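(* Suppose $u\in C\big([0,T_{max});\dot H^s_{\mathcal M}\big)$, $s>\frac52$, is an odd, permutation symmetric, $\sigma$-mirror symmetric solution of the Fourier-restricted hypodissipative Navier--Stokes equation (with $\nu>0$, $\alpha>0$) or of the Fourier-restricted Euler equation, with $T_{max}$ its maximal time of existence and Fourier coefficients $\psi(t)=(\psi_n(t))_{n\ge0}$, $\psi^0=\psi(0)$. Further suppose that $\psi_n(0)\ge0$ for all integers $n\ge0$. Then for all $0\le t<T_{max}$, $$\nabla u(\vec 0,t)=\lambda(t)\begin{pmatrix}0&-1&-1\\-1&0&-1\\-1&-1&0\end{pmatrix},\qquad \lambda(t)=12\sqrt2\,\pi\sum_{n=0}^{\infty}\psi_n(t)\frac{(\sqrt3)^n}{\big(1+\frac23(\frac34)^n\big)^{1/2}}\ge0.$$ Furthermore, for all $0\le t<T_{max}$, $$\|\psi(t)\|_{\mathcal H^1}^2\le\|\psi^0\|_{\mathcal H^1}^2\exp\left(\frac{\sqrt5}{3\sqrt3}\int_0^t\lambda(\tau)\,d\tau\right).$$ In particular, if $T_{max}<+\infty$, then $\int_0^{T_{max}}\lambda(t)\,dt=+\infty$.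
   Context: Function spaces: $\mathbb T^3=\mathbb R^3/\mathbb Z^3$, $\hat u(k)=\int_{\mathbb T^3}u(x)e^{-2\pi i k\cdot x}\,dx$ for $k\in\mathbb Z^3$. For $s\ge0$, $\dot H^s=\dot H^s(\mathbb T^3;\mathbb R^3)$ is the space of mean-zero $L^2$ vector fields with $\|u\|_{\dot H^s}^2=\sum_{k\ne0}(4\pi^2|k|^2)^s|\hat u(k)|^2<\infty$. $(-\Delta)^\alpha$ is the Fourier multiplier $(4\pi^2|k|^2)^\alpha$. Frequencies: let $\sigma=(1,1,1)$. For integers $m\ge0$ let $k^m=2^{2m}\sigma+3^m(1,0,-1)$, $h^m=2^{2m+1}\sigma+3^m(1,1,-2)$, $j^m=2^{2m+1}\sigma+3^m(2,-1,-1)$. For $v\in\mathbb R^3$, $\mathcal P[v]$ is the set of all vectors obtained by permuting the entries of $v$. Let $\mathcal M^+_{2m}=\mathcal P[k^m]$, $\mathcal M^+_{2m+1}=\mathcal P[h^m]\cup\mathcal P[j^m]$, $\mathcal M^+=\bigcup_{n\ge0}\mathcal M_n^+$, $\mathcal M=\mathcal M^+\cup(-\mathcal M^+)$. For $k\in\mathcal M$ let $P_k^\perp(\sigma)=\sigma-\frac{k\cdot\sigma}{|k|^2}k$ and $v^k=P_k^\perp(\sigma)/|P_k^\perp(\sigma)|$. Constraint space: $\dot H^s_{\mathcal M}$ is the set of $u\in\dot H^s(\mathbb T^3;\mathbb R^3)$ with $\operatorname{supp}\hat u\subset\mathcal M$ and $\hat u(k)\in\operatorname{span}\{v^k\}$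 (complex multiples of $v^k$) for all $k\in\mathcal M$. The projection $\mathbb P_{\mathcal M}$ is given by $\widehat{\mathbb P_{\mathcal M}w}(k)=(v^k\cdot\hat w(k))v^k$ for $k\in\mathcal M$ and $0$ for $k\notin\mathcal M$. Equations: the Fourier-restricted Euler equation is $\partial_tu+\mathbb P_{\mathcal M}((u\cdot\nabla)u)=0$ (solutions are $C^1$ in time with values in the space). The Fourier-restricted hypodissipative Navier--Stokes equation is $\partial_tu+\nu(-\Delta)^\alpha u+\mathbb P_{\mathcal M}((u\cdot\nabla)u)=0$, with solutions understood in the mild sense: $u(\cdot,t)=e^{-\nu t(-\Delta)^\alpha}u^0-\int_0^te^{-\nu(t-\tau)(-\Delta)^\alpha}\mathbb P_{\mathcal M}((u\cdot\nabla)u)(\cdot,\tau)\,d\tau$. Symmetries: $u$ is odd if $u(-x)=-u(x)$; permutation symmetric if $u(Px)=Pu(x)$ for every permutation $P$ of $\{1,2,3\}$ acting on vectors by $(Pv)_i=v_{P(i)}$; $\sigma$-mirror symmetric if $u(x)=M_\sigma u(M_\sigma x)$ for all $x$, where $M_\sigma=I_3-\frac23\sigma\otimes\sigma$ and $u$ is extended periodically to $\mathbb R^3$. An odd, permutation symmetric, $\sigma$-mirror symmetric $u\in\dot H^s_{\mathcal M}$ is written uniquely as $u(x)=-2\sum_{n\ge0}\psi_n\sum_{k\in\mathcal M_n^+}v^k\sin(2\pi k\cdot x)$ with real $\psi_n$; these are its Fourier coefficients. $\|\psi\|_{\mathcal H^s}^2=\sum_{n\ge0}(\sqrt3)^{2sn}\psi_n^2$.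 *)

theory Defs
  imports "HOL-Analysis.Analysis"
begin

type_synonym vfield = "real^3 \<Rightarrow> real^3"

section \<open>Fourier analysis on the torus\<close>

text \<open>Fields on the torus are \<open>\<int>\<^sup>3\<close>-periodic functions on \<open>\<real>\<^sup>3\<close>; frequencies live in \<open>int^3\<close>.\<close>

definition periodic :: "vfield \<Rightarrow> bool" where
  "periodic u \<longleftrightarrow> (\<forall>x i. u (x + axis i 1) = u x)"

definition cube :: "(real^3) set" where
  "cube = cbox 0 (\<chi> i. 1)"

definition rvec :: "int^3 \<Rightarrow> real^3" where
  "rvec k = (\<chi> i. real_of_int (k $ i))"

definition cvec :: "real^3 \<Rightarrow> complex^3" where
  "cvec v = (\<chi> i. complex_of_real (v $ i))"

definition fcoeff :: "vfield \<Rightarrow> int^3 \<Rightarrow> complex^3" where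
  "fcoeff u k =
     (\<chi> i. LINT x:cube|lebesgue.
             complex_of_real (u x $ i) * exp (- 2 * complex_of_real pi * \<i> * complex_of_real (rvec k \<bullet> x)))"

text \<open>The field with prescribed Fourier coefficients \<open>c\<close>. It is used only for coefficients of
  real fields (\<open>c (-k)\<close> conjugate to \<open>c k\<close>), for which the sum is real, and which are absolutely
  summable when \<open>s > 5/2\<close>.\<close>

definition fourier_series :: "(int^3 \<Rightarrow> complex^3) \<Rightarrow> vfield" where
  "fourier_series c x =
     (\<chi> i. Re (\<Sum>\<^sub>\<infinity>k\<in>UNIV. c k $ i * exp (2 * complex_of_real pi * \<i> * complex_of_real (rvec k \<bullet> x))))"

definition frac_symbol :: "real \<Rightarrow> int^3 \<Rightarrow> real" where
  "frac_symbol \<alpha> k = (4 * pi\<^sup>2 * (norm (rvec k))\<^sup>2) powr \<alpha>"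

definition mean_zero_L2 :: "vfield \<Rightarrow> bool" where
  "mean_zero_L2 u \<longleftrightarrow> periodic u \<and> u \<in> borel_measurable lebesgue \<and>
     set_integrable lebesgue cube (\<lambda>x. (norm (u x))\<^sup>2) \<and> (LINT x:cube|lebesgue. u x) = 0"

definition Hdot :: "real \<Rightarrow> vfield set" where
  "Hdot s = {u. mean_zero_L2 u \<and>
     (\<lambda>k. frac_symbol s k * (norm (fcoeff u k))\<^sup>2) summable_on (UNIV - {0})}"

definition Hdot_norm :: "real \<Rightarrow> vfield \<Rightarrow> real" where
  "Hdot_norm s u = sqrt (\<Sum>\<^sub>\<infinity>k\<in>UNIV - {0}. frac_symbol s k * (norm (fcoeff u k))\<^sup>2)"

section \<open>Frequencies and the constraint space\<close>

abbreviation sigma :: "'a::one^3" where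
  "sigma \<equiv> (\<chi> i. 1)"

definition kfreq :: "nat \<Rightarrow> int^3" where
  "kfreq m = 2^(2*m) *s sigma + 3^m *s vector [1, 0, -1]"

definition hfreq :: "nat \<Rightarrow> int^3" where
  "hfreq m = 2^(2*m+1) *s sigma + 3^m *s vector [1, 1, -2]"

definition jfreq :: "nat \<Rightarrow> int^3" where
  "jfreq m = 2^(2*m+1) *s sigma + 3^m *s vector [2, -1, -1]"

definition permute_vec :: "(3 \<Rightarrow> 3) \<Rightarrow> 'a^3 \<Rightarrow> 'a^3" where
  "permute_vec p v = (\<chi> i. v $ p i)"

definition perms :: "'a^3 \<Rightarrow> ('a^3) set" where
  "perms v = {permute_vec p v | p. bij p}"

definition Mplus :: "nat \<Rightarrow> (int^3) set" where
  "Mplus n = (if even n then perms (kfreq (n div 2))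
              else perms (hfreq (n div 2)) \<union> perms (jfreq (n div 2)))"

definition MM :: "(int^3) set" where
  "MM = (\<Union>n. Mplus n) \<union> uminus ` (\<Union>n. Mplus n)"

definition sigma_perp :: "int^3 \<Rightarrow> real^3" where
  "sigma_perp k = sigma - ((rvec k \<bullet> sigma) / (norm (rvec k))\<^sup>2) *\<^sub>R rvec k"

definition vdir :: "int^3 \<Rightarrow> real^3" where
  "vdir k = (1 / norm (sigma_perp k)) *\<^sub>R sigma_perp k"

definition Hdot_M :: "real \<Rightarrow> vfield set" where
  "Hdot_M s = {u \<in> Hdot s. (\<forall>k. fcoeff u k \<noteq> 0 \<longrightarrow> k \<in> MM) \<and>
                            (\<forall>k\<in>MM. \<exists>c::complex. fcoeff u k = c *s cvec (vdir k))}"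

definition proj_M :: "vfield \<Rightarrow> vfield" where
  "proj_M w = fourier_series
     (\<lambda>k. if k \<in> MM then (\<Sum>i\<in>UNIV. complex_of_real (vdir k $ i) * fcoeff w k $ i) *s cvec (vdir k)
          else 0)"

section \<open>The equations\<close>

text \<open>\<open>(u \<cdot> \<nabla>) u\<close> with the classical derivative, which exists for the
  continuous representative of an element of \<open>Hdot s\<close>, \<open>s > 5/2\<close>.\<close>

definition convect :: "vfield \<Rightarrow> vfield" where
  "convect u x = frechet_derivative u (at x) (u x)"

definition heat_op :: "real \<Rightarrow> real \<Rightarrow> real \<Rightarrow> vfield \<Rightarrow> vfield" where
  "heat_op \<nu> \<alpha> t w =
     fourier_series (\<lambda>k. complex_of_real (exp (- \<nu> * t * frac_symbol \<alpha> k)) *s fcoeff w k)"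

definition time_dom :: "ereal \<Rightarrow> real set" where
  "time_dom T = {t. 0 \<le> t \<and> ereal t < T}"

text \<open>\<open>C([0,T); Hdot_M s)\<close>. Elements of the space are classes of almost everywhere equal
  functions; for \<open>s > 3/2\<close> each is represented by its continuous member.\<close>

definition cont_path :: "real \<Rightarrow> ereal \<Rightarrow> (real \<Rightarrow> vfield) \<Rightarrow> bool" where
  "cont_path s T u \<longleftrightarrow>
     (\<forall>t\<in>time_dom T. u t \<in> Hdot_M s \<and> continuous_on UNIV (u t)) \<and>
     (\<forall>t\<in>time_dom T. ((\<lambda>\<tau>. Hdot_norm s (\<lambda>x. u \<tau> x - u t x)) \<longlongrightarrow> 0) (at t within time_dom T))"

definition nse_solution :: "real \<Rightarrow> real \<Rightarrow> real \<Rightarrow> ereal \<Rightarrow> (real \<Rightarrow> vfield) \<Rightarrow> bool" where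
  "nse_solution \<nu> \<alpha> s T u \<longleftrightarrow> cont_path s T u \<and>
     (\<forall>t\<in>time_dom T. \<forall>x.
        u t x = heat_op \<nu> \<alpha> t (u 0) x
                - (LINT \<tau>:{0..t}|lebesgue. heat_op \<nu> \<alpha> (t - \<tau>) (proj_M (convect (u \<tau>))) x))"

definition euler_solution :: "real \<Rightarrow> ereal \<Rightarrow> (real \<Rightarrow> vfield) \<Rightarrow> bool" where
  "euler_solution s T u \<longleftrightarrow> cont_path s T u \<and>
     (\<exists>u'. cont_path s T u' \<and>
        (\<forall>t\<in>time_dom T.
           ((\<lambda>\<tau>. Hdot_norm s (\<lambda>x. (1 / (\<tau> - t)) *\<^sub>R (u \<tau> x - u t x) - u' t x)) \<longlongrightarrow> 0)
             (at t within time_dom T)) \<and>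
        (\<forall>t\<in>time_dom T. \<forall>x. u' t x + proj_M (convect (u t)) x = 0))"

text \<open>A solution on \<open>[0,T)\<close> with \<open>T\<close> its maximal time of existence: it has no extension, as a
  solution in the same class, to a longer interval.\<close>

definition maximal_solution ::
  "(ereal \<Rightarrow> (real \<Rightarrow> vfield) \<Rightarrow> bool) \<Rightarrow> ereal \<Rightarrow> (real \<Rightarrow> vfield) \<Rightarrow> bool" where
  "maximal_solution sol T u \<longleftrightarrow> 0 < T \<and> sol T u \<and>
     \<not> (\<exists>T' v. T < T' \<and> sol T' v \<and> (\<forall>t\<in>time_dom T. v t = u t))"

section \<open>Symmetries and Fourier coefficients of symmetric fields\<close>

definition odd_field :: "vfield \<Rightarrow> bool" where
  "odd_field u \<longleftrightarrow> (\<forall>x. u (- x) = - u x)"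

definition permutation_symmetric :: "vfield \<Rightarrow> bool" where
  "permutation_symmetric u \<longleftrightarrow> (\<forall>p x. bij p \<longrightarrow> u (permute_vec p x) = permute_vec p (u x))"

definition M_sigma :: "real^3^3" where
  "M_sigma = mat 1 - (2/3) *\<^sub>R (\<chi> i j. sigma $ i * sigma $ j)"

definition mirror_symmetric :: "vfield \<Rightarrow> bool" where
  "mirror_symmetric u \<longleftrightarrow> (\<forall>x. u x = M_sigma *v u (M_sigma *v x))"

definition sym_partial_sum :: "(nat \<Rightarrow> real) \<Rightarrow> nat \<Rightarrow> vfield" where
  "sym_partial_sum \<psi> N x =
     - 2 *\<^sub>R (\<Sum>n<N. \<psi> n *\<^sub>R (\<Sum>k\<in>Mplus n. sin (2 * pi * (rvec k \<bullet> x)) *\<^sub>R vdir k))"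

text \<open>The sequence \<open>\<psi>\<close> with \<open>u(x) = -2 \<Sum>\<^sub>n \<psi>\<^sub>n \<Sum>\<^sub>k v\<^sup>k sin(2\<pi> k\<cdot>x)\<close> (inner sum over \<open>k \<in> Mplus n\<close>),
  the series converging in \<open>Hdot 0\<close>, i.e. in \<open>L\<^sup>2\<close>.\<close>

definition sym_coeffs :: "vfield \<Rightarrow> nat \<Rightarrow> real" where
  "sym_coeffs u =
     (THE \<psi>. (\<lambda>N. Hdot_norm 0 (\<lambda>x. u x - sym_partial_sum \<psi> N x)) \<longlonglongrightarrow> 0)"

definition seq_norm_summable :: "real \<Rightarrow> (nat \<Rightarrow> real) \<Rightarrow> bool" where
  "seq_norm_summable s \<psi> \<longleftrightarrow> summable (\<lambda>n. sqrt 3 powr (2 * s * real n) * (\<psi> n)\<^sup>2)"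

definition seq_norm :: "real \<Rightarrow> (nat \<Rightarrow> real) \<Rightarrow> real" where
  "seq_norm s \<psi> = sqrt (\<Sum>n. sqrt 3 powr (2 * s * real n) * (\<psi> n)\<^sup>2)"

end

theory Submission
  imports Defs
begin

text \<open>
  An odd, permutation and mirror symmetric field in the constraint space has one real coefficient
  \<open>\<psi>\<^sub>n\<close> per level, and only triads with two frequencies of level \<open>n\<close> and one of level \<open>n + 1\<close>
  interact. Hence both equations reduce to the shell model
  \<open>\<psi>\<^sub>n' = - d\<^sub>n \<psi>\<^sub>n + A\<^sub>n\<^sub>-\<^sub>1 \<psi>\<^sub>n\<^sub>-\<^sub>1\<^sup>2 - A\<^sub>n \<psi>\<^sub>n \<psi>\<^sub>n\<^sub>+\<^sub>1\<close>.
  Its source term is a square, so an integrating factor preserves positivity. The gradient at the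
  origin is \<open>\<lambda> = 12 \<pi> \<Sum>\<^sub>n 2\<^sup>n |P\<^sup>\<bottom>\<sigma>| \<psi>\<^sub>n\<close>; positivity gives \<open>4 A\<^sub>n \<psi>\<^sub>n\<^sub>+\<^sub>1 \<le> \<lambda> / 3\<close>, from which summation by
  parts yields the energy inequality, and \<open>A\<^sub>n \<psi>\<^sub>n \<le> \<lambda>\<close>, so that \<open>\<psi>\<^sub>n' \<le> \<lambda> \<psi>\<^sub>n\<^sub>-\<^sub>1\<close>. If
  \<open>\<integral> \<lambda>\<close> is finite up to a finite time, the latter bounds every \<open>\<psi>\<^sub>n\<close> by a fixed sequence in the
  weighted space, with respect to which the nonlinearity is Lipschitz in a weighted supremum norm,
  and a fixed point argument started at that time continues the solution.
\<close>

section \<open>Absolutely convergent Fourier series\<close>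

text \<open>Every frequency of \<open>Mplus n\<close> has component sum \<open>3 * 2 ^ n\<close>, so
  in a triad two powers of 2 add up to a third one; this forces the levels n, n, n + 1. Lengths and
  angles inside a triad then depend on n alone, which leaves one coupling constant per level. The
  obstacle to continuation is that the couplings \<open>Ac\<close> are unbounded, so the quadratic
  term loses derivatives, and that the dissipation rates are unbounded as well. A majorant
  \<open>M\<close> repairs the first point if it decays fast enough for \<open>Ac n * M n\<close> to
  stay bounded, but no faster than geometrically, so that the source from shell n - 1 is still a
  multiple of \<open>M n\<close>. The envelope \<open>env\<close> of the initial data is built to
  have both properties. Duhamel's formula removes the dissipation rates from all estimates.
  Restarting from the limits of the coefficients at the final time makes the prolongation agree with
  the given solution by construction. The energy argument yields the rate 1/3, which lies below the
  stated \<open>sqrt 5 / (3 * sqrt 3)\<close>.\<close>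

definition fchar :: "int^3 \<Rightarrow> real^3 \<Rightarrow> complex" where
  "fchar k x = exp (2 * complex_of_real pi * \<i> * complex_of_real (rvec k \<bullet> x))"

definition fc :: "(real^3 \<Rightarrow> complex) \<Rightarrow> int^3 \<Rightarrow> complex" where
  "fc f k = (LINT x:cube|lebesgue. f x * fchar (- k) x)"

lemma rvec_simps [simp]:
  "rvec 0 = 0" "rvec (- k) = - rvec k" "rvec (k + l) = rvec k + rvec l" "rvec (k - l) = rvec k - rvec l"
  "rvec k $ i = real_of_int (k $ i)"
  by (simp_all add: rvec_def vec_eq_iff)

lemma fchar_simps [simp]:
  "fchar 0 x = 1" "norm (fchar k x) = 1" "fchar k x \<noteq> 0" "fchar k 0 = 1"
  by (simp_all add: fchar_def norm_exp_eq_Re)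

lemma fchar_add: "fchar (k + l) x = fchar k x * fchar l x"
  by (simp add: fchar_def exp_add [symmetric] inner_add_left algebra_simps)

lemma fchar_minus: "fchar (- k) x = cnj (fchar k x)"
  by (simp add: fchar_def exp_cnj)

lemma fchar_cis: "fchar k x = cis (2 * pi * (rvec k \<bullet> x))"
  by (simp add: fchar_def cis_conv_exp mult_ac)

lemma continuous_fchar [continuous_intros]: "continuous_on S (fchar k)"
  unfolding fchar_def by (intro continuous_intros)

lemma fchar_periodic: "fchar k (x + axis i 1) = fchar k x"
proof -
  have "rvec k \<bullet> axis i 1 = real_of_int (k $ i)"
    by (simp add: inner_axis)
  then have "fchar k (x + axis i 1) = fchar k x * cis (2 * pi * real_of_int (k $ i))"
    unfolding fchar_cis inner_add_right distrib_left cis_mult [symmetric] by simp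
  also have "cis (2 * pi * real_of_int (k $ i)) = 1"
    by (rule cis_multiple_2pi) simp
  finally show ?thesis
    by simp
qed

lemma fcoeff_eq_fc: "fcoeff u k $ i = fc (\<lambda>x. complex_of_real (u x $ i)) k"
  by (simp add: fcoeff_def fc_def fchar_def)

lemma compact_cube: "compact cube"
  by (simp add: cube_def compact_cbox)

lemma mem_Basis_real3: "b \<in> (Basis :: (real^3) set) \<longleftrightarrow> (\<exists>i. b = axis i 1)"
  by (auto simp: Basis_vec_def)

section \<open>Orthogonality of the characters on the unit cube\<close>

lemma indicator_cube:
  "indicator cube x = (\<Prod>b\<in>Basis. indicator {0..1::real} (x \<bullet> b) :: real)"
proof (cases "x \<in> cube")
  case True
  then have "x \<bullet> b \<in> {0..1}" if "b \<in> Basis" for b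
    using that by (auto simp: cube_def mem_box_cart mem_Basis_real3 inner_axis)
  then show ?thesis
    using True by (simp add: prod.neutral)
next
  case False
  then obtain i where "x $ i \<notin> {0..1}"
    by (auto simp: cube_def mem_box_cart)
  then have "\<exists>b\<in>Basis. indicator {0..1} (x \<bullet> b) = (0::real)"
    by (intro bexI[of _ "axis i 1"]) (auto simp: inner_axis mem_Basis_real3)
  then have "(\<Prod>b\<in>Basis. indicator {0..1} (x \<bullet> b)) = (0::real)"
    by (intro prod_zero) auto
  then show ?thesis
    using False by simp
qed

text \<open>Continuous integrands are Borel measurable, so the Lebesgue integrals of the definitions
  may be computed over \<open>lborel\<close>, where the product structure of the space is
  available.\<close>

lemma integrable_cube:
  fixes f :: "real^3 \<Rightarrow> 'a::euclidean_space"
  assumes "continuous_on UNIV f"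
  shows "integrable lborel (\<lambda>x. indicator cube x *\<^sub>R f x)" "set_integrable lebesgue cube f"
    "(LINT x:cube|lebesgue. f x) = (LINT x|lborel. indicator cube x *\<^sub>R f x)"
proof -
  show 1: "integrable lborel (\<lambda>x. indicator cube x *\<^sub>R f x)"
    by (rule borel_integrable_compact [OF compact_cube]) (use assms continuous_on_subset in blast)
  have "(\<lambda>x. indicator cube x *\<^sub>R f x) \<in> borel_measurable lborel"
    using 1 by (rule borel_measurable_integrable)
  then show "set_integrable lebesgue cube f"
    "(LINT x:cube|lebesgue. f x) = (LINT x|lborel. indicator cube x *\<^sub>R f x)"
    using 1 by (simp_all add: set_integrable_def set_lebesgue_integral_def integrable_completion integral_completion)
qed

lemma integral_unit_interval_cis:
  "(LINT t|lborel. indicator {0..1} t *\<^sub>R cis (2 * pi * real_of_int m * t)) = (if m = 0 then 1 else 0)"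
proof (cases "m = 0")
  case False
  define c where "c = 2 * pi * real_of_int m"
  have c: "c \<noteq> 0" using False by (simp add: c_def)
  have "(LINT t|lborel. indicator {0..1} t *\<^sub>R cis (c * t)) = - \<i> / c * cis (c * 1) - (- \<i> / c * cis (c * 0))"
  proof (rule integral_FTC_atLeastAtMost)
    fix x :: real
    have "((\<lambda>x. cis (c * x)) has_vector_derivative (c *\<^sub>R (\<i> * cis (c * x)))) (at x within {0..1})"
      unfolding has_vector_derivative_def
      by (rule has_derivative_eq_rhs, rule has_derivative_cis) (auto intro!: derivative_eq_intros)
    then have "((\<lambda>x. (- \<i> / c) * cis (c * x)) has_vector_derivative (- \<i> / c) * (c *\<^sub>R (\<i> * cis (c * x)))) (at x within {0..1})"
      by (rule has_vector_derivative_mult_right)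
    moreover have "(- \<i> / c) * (c *\<^sub>R (\<i> * cis (c * x))) = cis (c * x)"
      using c by (simp add: scaleR_conv_of_real field_simps)
    ultimately show "((\<lambda>x. - \<i> / complex_of_real c * cis (c * x)) has_vector_derivative cis (c * x)) (at x within {0..1})"
      by simp
  qed (auto intro!: continuous_intros simp: cis_conv_exp)
  also have "cis (c * 1) = 1"
    by (simp add: c_def cis_multiple_2pi)
  finally show ?thesis
    using False by (simp add: c_def)
qed simp

text \<open>The indicator of the cube and the character both factor over the coordinates, so Fubini
  reduces the integral to integrals over the unit interval; a nonzero component of \<open>k\<close>
  makes one of them vanish.\<close>

lemma integral_cube_fchar: "(LINT x:cube|lebesgue. fchar k x) = (if k = 0 then 1 else 0)"
proof -
  define m where "m b = (THE j. real_of_int j = rvec k \<bullet> b)" for b :: "real^3"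
  have m: "rvec k \<bullet> b = real_of_int (m b)" if "b \<in> Basis" for b
  proof -
    obtain i where "b = axis i 1" using \<open>b \<in> Basis\<close> by (auto simp: mem_Basis_real3)
    then have "rvec k \<bullet> b = real_of_int (k $ i)" by (simp add: inner_axis)
    then show ?thesis by (simp add: m_def)
  qed
  define g where "g b t = indicator {0..1} t *\<^sub>R cis (2 * pi * real_of_int (m b) * t)" for b t
  interpret product_sigma_finite "\<lambda>_::real^3. lborel :: real measure" by standard
  have gi: "integrable lborel (g b)" for b
    unfolding g_def by (rule borel_integrable_compact) (auto intro!: continuous_intros simp: cis_conv_exp)
  have "(LINT x:cube|lebesgue. fchar k x) = (LINT x|lborel. indicator cube x *\<^sub>R fchar k x)"
    by (rule integrable_cube) (rule continuous_fchar)
  also have "(\<lambda>x. indicator cube x *\<^sub>R fchar k x) = (\<lambda>x. \<Prod>b\<in>Basis. g b (x \<bullet> b))"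
  proof
    fix x
    have "rvec k \<bullet> x = (\<Sum>b\<in>Basis. (rvec k \<bullet> b) * (x \<bullet> b))"
      by (rule euclidean_inner)
    then have "fchar k x = cis (\<Sum>b\<in>Basis. 2 * pi * real_of_int (m b) * (x \<bullet> b))"
      by (simp add: fchar_cis m sum_distrib_left mult_ac)
    also have "\<dots> = (\<Prod>b\<in>Basis. cis (2 * pi * real_of_int (m b) * (x \<bullet> b)))"
      by (simp add: cis_conv_exp exp_sum sum_distrib_left)
    finally show "indicator cube x *\<^sub>R fchar k x = (\<Prod>b\<in>Basis. g b (x \<bullet> b))"
      by (simp add: g_def indicator_cube scaleR_conv_of_real prod.distrib)
  qed
  also have "(LINT x|lborel. (\<Prod>b\<in>Basis. g b (x \<bullet> b))) = (LINT f|(Pi\<^sub>M Basis (\<lambda>_. lborel)). (\<Prod>b\<in>Basis. g b (f b)))"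
  proof (subst lborel_eq, subst integral_distr)
    have "g b \<in> borel_measurable borel" for b using gi[of b] by auto
    then show "(\<lambda>x. \<Prod>b\<in>Basis. g b (x \<bullet> b)) \<in> borel_measurable borel" by measurable
  qed simp_all
  also have "\<dots> = (\<Prod>b\<in>Basis. LINT t|lborel. g b t)"
    by (rule product_integral_prod) (auto simp: gi)
  also have "\<dots> = (\<Prod>b\<in>Basis. if m b = 0 then 1 else 0)"
    unfolding g_def integral_unit_interval_cis ..
  also have "\<dots> = (if k = 0 then 1 else 0)"
  proof (cases "k = 0")
    case True
    then have "m b = 0" if "b \<in> Basis" for b using m[OF that] by simp
    then show ?thesis using True by simp
  next
    case False
    then obtain i where "k $ i \<noteq> 0" by (metis vec_eq_iff zero_index)
    moreover have B: "axis i 1 \<in> (Basis :: (real^3) set)" by (auto simp: mem_Basis_real3)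
    ultimately have "m (axis i 1) \<noteq> 0"
      using m[OF B] by (auto simp: inner_axis)
    with B show ?thesis using False by (auto simp: prod_zero_iff)
  qed
  finally show ?thesis .
qed

section \<open>Linearity, frequency shift and size of Fourier coefficients\<close>

lemma fc_const: "fc (\<lambda>x. c) k = (if k = 0 then c else 0)"
proof -
  have "fc (\<lambda>x. c) k = c * (LINT x:cube|lebesgue. fchar (- k) x)"
    by (simp add: fc_def)
  then show ?thesis by (simp add: integral_cube_fchar)
qed

lemma fc_add:
  assumes "continuous_on UNIV f" "continuous_on UNIV g"
  shows "fc (\<lambda>x. f x + g x) k = fc f k + fc g k"
  unfolding fc_def distrib_right
  by (intro set_integral_add integrable_cube continuous_intros assms)

lemma fc_diff:
  assumes "continuous_on UNIV f" "continuous_on UNIV g"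
  shows "fc (\<lambda>x. f x - g x) k = fc f k - fc g k"
  unfolding fc_def left_diff_distrib
  by (intro set_integral_diff integrable_cube continuous_intros assms)

lemma fc_cmult: "fc (\<lambda>x. c * f x) k = c * fc f k"
  unfolding fc_def by (simp add: mult.assoc)

lemma fc_sum:
  assumes "finite I" "\<And>i. i \<in> I \<Longrightarrow> continuous_on UNIV (f i)"
  shows "fc (\<lambda>x. \<Sum>i\<in>I. f i x) k = (\<Sum>i\<in>I. fc (f i) k)"
  using assms
proof (induction I rule: finite_induct)
  case (insert a I)
  then show ?case by (simp add: fc_add continuous_on_sum)
qed (simp add: fc_def)

lemma fc_mult_fchar: "fc (\<lambda>x. f x * fchar h x) k = fc f (k - h)"
  by (simp add: fc_def mult.assoc fchar_add [symmetric])

lemma fc_cnj: "fc (\<lambda>x. cnj (f x)) k = cnj (fc f (- k))"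
proof -
  have "fc (\<lambda>x. cnj (f x)) k = (CLINT x|lebesgue. cnj (indicator cube x *\<^sub>R (f x * fchar k x)))"
    by (simp add: fc_def set_lebesgue_integral_def fchar_minus)
  also have "\<dots> = cnj (CLINT x|lebesgue. indicator cube x *\<^sub>R (f x * fchar k x))"
    by (rule Bochner_Integration.integral_cnj)
  finally show ?thesis
    by (simp add: fc_def set_lebesgue_integral_def)
qed

lemma norm_fc_le:
  assumes "continuous_on UNIV f" "\<And>x. norm (f x) \<le> B"
  shows "norm (fc f k) \<le> B"
proof -
  have c: "continuous_on UNIV (\<lambda>x. f x * fchar (- k) x)"
    by (intro continuous_intros assms)
  have "norm (fc f k) \<le> (LINT x|lborel. norm (indicator cube x *\<^sub>R (f x * fchar (- k) x)))"
    unfolding fc_def integrable_cube(3)[OF c] by (rule integral_norm_bound)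
  also have "\<dots> \<le> (LINT x|lborel. indicator cube x *\<^sub>R B)"
  proof (rule integral_mono)
    show "integrable lborel (\<lambda>x. norm (indicator cube x *\<^sub>R (f x * fchar (- k) x)))"
      using integrable_cube(1)[OF c] by (rule integrable_norm)
    show "integrable lborel (\<lambda>x. indicator cube x *\<^sub>R B)"
      by (rule integrable_cube) (rule continuous_on_const)
  qed (auto simp: norm_mult assms(2) indicator_def)
  also have "\<dots> = B * measure lborel cube"
    by simp
  also have "measure lborel cube = 1"
    by (simp add: cube_def content_cbox_cart interval_eq_empty_cart)
  finally show ?thesis by simp
qed

instance bcontfun :: (metric_space, banach) banach ..

definition cser :: "(int^3 \<Rightarrow> complex) \<Rightarrow> real^3 \<Rightarrow> complex" where
  "cser a x = (\<Sum>\<^sub>\<infinity>k. a k * fchar k x)"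

text \<open>The series is summed in the Banach space of bounded continuous functions, so that bounded
  linear functionals may be applied term by term.\<close>

lemma cser_bcontfun:
  assumes "(\<lambda>k. norm (a k)) summable_on UNIV"
  obtains \<phi> :: "(real^3, complex) bcontfun" and T where
    "(T has_sum \<phi>) UNIV" "\<And>k x. apply_bcontfun (T k) x = a k * fchar k x"
    "\<And>x. apply_bcontfun \<phi> x = cser a x"
proof -
  define T where "T k = Bcontfun (\<lambda>x. a k * fchar k x)" for k
  have "(\<lambda>x. a k * fchar k x) \<in> bcontfun" for k
    by (rule bcontfun_normI [where b = "norm (a k)"]) (auto intro!: continuous_intros simp: norm_mult)
  then have T: "apply_bcontfun (T k) x = a k * fchar k x" for k x
    by (simp add: T_def Bcontfun_inverse)
  have "norm (T k) \<le> norm (a k)" for k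
    by (rule norm_bound) (simp add: T norm_mult)
  with assms have "(\<lambda>k. norm (T k)) summable_on UNIV"
    by (intro Infinite_Sum.abs_summable_on_comparison_test' [where f = T and g = "\<lambda>k. norm (a k)"]) auto
  then have "T summable_on UNIV"
    by (rule Infinite_Sum.abs_summable_summable)
  then have sum: "(T has_sum infsum T UNIV) UNIV"
    by (rule has_sum_infsum)
  have "apply_bcontfun (infsum T UNIV) x = cser a x" for x
  proof -
    have "bounded_linear (\<lambda>\<phi>::(real^3, complex) bcontfun. apply_bcontfun \<phi> x)"
      by (rule bounded_linear_intro [where K = 1]) (auto simp: norm_bounded)
    from has_sum_bounded_linear [OF this sum]
    have "((\<lambda>k. a k * fchar k x) has_sum apply_bcontfun (infsum T UNIV) x) UNIV"
      by (simp add: T o_def)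
    then show ?thesis
      unfolding cser_def by (simp add: infsumI)
  qed
  with T sum show thesis by (intro that)
qed

lemma continuous_cser:
  assumes "(\<lambda>k. norm (a k)) summable_on UNIV"
  shows "continuous_on S (cser a)"
  using assms
proof (rule cser_bcontfun)
  fix \<phi> :: "(real^3, complex) bcontfun" and T
  assume "\<And>x. apply_bcontfun \<phi> x = cser a x"
  then have "cser a = apply_bcontfun \<phi>" by auto
  then show ?thesis by simp
qed

lemma has_sum_cser:
  assumes "(\<lambda>k. norm (a k)) summable_on UNIV"
  shows "((\<lambda>k. a k * fchar k x) has_sum cser a x) UNIV"
proof -
  have "(\<lambda>k. norm (a k * fchar k x)) summable_on UNIV"
    using assms by (simp add: norm_mult)
  then show ?thesis
    unfolding cser_def by (rule has_sum_infsum [OF Infinite_Sum.abs_summable_summable])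
qed

lemma cser_periodic: "cser a (x + axis i 1) = cser a x"
  by (simp add: cser_def fchar_periodic)

text \<open>Only one factor is a series: integration against \<open>g\<close> and a character is a
  bounded linear functional on bounded continuous functions, so it applies term by term, and each
  term merely shifts the frequency at which \<open>g\<close> is tested.\<close>

lemma fc_cser_mult:
  assumes a: "(\<lambda>k. norm (a k)) summable_on UNIV"
    and g: "continuous_on UNIV g" "\<And>x. norm (g x) \<le> B"
  shows "((\<lambda>h. a h * fc g (k - h)) has_sum fc (\<lambda>x. cser a x * g x) k) UNIV"
  using a
proof (rule cser_bcontfun)
  fix \<phi> :: "(real^3, complex) bcontfun" and T
  assume sum: "(T has_sum \<phi>) UNIV" and T: "\<And>k x. apply_bcontfun (T k) x = a k * fchar k x"
    and \<phi>: "\<And>x. apply_bcontfun \<phi> x = cser a x"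
  have "bounded_linear (\<lambda>\<phi>::(real^3, complex) bcontfun. fc (\<lambda>x. apply_bcontfun \<phi> x * g x) k)"
  proof (rule bounded_linear_intro [where K = B])
    fix \<phi> \<psi> :: "(real^3, complex) bcontfun" and r :: real
    show "fc (\<lambda>x. apply_bcontfun (\<phi> + \<psi>) x * g x) k =
        fc (\<lambda>x. apply_bcontfun \<phi> x * g x) k + fc (\<lambda>x. apply_bcontfun \<psi> x * g x) k"
      by (subst fc_add [symmetric]) (auto intro!: continuous_intros g simp: distrib_right)
    show "fc (\<lambda>x. apply_bcontfun (r *\<^sub>R \<phi>) x * g x) k = r *\<^sub>R fc (\<lambda>x. apply_bcontfun \<phi> x * g x) k"
      by (simp add: scaleR_conv_of_real fc_cmult mult.assoc)
    show "norm (fc (\<lambda>x. apply_bcontfun \<phi> x * g x) k) \<le> norm \<phi> * B"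
      by (rule norm_fc_le) (auto intro!: continuous_intros g mult_mono norm_bounded simp: norm_mult)
  qed
  from has_sum_bounded_linear [OF this sum] show ?thesis
    by (simp add: T \<phi> o_def mult.assoc fc_cmult fc_mult_fchar mult.commute [of "fchar _ _"])
qed

lemma fc_cser:
  assumes "(\<lambda>k. norm (a k)) summable_on UNIV"
  shows "fc (cser a) k = a k"
proof -
  have "((\<lambda>h. a h * fc (\<lambda>x. 1) (k - h)) has_sum fc (\<lambda>x. cser a x * 1) k) UNIV"
    by (rule fc_cser_mult [where B = 1]) (use assms in auto)
  then have "((\<lambda>h. a h * fc (\<lambda>x. 1) (k - h)) has_sum fc (cser a) k) UNIV"
    by simp
  moreover have "((\<lambda>h. a h * fc (\<lambda>x. 1) (k - h)) has_sum a k) UNIV"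
    by (rule has_sum_finite_neutralI [where B = "{k}"]) (auto simp: fc_const)
  ultimately show ?thesis
    by (rule has_sum_unique)
qed

subsection \<open>Uniqueness of Fourier coefficients\<close>

lemma periodic_shift:
  fixes f :: "real^3 \<Rightarrow> 'a"
  assumes "\<And>x i. f (x + axis i 1) = f x"
  shows "f (x + rvec k) = f x"
proof -
  have n: "f (x + real n *\<^sub>R axis i 1) = f x" for x i and n :: nat
  proof (induction n)
    case (Suc n)
    have "f (x + real (Suc n) *\<^sub>R axis i 1) = f ((x + real n *\<^sub>R axis i 1) + axis i 1)"
      by (simp add: algebra_simps scaleR_left_distrib)
    with Suc show ?case by (simp add: assms)
  qed simp
  have z: "f (x + real_of_int m *\<^sub>R axis i 1) = f x" for x i m
  proof (cases "m \<ge> 0")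
    case True
    then show ?thesis using n[of x "nat m" i] by simp
  next
    case False
    then show ?thesis using n[of "x + real_of_int m *\<^sub>R axis i 1" "nat (- m)" i]
      by (simp add: scaleR_left_distrib [symmetric] add.assoc)
  qed
  have "rvec k = (\<Sum>i\<in>UNIV. real_of_int (k $ i) *\<^sub>R axis i 1)"
    by (simp add: vec_eq_iff sum_3 axis_def forall_3)
  then have "x + rvec k = ((x + real_of_int (k $ 1) *\<^sub>R axis 1 1) + real_of_int (k $ 2) *\<^sub>R axis 2 1)
      + real_of_int (k $ 3) *\<^sub>R axis 3 1"
    by (simp add: sum_3 add.assoc)
  then show ?thesis by (simp only: z)
qed

lemma exists_shift_to_cube: "\<exists>k. x + rvec k \<in> cube"
proof
  show "x + rvec (\<chi> i. - \<lfloor>x $ i\<rfloor>) \<in> cube"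
    by (auto simp: cube_def mem_box_cart) linarith+
qed

text \<open>The function \<open>f\<close> factors as \<open>g\<close> after \<open>e\<close> through
  a compact torus \<open>K\<close> in complex 3-space. Stone-Weierstrass approximates
  \<open>g\<close> by functions \<open>h\<close> for which \<open>f x * h (e x)\<close> still has
  mean zero, so the mean of \<open>f * f\<close> equals that of \<open>f\<close> times the error,
  which is arbitrarily small.\<close>

lemma continuous_periodic_fc_zero_real:
  fixes f :: "real^3 \<Rightarrow> real"
  assumes cont: "continuous_on UNIV f" and per: "\<And>x i. f (x + axis i 1) = f x"
    and zero: "\<And>k. fc (\<lambda>x. complex_of_real (f x)) k = 0"
  shows "f x = 0"
proof -
  define e :: "real^3 \<Rightarrow> complex^3" where "e x = (\<chi> i. cis (2 * pi * x $ i))" for x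
  have e_cont: "continuous_on S e" for S
    unfolding e_def by (intro continuous_intros)
  have e_eq: "f x = f y" if "e x = e y" for x y
  proof -
    have "\<exists>n::int. x $ i = y $ i + n" for i
    proof -
      have "cis (2 * pi * x $ i) = cis (2 * pi * y $ i)"
        using that by (simp add: e_def vec_eq_iff)
      then obtain n :: int where "2 * pi * x $ i = 2 * pi * y $ i + 2 * pi * n"
        by (metis cis.sel sin_cos_eq_iff)
      then have "2 * pi * (x $ i) = 2 * pi * (y $ i + n)"
        by (simp add: algebra_simps)
      then have "x $ i = y $ i + n" by simp
      then show ?thesis ..
    qed
    then obtain n where n: "\<And>i. x $ i = y $ i + real_of_int (n i)" by metis
    then have "x = y + rvec (\<chi> i. n i)" by (simp add: vec_eq_iff)
    then show ?thesis by (simp add: periodic_shift [of f, OF per])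
  qed
  have e_shift: "e (x + rvec k) = e x" for x k
  proof -
    have "cis (2 * pi * (x $ i + real_of_int (k $ i))) = cis (2 * pi * x $ i) * cis (2 * pi * real_of_int (k $ i))" for i
      by (simp only: cis_mult distrib_left)
    then show ?thesis by (simp add: e_def vec_eq_iff)
  qed
  define K where "K = e ` cube"
  have K: "e x \<in> K" for x
  proof -
    obtain k where "x + rvec k \<in> cube" using exists_shift_to_cube by blast
    then have "e (x + rvec k) \<in> K" unfolding K_def by blast
    then show ?thesis by (simp add: e_shift)
  qed
  have "compact K"
    unfolding K_def by (intro compact_continuous_image e_cont compact_cube)
  \<comment> \<open>The chosen preimage does not matter, by \<open>e_eq\<close>.\<close>
  define g where "g z = f (SOME x. e x = z)" for z
  have g: "g (e x) = f x" for x
    unfolding g_def by (rule e_eq) (rule someI_ex, blast)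
  \<comment> \<open>Preimages of closed sets are closed because they are images under
    \<open>e\<close> of compact subsets of the cube.\<close>
  have g_cont: "continuous_on K g"
  proof (subst continuous_on_closed_vimage)
    show "closed K" using \<open>compact K\<close> by (rule compact_imp_closed)
    show "\<forall>B. closed B \<longrightarrow> closed (g -` B \<inter> K)"
    proof (intro allI impI)
      fix B :: "real set" assume "closed B"
      have "g -` B \<inter> K = e ` (f -` B \<inter> cube)"
        by (auto simp: K_def g)
      moreover have "compact (f -` B \<inter> cube)"
        using \<open>closed B\<close> cont compact_cube
        by (intro closed_Int_compact continuous_closed_vimage) (auto simp: continuous_on_eq_continuous_at)
      ultimately show "closed (g -` B \<inter> K)"
        by (simp add: compact_imp_closed compact_continuous_image e_cont)
    qed
  qed
  have fe: "f x = g (e x)" for x by (simp add: g)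
  obtain B where B: "\<And>x. \<bar>f x\<bar> \<le> B"
  proof -
    have "bounded (g ` K)"
      using \<open>compact K\<close> g_cont by (intro compact_imp_bounded compact_continuous_image)
    then show ?thesis using that K g by (metis bounded_real imageI)
  qed
  \<comment> \<open>Admissible are the \<open>h\<close> for which multiplication by
    \<open>h (e x)\<close> preserves the vanishing of all Fourier coefficients; quantifying over
    every \<open>G\<close> is what closes the class under products.\<close>
  define P where "P h \<longleftrightarrow> continuous_on UNIV h \<and> (\<forall>G. continuous_on UNIV G \<longrightarrow> (\<forall>k. fc G k = 0) \<longrightarrow>
      (\<forall>k. fc (\<lambda>x. G x * complex_of_real (h (e x))) k = 0))" for h :: "complex^3 \<Rightarrow> real"
  have he: "continuous_on UNIV (\<lambda>x. complex_of_real (h (e x)))" if "continuous_on UNIV h" for h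
    by (intro continuous_intros continuous_on_compose2 [OF that e_cont]) auto
  have PRe: "P (\<lambda>z. Re (z $ i))" and PIm: "P (\<lambda>z. Im (z $ i))" for i
  proof -
    have r: "rvec (axis i 1) \<bullet> x = x $ i" for x
    proof -
      have "rvec (axis i 1) = axis i 1" by (simp add: vec_eq_iff axis_def)
      then show ?thesis by (simp add: inner_axis')
    qed
    \<comment> \<open>Multiplication by a combination of two characters only shifts and combines
      coefficients; real and imaginary parts of the coordinates are such combinations.\<close>
    have lin: "P h" if h: "continuous_on UNIV h"
      and eq: "\<And>x. complex_of_real (h (e x)) = c * fchar a x + d * fchar b x" for h c d a b
      unfolding P_def
    proof (intro conjI allI impI h)
      fix G k assume G: "continuous_on UNIV G" "\<forall>k. fc G k = 0"
      have "(\<lambda>x. G x * complex_of_real (h (e x))) = (\<lambda>x. c * (G x * fchar a x) + d * (G x * fchar b x))"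
        by (simp add: eq algebra_simps)
      moreover have "fc (\<lambda>x. c * (G x * fchar a x) + d * (G x * fchar b x)) k
          = c * fc G (k - a) + d * fc G (k - b)"
        by (subst fc_add) (auto intro!: continuous_intros G(1) simp: fc_cmult fc_mult_fchar)
      ultimately show "fc (\<lambda>x. G x * complex_of_real (h (e x))) k = 0"
        using G(2) by simp
    qed
    show "P (\<lambda>z. Re (z $ i))"
      by (rule lin [of _ "1/2" "axis i 1" "1/2" "- axis i 1"])
        (auto intro!: continuous_intros simp: fchar_cis r e_def complex_eq_iff)
    show "P (\<lambda>z. Im (z $ i))"
      by (rule lin [of _ "- \<i> / 2" "axis i 1" "\<i> / 2" "- axis i 1"])
        (auto intro!: continuous_intros simp: fchar_cis r e_def complex_eq_iff)
  qed
  have sq_small: "norm (fc (\<lambda>x. complex_of_real (f x * f x)) 0) \<le> B * \<epsilon>" if "\<epsilon> > 0" for \<epsilon>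
  proof -
    have "\<exists>h. P h \<and> (\<forall>z\<in>K. \<bar>g z - h z\<bar> < \<epsilon>)"
    proof (rule Stone_Weierstrass_HOL [OF \<open>compact K\<close> _ _ _ _ _ g_cont \<open>\<epsilon> > 0\<close>])
      show "P (\<lambda>x. c)" for c
        by (auto simp: P_def mult.commute [of _ "complex_of_real c"] fc_cmult)
      show "continuous_on K h" if "P h" for h
        using that continuous_on_subset unfolding P_def by blast
      show "P (\<lambda>x. h1 x + h2 x)" if "P h1 \<and> P h2" for h1 h2
      proof -
        have "fc (\<lambda>x. G x * complex_of_real (h1 (e x)) + G x * complex_of_real (h2 (e x))) k = 0"
          if "continuous_on UNIV G" "\<forall>k. fc G k = 0" for G k
          using \<open>P h1 \<and> P h2\<close> that by (subst fc_add) (auto intro!: continuous_on_mult he simp: P_def)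
        moreover have "continuous_on UNIV (\<lambda>x. h1 x + h2 x)"
          using that by (intro continuous_on_add) (auto simp: P_def)
        ultimately show ?thesis
          by (simp add: P_def distrib_left)
      qed
      show "P (\<lambda>x. h1 x * h2 x)" if "P h1 \<and> P h2" for h1 h2
      proof -
        have "fc (\<lambda>x. (G x * complex_of_real (h1 (e x))) * complex_of_real (h2 (e x))) k = 0"
          if "continuous_on UNIV G" "\<forall>k. fc G k = 0" for G k
        proof -
          have "continuous_on UNIV (\<lambda>x. G x * complex_of_real (h1 (e x)))"
            using \<open>P h1 \<and> P h2\<close> that by (intro continuous_on_mult he) (auto simp: P_def)
          moreover have "\<forall>k. fc (\<lambda>x. G x * complex_of_real (h1 (e x))) k = 0"
            using \<open>P h1 \<and> P h2\<close> that by (auto simp: P_def)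
          ultimately show ?thesis
            using \<open>P h1 \<and> P h2\<close> unfolding P_def by blast
        qed
        moreover have "continuous_on UNIV (\<lambda>x. h1 x * h2 x)"
          using that by (intro continuous_on_mult) (auto simp: P_def)
        ultimately show ?thesis
          by (simp add: P_def mult.assoc)
      qed
      show "\<exists>h. P h \<and> h x \<noteq> h y" if xy: "x \<in> K \<and> y \<in> K \<and> x \<noteq> y" for x y
      proof -
        obtain i where "x $ i \<noteq> y $ i" using xy by (auto simp: vec_eq_iff)
        then consider "Re (x $ i) \<noteq> Re (y $ i)" | "Im (x $ i) \<noteq> Im (y $ i)"
          by (auto simp: complex_eq_iff)
        then show ?thesis
        proof cases
          case 1 then show ?thesis using PRe[of i] by (intro exI[of _ "\<lambda>z. Re (z $ i)"]) auto
        next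
          case 2 then show ?thesis using PIm[of i] by (intro exI[of _ "\<lambda>z. Im (z $ i)"]) auto
        qed
      qed
    qed
    then obtain h where h: "P h" "\<And>z. z \<in> K \<Longrightarrow> \<bar>g z - h z\<bar> < \<epsilon>" by blast
    have f_c: "continuous_on UNIV (\<lambda>x. complex_of_real (f x))"
      by (intro continuous_intros cont)
    have h_c: "continuous_on UNIV (\<lambda>x. complex_of_real (h (e x)))"
      using h(1) by (intro he) (simp add: P_def)
    have "fc (\<lambda>x. complex_of_real (f x) * complex_of_real (h (e x))) 0 = 0"
      using h(1) f_c zero unfolding P_def by blast
    then have "fc (\<lambda>x. complex_of_real (f x * f x)) 0
        = fc (\<lambda>x. complex_of_real (f x) * (complex_of_real (f x) - complex_of_real (h (e x)))) 0"
      unfolding right_diff_distrib by (subst fc_diff) (auto intro!: continuous_intros f_c h_c cont)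
    also have "norm \<dots> \<le> B * \<epsilon>"
    proof (rule norm_fc_le)
      fix x
      have "\<bar>f x - h (e x)\<bar> \<le> \<epsilon>"
        using h(2)[OF K[of x]] by (simp add: g)
      then have "\<bar>f x\<bar> * \<bar>f x - h (e x)\<bar> \<le> B * \<epsilon>"
        using B[of x] by (intro mult_mono) auto
      then show "norm (complex_of_real (f x) * (complex_of_real (f x) - complex_of_real (h (e x)))) \<le> B * \<epsilon>"
        by (simp add: norm_mult of_real_diff [symmetric] del: of_real_diff)
    qed (intro continuous_intros f_c h_c cont)
    finally show ?thesis .
  qed
  have "norm (fc (\<lambda>x. complex_of_real (f x * f x)) 0) \<le> 0"
  proof (rule field_le_epsilon)
    fix r :: real assume "r > 0"
    have "B \<ge> 0" using B[of 0] by linarith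
    then have "B * (r / (B + 1)) \<le> r"
      using \<open>r > 0\<close> by (simp add: field_simps)
    moreover have "norm (fc (\<lambda>x. complex_of_real (f x * f x)) 0) \<le> B * (r / (B + 1))"
      using \<open>r > 0\<close> \<open>B \<ge> 0\<close> by (intro sq_small) simp
    ultimately show "norm (fc (\<lambda>x. complex_of_real (f x * f x)) 0) \<le> 0 + r" by simp
  qed
  then have "fc (\<lambda>x. complex_of_real (f x * f x)) 0 = 0" by simp
  moreover have "fc (\<lambda>x. complex_of_real (f x * f x)) 0 = complex_of_real (LINT x:cube|lebesgue. f x * f x)"
  proof -
    have "fc (\<lambda>x. complex_of_real (f x * f x)) 0 = (CLINT x|lebesgue. complex_of_real (indicator cube x *\<^sub>R (f x * f x)))"
      by (simp add: fc_def set_lebesgue_integral_def scaleR_conv_of_real)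
    then show ?thesis
      unfolding set_lebesgue_integral_def by (simp only: integral_complex_of_real)
  qed
  ultimately have i0: "(LINT x:cube|lebesgue. f x * f x) = 0" by simp
  have f2: "continuous_on UNIV (\<lambda>x. f x * f x)" by (intro continuous_intros cont)
  have si: "set_integrable lebesgue cube (\<lambda>x. f x * f x)"
    by (rule integrable_cube [OF f2])
  have hi: "((\<lambda>x. f x * f x) has_integral 0) cube"
    using has_integral_set_lebesgue [OF si] i0 by simp
  have cube0: "f x * f x = 0" if "x \<in> cube" for x
  proof (rule has_integral_0_cbox_imp_0 [of 0 "\<chi> i. 1" "\<lambda>x. f x * f x" x])
    show "continuous_on (cbox 0 (\<chi> i. 1)) (\<lambda>x. f x * f x)"
      using f2 by (rule continuous_on_subset) simp
  qed (use hi that in \<open>auto simp: cube_def interval_ne_empty_cart\<close>)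
  obtain k where "x + rvec k \<in> cube" using exists_shift_to_cube by blast
  then have "f (x + rvec k) * f (x + rvec k) = 0" by (rule cube0)
  then have "f (x + rvec k) = 0" by simp
  then show ?thesis by (simp add: periodic_shift [of f, OF per])
qed

text \<open>Real and imaginary parts inherit the vanishing coefficients, since conjugation only
  reflects the frequency.\<close>

lemma continuous_periodic_fc_zero:
  assumes cont: "continuous_on UNIV f" and per: "\<And>x i. f (x + axis i 1) = f x"
    and zero: "\<And>k. fc f k = 0"
  shows "f x = 0"
proof -
  have c: "continuous_on UNIV (\<lambda>x. cnj (f x))"
    by (intro continuous_intros cont)
  have "(\<lambda>x. complex_of_real (Re (f x))) = (\<lambda>x. 1/2 * (f x + cnj (f x)))"
    by (simp add: complex_eq_iff fun_eq_iff)
  then have "fc (\<lambda>x. complex_of_real (Re (f x))) k = 0" for k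
    using c cont zero by (simp only: fc_cmult fc_add fc_cnj) simp
  then have "Re (f x) = 0"
    by (intro continuous_periodic_fc_zero_real [of "\<lambda>x. Re (f x)"] continuous_intros cont) (simp add: per)
  moreover
  have "(\<lambda>x. complex_of_real (Im (f x))) = (\<lambda>x. 1/(2*\<i>) * (f x - cnj (f x)))"
    by (simp add: complex_eq_iff fun_eq_iff)
  then have "fc (\<lambda>x. complex_of_real (Im (f x))) k = 0" for k
    using c cont zero by (simp only: fc_cmult fc_diff fc_cnj) simp
  then have "Im (f x) = 0"
    by (intro continuous_periodic_fc_zero_real [of "\<lambda>x. Im (f x)"] continuous_intros cont) (simp add: per)
  ultimately show ?thesis by (simp add: complex_eq_iff)
qed

lemma fourier_inversion:
  assumes cont: "continuous_on UNIV f" and per: "\<And>x i. f (x + axis i 1) = f x"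
    and sm: "(\<lambda>k. norm (fc f k)) summable_on UNIV"
  shows "f x = cser (fc f) x"
proof -
  have "f x - cser (fc f) x = 0"
  proof (rule continuous_periodic_fc_zero)
    show "continuous_on UNIV (\<lambda>x. f x - cser (fc f) x)"
      by (intro continuous_intros cont continuous_cser sm)
  qed (simp_all add: per cser_periodic fc_diff cont continuous_cser sm fc_cser)
  then show ?thesis by simp
qed

section \<open>The frequency set\<close>

definition vec3 :: "'a \<times> 'a \<times> 'a \<Rightarrow> 'a::zero^3" where
  "vec3 = (\<lambda>(x, y, z). vector [x, y, z])"

text \<open>Triples instead of vectors keep these finite sets executable, so that the triad counts
  can be decided by evaluation. The argument \<open>True\<close> belongs to the even levels.\<close>

definition dirs :: "bool \<Rightarrow> (int \<times> int \<times> int) set" where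
  "dirs e = (if e
     then {(1,0,-1), (1,-1,0), (0,1,-1), (0,-1,1), (-1,1,0), (-1,0,1)}
     else {(1,1,-2), (1,-2,1), (-2,1,1), (2,-1,-1), (-1,2,-1), (-1,-1,2)})"

text \<open>Uniform form of k^m, h^m and j^m: the levels \<open>2 * m\<close> and
  \<open>2 * m + 1\<close> share the power \<open>3 ^ m\<close> and differ in the power of 2 and in
  the directions.\<close>

definition freq :: "nat \<Rightarrow> int \<times> int \<times> int \<Rightarrow> int^3" where
  "freq n a = 2 ^ n *s sigma + 3 ^ (n div 2) *s vec3 a"

lemma vec3_nth [simp]:
  "vec3 (x, y, z) $ 1 = x" "vec3 (x, y, z) $ 2 = y" "vec3 (x, y, z) $ 3 = z"
  by (simp_all add: vec3_def)

lemma freq_nth [simp]: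
  "freq n (x, y, z) $ 1 = 2 ^ n + 3 ^ (n div 2) * x"
  "freq n (x, y, z) $ 2 = 2 ^ n + 3 ^ (n div 2) * y"
  "freq n (x, y, z) $ 3 = 2 ^ n + 3 ^ (n div 2) * z"
  by (simp_all add: freq_def)

lemma vec3_eqI: "v $ 1 = w $ 1 \<Longrightarrow> v $ 2 = w $ 2 \<Longrightarrow> v $ 3 = w $ 3 \<Longrightarrow> v = (w :: 'a^3)"
  by (simp add: vec_eq_iff forall_3)

lemma inner_3: "v \<bullet> w = v $ 1 * w $ 1 + v $ 2 * w $ 2 + v $ 3 * w $ 3" for v w :: "real^3"
  by (simp add: inner_vec_def sum_3)

lemma inj_freq: "inj (freq n)"
  by (rule injI) (auto simp: vec_eq_iff forall_3 split_paired_all)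

lemma perms_eq:
  fixes v :: "'a::zero^3"
  shows "perms v = vec3 ` {(v$1,v$2,v$3), (v$1,v$3,v$2), (v$2,v$1,v$3), (v$2,v$3,v$1), (v$3,v$1,v$2), (v$3,v$2,v$1)}"
proof
  show "perms v \<subseteq> vec3 ` {(v$1,v$2,v$3), (v$1,v$3,v$2), (v$2,v$1,v$3), (v$2,v$3,v$1), (v$3,v$1,v$2), (v$3,v$2,v$1)}"
  proof
    fix w assume "w \<in> perms v"
    then obtain p where p: "bij p" "w = permute_vec p v"
      by (auto simp: perms_def)
    have w: "w = vec3 (v $ p 1, v $ p 2, v $ p 3)"
      by (rule vec3_eqI) (simp_all add: p permute_vec_def)
    have "p 1 \<noteq> p 2" "p 1 \<noteq> p 3" "p 2 \<noteq> p 3"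
      using p(1) by (auto dest!: bij_is_inj simp: inj_eq)
    moreover have "p 1 \<in> {1,2,3}" "p 2 \<in> {1,2,3}" "p 3 \<in> {1,2,3}"
      using exhaust_3 by auto
    ultimately show "w \<in> vec3 ` {(v$1,v$2,v$3), (v$1,v$3,v$2), (v$2,v$1,v$3), (v$2,v$3,v$1), (v$3,v$1,v$2), (v$3,v$2,v$1)}"
      unfolding w by (elim insertE emptyE) auto
  qed
next
  have *: "vec3 (v $ a, v $ b, v $ c) \<in> perms v" if "a \<noteq> b" "a \<noteq> c" "b \<noteq> c" for a b c :: 3
  proof -
    define p where "p = (\<lambda>i::3. if i = 1 then a else if i = 2 then b else c)"
    have "inj p"
      using that by (auto simp: inj_def p_def forall_3)
    then have "bij p"
      by (simp add: bij_def finite_UNIV_inj_surj)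
    moreover have "vec3 (v $ a, v $ b, v $ c) = permute_vec p v"
      by (rule vec3_eqI) (simp_all add: permute_vec_def p_def)
    ultimately show ?thesis
      unfolding perms_def by blast
  qed
  show "vec3 ` {(v$1,v$2,v$3), (v$1,v$3,v$2), (v$2,v$1,v$3), (v$2,v$3,v$1), (v$3,v$1,v$2), (v$3,v$2,v$1)} \<subseteq> perms v"
    by (auto intro!: *)
qed

lemma freq_vec3: "freq n (x, y, z) = vec3 (2 ^ n + 3 ^ (n div 2) * x, 2 ^ n + 3 ^ (n div 2) * y, 2 ^ n + 3 ^ (n div 2) * z)"
  by (rule vec3_eqI) simp_all

lemma Mplus_eq: "Mplus n = freq n ` dirs (even n)"
proof (cases "even n")
  case True
  then obtain m where "n = 2 * m" by (elim evenE)
  then show ?thesis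
    by (simp add: Mplus_def perms_eq kfreq_def dirs_def freq_vec3 insert_commute)
next
  case False
  then obtain m where "n = 2 * m + 1" by (elim oddE)
  then show ?thesis
    by (auto simp add: Mplus_def perms_eq hfreq_def jfreq_def dirs_def freq_vec3 insert_commute)
qed

lemma finite_Mplus [simp]: "finite (Mplus n)"
  by (simp add: Mplus_eq dirs_def)

lemma card_Mplus: "card (Mplus n) = 6"
  unfolding Mplus_eq by (subst card_image) (auto simp: dirs_def inj_on_subset [OF inj_freq])

lemma sum_Mplus: "(\<Sum>k\<in>Mplus n. f k) = (\<Sum>a\<in>dirs (even n). f (freq n a))"
  unfolding Mplus_eq by (subst sum.reindex) (auto simp: inj_on_subset [OF inj_freq])

lemma dirs_sum0: "(x, y, z) \<in> dirs e \<Longrightarrow> x + y + z = 0"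
  by (auto simp: dirs_def split: if_splits)

lemma dirs_sq: "(x, y, z) \<in> dirs e \<Longrightarrow> x * x + y * y + z * z = (if e then 2 else 6)"
  by (auto simp: dirs_def split: if_splits)

lemma dirs_uminus: "(x, y, z) \<in> dirs e \<Longrightarrow> (- x, - y, - z) \<in> dirs e"
  by (auto simp: dirs_def split: if_splits)

lemma Mplus_sum:
  assumes "k \<in> Mplus n"
  shows "k $ 1 + k $ 2 + k $ 3 = 3 * 2 ^ n"
proof -
  obtain x y z where d: "(x, y, z) \<in> dirs (even n)" and k: "k = freq n (x, y, z)"
    using assms by (auto simp: Mplus_eq)
  have "k $ 1 + k $ 2 + k $ 3 = 3 * 2 ^ n + 3 ^ (n div 2) * (x + y + z)"
    by (simp add: k distrib_left)
  then show ?thesis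
    by (simp add: dirs_sum0[OF d])
qed

text \<open>\<open>Kn n\<close> and \<open>Pn n\<close> are \<open>|k|\<^sup>2\<close> and \<open>|P\<^sub>k\<^sup>\<bottom>(\<sigma>)|\<close> for \<open>k \<in> Mplus n\<close>.\<close>

definition Kn :: "nat \<Rightarrow> real" where "Kn n = 3 * 4 ^ n + 2 * 3 ^ n"

definition Pn :: "nat \<Rightarrow> real" where "Pn n = sqrt (6 * 3 ^ n / Kn n)"

lemma Kn_pos [simp]: "Kn n > 0"
  by (simp add: Kn_def add_pos_pos)

lemma Kn_nonzero [simp]: "Kn n \<noteq> 0"
  using Kn_pos[of n] by linarith

text \<open>The left side is the squared length of \<open>sigma\<close> minus the square of k .
  sigma over the squared length of k, that is, the squared length of the projection of
  \<open>sigma\<close> orthogonal to k.\<close>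

lemma Kn_identity: "3 - 9 * 4 ^ n / Kn n = 6 * 3 ^ n / Kn n"
proof -
  have "3 - 9 * 4 ^ n / Kn n = (3 * Kn n - 9 * 4 ^ n) / Kn n"
    by (simp add: diff_divide_distrib)
  then show ?thesis by (simp add: Kn_def)
qed

lemma Pn_pos [simp]: "Pn n > 0"
  by (simp add: Pn_def)

lemma Pn_nonzero [simp]: "Pn n \<noteq> 0"
  using Pn_pos[of n] by linarith

lemma Pn_sq: "Pn n * Pn n = 6 * 3 ^ n / Kn n"
  using Kn_pos[of n] by (simp add: Pn_def less_imp_le)

lemma rvec_sigma: "k \<in> Mplus n \<Longrightarrow> rvec k \<bullet> sigma = 3 * 2 ^ n"
proof -
  assume "k \<in> Mplus n"
  then have "real_of_int (k $ 1 + k $ 2 + k $ 3) = real_of_int (3 * 2 ^ n)"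
    by (simp only: Mplus_sum)
  then show ?thesis by (simp add: inner_3)
qed

lemma sigma_rvec: "k \<in> Mplus n \<Longrightarrow> sigma \<bullet> rvec k = 3 * 2 ^ n"
  using rvec_sigma[of k n] by (simp add: inner_commute)

lemma rvec_inner_self: "k \<in> Mplus n \<Longrightarrow> rvec k \<bullet> rvec k = Kn n"
proof -
  assume "k \<in> Mplus n"
  then obtain x y z where d: "(x, y, z) \<in> dirs (even n)" and k: "k = freq n (x, y, z)"
    by (auto simp: Mplus_eq)
  define c :: int where "c = 3 ^ (n div 2)"
  have "k $ 1 * k $ 1 + k $ 2 * k $ 2 + k $ 3 * k $ 3
      = 3 * (2 ^ n * 2 ^ n) + 2 * 2 ^ n * c * (x + y + z) + c * c * (x * x + y * y + z * z)"
    by (simp add: k c_def algebra_simps)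
  also have "\<dots> = 3 * (2 ^ n * 2 ^ n) + c * c * (if even n then 2 else 6)"
    unfolding dirs_sum0[OF d] dirs_sq[OF d] by simp
  also have "c * c * (if even n then 2 else 6) = 2 * 3 ^ n"
    unfolding c_def by (auto elim!: evenE oddE simp: power_mult power2_eq_square mult_ac power_mult_distrib)
  also have "(2::int) ^ n * 2 ^ n = 4 ^ n"
    by (simp add: power_mult_distrib [symmetric])
  finally have "real_of_int (k $ 1 * k $ 1 + k $ 2 * k $ 2 + k $ 3 * k $ 3) = real_of_int (3 * 4 ^ n + 2 * 3 ^ n)"
    by (simp only:)
  then show ?thesis by (simp add: inner_3 Kn_def)
qed

lemma norm_rvec_sq: "k \<in> Mplus n \<Longrightarrow> (norm (rvec k))\<^sup>2 = Kn n"
  by (simp add: power2_norm_eq_inner rvec_inner_self)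

lemma vdir_eq:
  assumes "k \<in> Mplus n"
  shows "vdir k = (1 / Pn n) *\<^sub>R (sigma - (3 * 2 ^ n / Kn n) *\<^sub>R rvec k)"
proof -
  have sp: "sigma_perp k = sigma - (3 * 2 ^ n / Kn n) *\<^sub>R rvec k"
    by (simp add: sigma_perp_def rvec_sigma[OF assms] norm_rvec_sq[OF assms])
  have s3: "sigma \<bullet> (sigma :: real^3) = 3"
    by (simp add: inner_3)
  have "(norm (sigma_perp k))\<^sup>2 = 3 - (3 * 2 ^ n) * (3 * 2 ^ n) / Kn n"
    using Kn_pos[of n] unfolding power2_norm_eq_inner sp inner_diff_left inner_diff_right
    by (simp add: s3 rvec_sigma[OF assms] rvec_inner_self[OF assms] sigma_rvec[OF assms])
  also have "\<dots> = 6 * 3 ^ n / Kn n"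
    unfolding Kn_identity [symmetric] by (simp add: power_mult_distrib [symmetric])
  finally have "norm (sigma_perp k) = Pn n"
    by (metis Pn_def norm_ge_zero real_sqrt_unique)
  then show ?thesis by (simp add: vdir_def sp)
qed

lemma vdir_uminus: "vdir (- k) = vdir k"
  by (simp add: vdir_def sigma_perp_def)

lemma vdir_inner_self:
  assumes "k \<in> Mplus n"
  shows "vdir k \<bullet> vdir k = 1"
proof -
  have "sigma_perp k \<noteq> 0"
  proof
    assume "sigma_perp k = 0"
    then have "(Pn n) *\<^sub>R vdir k = 0" by (simp add: vdir_def)
    then have "sigma - (3 * 2 ^ n / Kn n) *\<^sub>R rvec k = 0"
      using Pn_pos[of n] by (simp add: vdir_eq[OF assms])
    then have "(sigma - (3 * 2 ^ n / Kn n) *\<^sub>R rvec k) \<bullet> sigma = 0" by simp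
    then have "3 - 9 * 4 ^ n / Kn n = 0"
      by (simp add: inner_diff_left rvec_sigma[OF assms] power_mult_distrib [symmetric]) (simp add: inner_3)
    then show False
      by (simp add: Kn_identity)
  qed
  then show ?thesis by (simp add: vdir_def power2_norm_eq_inner [symmetric] power2_eq_square)
qed

lemma vdir_inner_rvec_self: "k \<in> Mplus n \<Longrightarrow> vdir k \<bullet> rvec k = 0"
  by (simp add: vdir_eq inner_diff_left rvec_inner_self sigma_rvec)

lemma vdir_inner_sigma: "k \<in> Mplus n \<Longrightarrow> vdir k \<bullet> sigma = Pn n"
proof -
  assume k: "k \<in> Mplus n"
  have "vdir k \<bullet> sigma = (1 / Pn n) * (3 - 9 * 4 ^ n / Kn n)"
    by (simp add: vdir_eq[OF k] inner_diff_left rvec_sigma[OF k] power_mult_distrib [symmetric]) (simp add: inner_3)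
  also have "3 - 9 * 4 ^ n / Kn n = Pn n * Pn n"
    by (simp add: Pn_sq Kn_identity)
  finally show ?thesis using Pn_pos[of n] by simp
qed

lemma norm_vdir: "k \<in> Mplus n \<Longrightarrow> norm (vdir k) = 1"
  by (simp add: norm_eq_sqrt_inner vdir_inner_self)

subsection \<open>Triads\<close>

text \<open>Polarisation: the three lengths in a triad are determined by the levels, hence so is the
  angle.\<close>

lemma triad_inner:
  assumes "k \<in> Mplus n" "p \<in> Mplus n" "k + p \<in> Mplus (Suc n)"
  shows "rvec k \<bullet> rvec p = 3 * 4 ^ n + 3 ^ n"
proof -
  have "Kn (Suc n) = 2 * Kn n + 2 * (rvec k \<bullet> rvec p)"
    using rvec_inner_self[OF assms(3)]
    by (simp add: inner_add_left inner_add_right rvec_inner_self[OF assms(1)] rvec_inner_self[OF assms(2)] inner_commute)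
  then show ?thesis by (simp add: Kn_def)
qed

lemma triad_vdir_rvec:
  assumes "k \<in> Mplus n" "p \<in> Mplus n" "k + p \<in> Mplus (Suc n)"
  shows "vdir p \<bullet> rvec k = 3 * 6 ^ n / (Kn n * Pn n)"
proof -
  have "vdir p \<bullet> rvec k = (1 / Pn n) * (3 * 2 ^ n - 3 * 2 ^ n / Kn n * (3 * 4 ^ n + 3 ^ n))"
    using rvec_sigma[OF assms(1)] triad_inner[OF assms]
    by (simp add: vdir_eq[OF assms(2)] inner_diff_left inner_diff_right inner_commute)
  also have "\<dots> = (1 / Pn n) * (3 * 2 ^ n / Kn n * (Kn n - (3 * 4 ^ n + 3 ^ n)))"
    by (simp add: right_diff_distrib)
  also have "Kn n - (3 * 4 ^ n + 3 ^ n) = 3 ^ n"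
    by (simp add: Kn_def)
  finally show ?thesis
    using power_mult_distrib[of "2::real" 3 n] by (simp add: mult_ac)
qed

text \<open>\<open>k\<close> and \<open>p\<close> have the same length and the same product with
  \<open>sigma\<close>, so \<open>p\<close> minus half of \<open>k + p\<close> is orthogonal to
  \<open>sigma\<close> and to \<open>k + p\<close>, whose span contains \<open>vdir (k + p)\<close>.
  Transport thus vanishes when the frequency of the higher level is the advecting one.\<close>

lemma triad_sum_vdir_rvec:
  assumes "k \<in> Mplus n" "p \<in> Mplus n" "k + p \<in> Mplus (Suc n)"
  shows "vdir (k + p) \<bullet> rvec p = 0"
proof -
  have "(rvec k + rvec p) \<bullet> rvec p = Kn (Suc n) / 2"
    using triad_inner[OF assms] by (simp add: inner_add_left rvec_inner_self[OF assms(2)] Kn_def)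
  then show ?thesis
    using rvec_sigma[OF assms(2)]
    by (simp add: vdir_eq[OF assms(3)] inner_diff_left sigma_rvec[OF assms(2)] del: rvec_simps(3))
      (simp add: field_simps)
qed

text \<open>\<open>vdir (k + p)\<close> is orthogonal to \<open>k\<close>, so only the
  \<open>sigma\<close> part of \<open>vdir k\<close> contributes.\<close>

lemma triad_vdir_vdir:
  assumes "k \<in> Mplus n" "p \<in> Mplus n" "k + p \<in> Mplus (Suc n)"
  shows "vdir (k + p) \<bullet> vdir k = Pn (Suc n) / Pn n"
proof -
  have "vdir (k + p) \<bullet> rvec k = 0"
    using triad_sum_vdir_rvec[of p n k] assms by (simp add: add.commute)
  then show ?thesis
    by (simp add: vdir_eq[OF assms(1)] inner_diff_right vdir_inner_sigma[OF assms(3)])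
qed

definition tadd :: "int \<times> int \<times> int \<Rightarrow> int \<times> int \<times> int \<Rightarrow> int \<times> int \<times> int" where
  "tadd = (\<lambda>(x, y, z) (x', y', z'). (x + x', y + y', z + z'))"

definition tscale :: "int \<Rightarrow> int \<times> int \<times> int \<Rightarrow> int \<times> int \<times> int" where
  "tscale c = (\<lambda>(x, y, z). (c * x, c * y, c * z))"

lemma freq_add: "even n \<Longrightarrow> freq n a + freq n b = freq (Suc n) (tadd a b)"
  by (cases a; cases b) (auto intro!: vec3_eqI simp: tadd_def algebra_simps elim!: evenE)

text \<open>From an odd level to the next even one the power of 3 grows by one, so two directions
  must add up to three times a direction; from even to odd the power is unchanged.\<close>

lemma freq_add_odd: "odd n \<Longrightarrow> freq (Suc n) c = freq n a + freq n b \<longleftrightarrow> tscale 3 c = tadd a b"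
proof (cases a; cases b; cases c)
  fix x y z x' y' z' x'' y'' z''
  assume n: "odd n" and abc: "a = (x, y, z)" "b = (x', y', z')" "c = (x'', y'', z'')"
  define q :: int where "q = 3 ^ (n div 2)"
  have q: "3 ^ (Suc n div 2) = 3 * q" "q \<noteq> 0"
    using n by (auto simp: q_def elim!: oddE)
  have *: "q * (3 * x) = q * u \<longleftrightarrow> 3 * x = u" for x u :: int
    using q(2) by (simp only: mult_cancel_left) simp
  have "freq (Suc n) c = freq n a + freq n b \<longleftrightarrow>
      q * (3 * x'') = q * (x + x') \<and> q * (3 * y'') = q * (y + y') \<and> q * (3 * z'') = q * (z + z')"
    unfolding abc vec_eq_iff forall_3 vector_add_component freq_nth q(1)
    by (simp add: q_def [symmetric] algebra_simps)
  then show "freq (Suc n) c = freq n a + freq n b \<longleftrightarrow> tscale 3 c = tadd a b"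
    unfolding * by (simp add: abc tscale_def tadd_def)
qed

lemma dirs_count_up:
  "\<forall>a\<in>dirs True. card {b \<in> dirs True. tadd a b \<in> dirs False} = 2"
  "\<forall>a\<in>dirs False. card {b \<in> dirs False. tadd a b \<in> tscale 3 ` dirs True} = 2"
  by code_simp+

lemma dirs_count_down:
  "\<forall>c\<in>dirs False. card {a \<in> dirs True. \<exists>b\<in>dirs True. c = tadd a b} = 2"
  "\<forall>c\<in>dirs True. card {a \<in> dirs False. \<exists>b\<in>dirs False. tscale 3 c = tadd a b} = 2"
  by code_simp+

lemma card_up:
  assumes "k \<in> Mplus n"
  shows "card {p \<in> Mplus n. k + p \<in> Mplus (Suc n)} = 2"
proof -
  obtain a where a: "a \<in> dirs (even n)" "k = freq n a"
    using assms by (auto simp: Mplus_eq)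
  let ?S = "{b \<in> dirs (even n). tadd a b \<in> (if even n then dirs False else tscale 3 ` dirs True)}"
  have "{p \<in> Mplus n. k + p \<in> Mplus (Suc n)} = freq n ` ?S"
  proof -
    have "k + freq n b \<in> Mplus (Suc n) \<longleftrightarrow>
        tadd a b \<in> (if even n then dirs False else tscale 3 ` dirs True)" for b
    proof (cases "even n")
      case True
      then show ?thesis
        by (simp add: Mplus_eq a freq_add inj_image_mem_iff [OF inj_freq])
    next
      case False
      have "k + freq n b \<in> freq (Suc n) ` dirs True \<longleftrightarrow> (\<exists>c\<in>dirs True. freq (Suc n) c = k + freq n b)"
        unfolding image_iff by metis
      also have "\<dots> \<longleftrightarrow> (\<exists>c\<in>dirs True. tscale 3 c = tadd a b)"
        by (simp add: a freq_add_odd[OF False])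
      also have "\<dots> \<longleftrightarrow> tadd a b \<in> tscale 3 ` dirs True"
        unfolding image_iff by metis
      finally show ?thesis
        using False by (simp add: Mplus_eq)
    qed
    then show ?thesis
      unfolding Mplus_eq[of n] by blast
  qed
  then have "card {p \<in> Mplus n. k + p \<in> Mplus (Suc n)} = card ?S"
    by (simp add: card_image inj_on_subset [OF inj_freq])
  then show ?thesis
    using dirs_count_up a by (cases "even n") auto
qed

text \<open>The count is of ordered decompositions: \<open>q\<close> is the sum of exactly one pair
  of frequencies of level \<open>n\<close>, seen in both orders.\<close>

lemma card_down:
  assumes "q \<in> Mplus (Suc n)"
  shows "card {h \<in> Mplus n. q - h \<in> Mplus n} = 2"
proof -
  obtain c where c: "c \<in> dirs (odd n)" "q = freq (Suc n) c"
    using assms by (auto simp: Mplus_eq)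
  let ?S = "{a \<in> dirs (even n). \<exists>b\<in>dirs (even n). (if even n then c = tadd a b else tscale 3 c = tadd a b)}"
  have "q - freq n a = freq n b \<longleftrightarrow> q = freq n a + freq n b" for a b
    by (auto simp: algebra_simps)
  moreover have "q = freq n a + freq n b \<longleftrightarrow> (if even n then c = tadd a b else tscale 3 c = tadd a b)" for a b
    by (simp add: c freq_add freq_add_odd inj_eq [OF inj_freq])
  ultimately have "q - freq n a = freq n b \<longleftrightarrow> (if even n then c = tadd a b else tscale 3 c = tadd a b)" for a b
    by blast
  then have "{h \<in> Mplus n. q - h \<in> Mplus n} = freq n ` ?S"
    unfolding Mplus_eq image_iff by blast
  then have "card {h \<in> Mplus n. q - h \<in> Mplus n} = card ?S"
    by (simp add: card_image inj_on_subset [OF inj_freq])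
  then show ?thesis
    using dirs_count_down c by (cases "even n") auto
qed

text \<open>Transport factor times alignment for a single triad. It is the same whether the triad
  feeds the upper level or drains the lower one; the factor 1/2 disappears because each sum runs
  over two triads.\<close>

lemma triad_strength: "3 * 6 ^ n / (Kn n * Pn n) * (Pn (Suc n) / Pn n) = 2 ^ n * Pn (Suc n) / 2"
proof -
  have "3 * 6 ^ n / (Kn n * Pn n) * (Pn (Suc n) / Pn n) = 3 * 6 ^ n * Pn (Suc n) / (Kn n * (Pn n * Pn n))"
    by simp
  also have "Kn n * (Pn n * Pn n) = 6 * 3 ^ n"
    by (simp add: Pn_sq)
  also have "3 * 6 ^ n * Pn (Suc n) / (6 * 3 ^ n) = (6 / 3) ^ n * Pn (Suc n) / 2"
    unfolding power_divide by (simp add: field_simps)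
  finally show ?thesis by simp
qed

lemma sum_down:
  assumes q: "q \<in> Mplus (Suc n)"
  shows "(\<Sum>h\<in>{h \<in> Mplus n. q - h \<in> Mplus n}. (vdir h \<bullet> rvec (q - h)) * (vdir (q - h) \<bullet> vdir q)) = 2 ^ n * Pn (Suc n)"
proof -
  have "(vdir h \<bullet> rvec (q - h)) * (vdir (q - h) \<bullet> vdir q) = 2 ^ n * Pn (Suc n) / 2"
    if "h \<in> {h \<in> Mplus n. q - h \<in> Mplus n}" for h
  proof -
    have t: "q - h \<in> Mplus n" "h \<in> Mplus n" "(q - h) + h \<in> Mplus (Suc n)"
      using that q by auto
    show ?thesis
      using triad_vdir_rvec[OF t] triad_vdir_vdir[OF t] triad_strength[of n]
      by (simp add: inner_commute)
  qed
  then have "(\<Sum>h\<in>{h \<in> Mplus n. q - h \<in> Mplus n}. (vdir h \<bullet> rvec (q - h)) * (vdir (q - h) \<bullet> vdir q))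
      = (\<Sum>h\<in>{h \<in> Mplus n. q - h \<in> Mplus n}. 2 ^ n * Pn (Suc n) / 2)"
    by (rule sum.cong [OF refl])
  also have "\<dots> = 2 ^ n * Pn (Suc n)"
    unfolding sum_constant card_down[OF q] by simp
  finally show ?thesis .
qed

text \<open>The total agrees with that of \<open>sum_down\<close>: gain and loss share one coupling
  constant, so the quadratic terms telescope in the unweighted energy.\<close>

lemma sum_up:
  assumes k: "k \<in> Mplus n"
  shows "(\<Sum>p\<in>{p \<in> Mplus n. k + p \<in> Mplus (Suc n)}. (vdir p \<bullet> rvec (k + p)) * (vdir (k + p) \<bullet> vdir k)) = 2 ^ n * Pn (Suc n)"
proof -
  have "(vdir p \<bullet> rvec (k + p)) * (vdir (k + p) \<bullet> vdir k) = 2 ^ n * Pn (Suc n) / 2"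
    if "p \<in> {p \<in> Mplus n. k + p \<in> Mplus (Suc n)}" for p
  proof -
    have "vdir p \<bullet> rvec (k + p) = vdir p \<bullet> rvec k"
      using that vdir_inner_rvec_self[of p n] by (simp add: inner_add_right)
    then show ?thesis
      using that triad_vdir_rvec[OF k, of p] triad_vdir_vdir[OF k, of p] triad_strength[of n] by simp
  qed
  then have "(\<Sum>p\<in>{p \<in> Mplus n. k + p \<in> Mplus (Suc n)}. (vdir p \<bullet> rvec (k + p)) * (vdir (k + p) \<bullet> vdir k))
      = (\<Sum>p\<in>{p \<in> Mplus n. k + p \<in> Mplus (Suc n)}. 2 ^ n * Pn (Suc n) / 2)"
    by (rule sum.cong [OF refl])
  also have "\<dots> = 2 ^ n * Pn (Suc n)"
    unfolding sum_constant card_up[OF k] by simp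
  finally show ?thesis .
qed

text \<open>Up to the factor of differentiation this is the gradient of level \<open>n\<close> at
  the origin. Permutation invariance leaves a combination of the identity and the projection onto
  \<open>sigma\<close>, with trace zero because \<open>vdir k\<close> is orthogonal to
  \<open>k\<close>; the remaining factor comes from the moments \<open>s1\<close> and
  \<open>s2\<close> of the frequencies.\<close>

lemma sum_vdir_tensor:
  "(\<Sum>k\<in>Mplus n. (rvec k \<bullet> h) *\<^sub>R vdir k) = (3 * 2 ^ n * Pn n) *\<^sub>R ((sigma \<bullet> h) *\<^sub>R sigma - h)"
proof -
  define S where "S = sigma \<bullet> h"
  define q :: real where "q = 3 ^ (n div 2)"
  define t :: real where "t = 2 ^ n"
  have S: "S = h $ 1 + h $ 2 + h $ 3"
    by (simp add: S_def inner_3)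
  have tt: "t * t = 4 ^ n"
    by (simp add: t_def power_mult_distrib [symmetric])
  have qq: "q * q * (if even n then 2 else 6) = 2 * 3 ^ n"
    unfolding q_def by (auto elim!: evenE oddE simp: power_mult power2_eq_square mult_ac power_mult_distrib)
  have fr: "rvec (freq n (x, y, z)) \<bullet> h = t * S + q * (x * h $ 1 + y * h $ 2 + z * h $ 3)" for x y z
    by (simp add: inner_3 S t_def q_def algebra_simps)
  have s1: "(\<Sum>k\<in>Mplus n. rvec k \<bullet> h) = 6 * t * S"
    unfolding sum_Mplus by (simp add: dirs_def fr) (simp add: algebra_simps)
  have s2: "(\<Sum>k\<in>Mplus n. (rvec k \<bullet> h) *\<^sub>R rvec k) = (6 * t * t * S - q * q * (if even n then 2 else 6) * S) *\<^sub>R sigma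
      + (3 * (q * q * (if even n then 2 else 6))) *\<^sub>R h"
    unfolding sum_Mplus
    by (rule vec3_eqI)
      (simp_all add: dirs_def fr sum_component, simp_all add: t_def [symmetric] q_def [symmetric] S algebra_simps)
  have "(\<Sum>k\<in>Mplus n. (rvec k \<bullet> h) *\<^sub>R vdir k)
      = (\<Sum>k\<in>Mplus n. (1 / Pn n) *\<^sub>R ((rvec k \<bullet> h) *\<^sub>R sigma - (3 * t / Kn n) *\<^sub>R ((rvec k \<bullet> h) *\<^sub>R rvec k)))"
    by (intro sum.cong refl) (simp add: vdir_eq t_def scaleR_diff_right)
  also have "\<dots> = (1 / Pn n) *\<^sub>R ((\<Sum>k\<in>Mplus n. rvec k \<bullet> h) *\<^sub>R sigma - (3 * t / Kn n) *\<^sub>R (\<Sum>k\<in>Mplus n. (rvec k \<bullet> h) *\<^sub>R rvec k))"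
    by (simp only: scaleR_sum_right [symmetric] sum_subtractf scaleR_sum_left)
  also have "\<dots> = (1 / Pn n) *\<^sub>R ((6 * t * S - (3 * t / Kn n) * (6 * 4 ^ n * S - 2 * 3 ^ n * S)) *\<^sub>R sigma
      - ((3 * t / Kn n) * (6 * 3 ^ n)) *\<^sub>R h)"
    unfolding s1 s2 qq using tt by (simp add: algebra_simps)
  also have "6 * t * S - (3 * t / Kn n) * (6 * 4 ^ n * S - 2 * 3 ^ n * S) = (3 * t / Kn n) * (6 * 3 ^ n) * S"
  proof -
    define c where "c = 3 * t / Kn n"
    have "6 * t * S = c * (2 * S * Kn n)" by (simp add: c_def)
    then show ?thesis unfolding c_def [symmetric] by (simp add: Kn_def algebra_simps)
  qed
  also have "(1 / Pn n) *\<^sub>R (((3 * t / Kn n) * (6 * 3 ^ n) * S) *\<^sub>R sigma - ((3 * t / Kn n) * (6 * 3 ^ n)) *\<^sub>R h)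
      = ((1 / Pn n) * (3 * t) * (6 * 3 ^ n / Kn n)) *\<^sub>R (S *\<^sub>R sigma - h)"
    by (simp add: scaleR_diff_right mult_ac)
  also have "(1 / Pn n) * (3 * t) * (6 * 3 ^ n / Kn n) = 3 * t * Pn n"
    unfolding Pn_sq [symmetric] using Pn_pos[of n] by simp
  finally show ?thesis by (simp add: S_def t_def)
qed

subsection \<open>Levels and symmetries of the frequency set\<close>

lemma Mplus_level: "k \<in> Mplus n \<Longrightarrow> k \<in> Mplus m \<Longrightarrow> n = m"
  using Mplus_sum[of k n] Mplus_sum[of k m] by simp

lemma uminus_Mplus: "k \<in> Mplus n \<Longrightarrow> - k \<notin> Mplus m"
proof
  assume "k \<in> Mplus n" "- k \<in> Mplus m"
  then have "- (3 * 2 ^ n) = (3 * 2 ^ m :: int)"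
    using Mplus_sum[of k n] Mplus_sum[of "- k" m] by simp
  moreover have "(0::int) < 3 * 2 ^ n" "(0::int) < 3 * 2 ^ m" by simp_all
  ultimately show False by linarith
qed

lemma MM_iff: "k \<in> MM \<longleftrightarrow> (\<exists>n. k \<in> Mplus n \<or> - k \<in> Mplus n)"
proof -
  have "k \<in> uminus ` S \<longleftrightarrow> - k \<in> S" for S :: "(int^3) set"
    by (metis (no_types, opaque_lifting) image_iff minus_minus)
  then show ?thesis unfolding MM_def by auto
qed

lemma uminus_MM [simp]: "- k \<in> MM \<longleftrightarrow> k \<in> MM"
  by (auto simp: MM_iff)

lemma zero_notin_MM [simp]: "0 \<notin> MM"
proof -
  have "0 \<notin> Mplus n" for n
    using Mplus_sum[of 0 n] by auto
  then show ?thesis by (simp add: MM_iff)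
qed

text \<open>After division by the smaller power the left side is 1 plus a power of 2, which is odd
  unless that power is 1.\<close>

lemma power2_sum_eq:
  assumes "(2::int) ^ a + 2 ^ b = 2 ^ c"
  shows "a = b \<and> c = Suc a"
proof -
  have *: "a = b \<and> c = Suc a" if le: "a \<le> b" and eq: "(2::int) ^ a + 2 ^ b = 2 ^ c" for a b c :: nat
  proof -
    obtain d where d: "b = a + d" using le by (metis le_add_diff_inverse)
    have "a < c"
    proof (rule ccontr)
      assume "\<not> a < c"
      then have "(2::int) ^ c \<le> 2 ^ a" by (simp add: power_increasing)
      moreover have "(0::int) < 2 ^ b" by simp
      ultimately show False using eq by linarith
    qed
    then obtain e where e: "c = a + Suc e" by (metis less_iff_Suc_add add_Suc_right)
    have "(2::int) ^ a * (1 + 2 ^ d) = 2 ^ a * 2 ^ Suc e"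
      using eq by (simp add: d e power_add algebra_simps)
    then have "1 + (2::int) ^ d = 2 ^ Suc e" by simp
    moreover have "d = 0"
    proof (rule ccontr)
      assume "d \<noteq> 0"
      then have "odd (1 + (2::int) ^ d)" by simp
      moreover have "even ((2::int) ^ Suc e)" by simp
      ultimately show False using \<open>1 + (2::int) ^ d = 2 ^ Suc e\<close> by metis
    qed
    ultimately have "(2::int) ^ e = 2 ^ 0" by simp
    then have "e = 0" by (subst (asm) power_inject_exp) auto
    with \<open>d = 0\<close> show ?thesis by (simp add: d e)
  qed
  show ?thesis
  proof (cases "a \<le> b")
    case True
    then show ?thesis using * assms by blast
  next
    case False
    then show ?thesis using *[of b a c] assms by (simp add: add.commute)
  qed
qed

lemma triad_levels:
  assumes "h \<in> Mplus a" "j \<in> Mplus b" "h + j \<in> Mplus c"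
  shows "a = b \<and> c = Suc a"
proof (rule power2_sum_eq)
  have "3 * ((2::int) ^ a + 2 ^ b) = 3 * 2 ^ c"
    using Mplus_sum[OF assms(1)] Mplus_sum[OF assms(2)] Mplus_sum[OF assms(3)] by simp
  then show "(2::int) ^ a + 2 ^ b = 2 ^ c" by simp
qed

section \<open>Permutations and the mirror acting on frequencies and directions\<close>

lemma permute_vec_nth [simp]: "permute_vec p v $ i = v $ p i"
  by (simp add: permute_vec_def)

lemma permute_uminus: "permute_vec p (- k) = - permute_vec p (k :: int^3)"
  by (simp add: vec_eq_iff)

lemma rvec_permute: "rvec (permute_vec p k) = permute_vec p (rvec k)"
  by (simp add: vec_eq_iff)

lemma permute_inner: "bij p \<Longrightarrow> permute_vec p v \<bullet> permute_vec p w = v \<bullet> w" for v w :: "real^3"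
  unfolding inner_vec_def by (simp add: sum.reindex_bij_betw [of p UNIV UNIV "\<lambda>i. v $ i * w $ i"])

lemma permute_Mplus:
  assumes "bij p" "k \<in> Mplus n"
  shows "permute_vec p k \<in> Mplus n"
proof -
  have "permute_vec p w \<in> perms v" if "w \<in> perms v" for v w :: "int^3"
  proof -
    obtain q where q: "bij q" "w = permute_vec q v"
      using \<open>w \<in> perms v\<close> by (auto simp: perms_def)
    then have "permute_vec p w = permute_vec (q \<circ> p) v" "bij (q \<circ> p)"
      using assms(1) by (auto simp: vec_eq_iff bij_comp)
    then show ?thesis unfolding perms_def by blast
  qed
  then show ?thesis
    using assms(2) by (auto simp: Mplus_def split: if_splits)
qed

lemma permute_MM: "bij p \<Longrightarrow> k \<in> MM \<Longrightarrow> permute_vec p k \<in> MM"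
  using permute_Mplus [of p k] permute_Mplus [of p "- k"] by (auto simp: MM_iff permute_uminus)

lemma vdir_permute:
  assumes "bij p"
  shows "vdir (permute_vec p k) = permute_vec p (vdir k)"
proof -
  have "sigma = permute_vec p (sigma :: real^3)"
    by (simp add: vec_eq_iff)
  then have s: "permute_vec p (rvec k) \<bullet> sigma = rvec k \<bullet> sigma"
    using permute_inner[OF assms, of "rvec k" sigma] by simp
  have n: "norm (permute_vec p v) = norm v" for v :: "real^3"
    by (simp add: norm_eq_sqrt_inner permute_inner assms)
  have sp: "sigma_perp (permute_vec p k) = permute_vec p (sigma_perp k)"
    by (simp add: sigma_perp_def rvec_permute s n) (simp add: vec_eq_iff)
  show ?thesis
    by (simp add: vdir_def sp n) (simp add: vec_eq_iff)
qed

text \<open>The reflection \<open>M_sigma\<close> does not preserve the integer lattice, but it preserves \<open>MM\<close>, where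
  the component sum is divisible by 3.\<close>

definition mir :: "int^3 \<Rightarrow> int^3" where
  "mir k = k - (2 * ((k $ 1 + k $ 2 + k $ 3) div 3)) *s sigma"

lemma mir_nth: "mir k $ i = k $ i - 2 * ((k $ 1 + k $ 2 + k $ 3) div 3)"
  by (simp add: mir_def)

lemma mir_uminus_Mplus: "k \<in> Mplus n \<Longrightarrow> mir (- k) = - mir k"
proof -
  assume "k \<in> Mplus n"
  then have "(k $ 1 + k $ 2 + k $ 3) div 3 = 2 ^ n" "(- k $ 1 + - k $ 2 + - k $ 3) div 3 = - (2 ^ n)"
    using Mplus_sum[of k n] by (simp_all add: algebra_simps)
  then show ?thesis by (simp add: vec_eq_iff mir_nth)
qed

text \<open>The reflection reverses the \<open>sigma\<close> part and fixes the direction part,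
  which is orthogonal to \<open>sigma\<close>.\<close>

lemma mir_freq:
  assumes "(x, y, z) \<in> dirs (even n)"
  shows "mir (freq n (x, y, z)) = - freq n (- x, - y, - z)"
proof -
  have "freq n (x, y, z) \<in> Mplus n" using assms by (auto simp: Mplus_eq)
  then have s: "(freq n (x, y, z) $ 1 + freq n (x, y, z) $ 2 + freq n (x, y, z) $ 3) div 3 = 2 ^ n"
    by (simp only: Mplus_sum)
  show ?thesis
    unfolding mir_def s by (rule vec3_eqI) simp_all
qed

lemma mir_Mplus: "k \<in> Mplus n \<Longrightarrow> - mir k \<in> Mplus n"
  by (auto simp: Mplus_eq mir_freq dirs_uminus)

lemma mir_MM: "k \<in> MM \<Longrightarrow> mir k \<in> MM"
  using mir_Mplus [of k] mir_Mplus [of "- k"] mir_uminus_Mplus [of "- k"] by (fastforce simp: MM_iff)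

lemma mir_mir_Mplus: "k \<in> Mplus n \<Longrightarrow> mir (mir k) = k"
proof -
  assume k: "k \<in> Mplus n"
  then obtain x y z where d: "(x, y, z) \<in> dirs (even n)" "k = freq n (x, y, z)"
    by (auto simp: Mplus_eq)
  then have "mir (mir k) = - mir (freq n (- x, - y, - z))"
    using mir_uminus_Mplus[of "freq n (- x, - y, - z)" n] dirs_uminus[OF d(1)] by (simp add: mir_freq Mplus_eq)
  then show ?thesis
    using mir_freq[OF dirs_uminus[OF d(1)]] d(2) by simp
qed

lemma mir_mir: "k \<in> MM \<Longrightarrow> mir (mir k) = k"
proof -
  assume "k \<in> MM"
  then consider n where "k \<in> Mplus n" | n where "- k \<in> Mplus n" by (auto simp: MM_iff)
  then show ?thesis
  proof cases
    case 2
    then have "mir k = - mir (- k)" using mir_uminus_Mplus[of "- k"] by simp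
    also have "mir \<dots> = - mir (mir (- k))"
      using mir_uminus_Mplus[of "- mir (- k)"] mir_Mplus[OF 2] by simp
    finally show ?thesis using mir_mir_Mplus[OF 2] by simp
  qed (rule mir_mir_Mplus)
qed

lemma M_sigma_mult: "M_sigma *v x = x - (2/3 * (sigma \<bullet> x)) *\<^sub>R sigma"
  by (rule vec3_eqI) (simp_all add: M_sigma_def matrix_vector_mult_def sum_3 inner_3 mat_def algebra_simps)

lemma rvec_mir:
  assumes "k \<in> MM"
  shows "rvec (mir k) = M_sigma *v rvec k"
proof -
  obtain n where "k \<in> Mplus n \<or> - k \<in> Mplus n" using assms by (auto simp: MM_iff)
  then obtain m where m: "k $ 1 + k $ 2 + k $ 3 = 3 * m"
    using Mplus_sum[of k n] Mplus_sum[of "- k" n]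
    by (metis (no_types, opaque_lifting) add.inverse_inverse minus_add_distrib mult_minus_right vector_uminus_component)
  have "real_of_int (k $ 1) + real_of_int (k $ 2) + real_of_int (k $ 3) = 3 * real_of_int m"
    using m by (metis of_int_add of_int_mult of_int_numeral)
  then show ?thesis
    by (simp add: vec_eq_iff M_sigma_mult mir_nth m inner_3)
qed

lemma M_sigma_sigma: "M_sigma *v sigma = - sigma"
  by (rule vec3_eqI) (simp_all add: M_sigma_mult inner_3)

lemma M_sigma_inner: "(M_sigma *v x) \<bullet> y = x \<bullet> (M_sigma *v y)"
  by (simp add: M_sigma_mult inner_diff_left inner_diff_right inner_commute)

lemma M_sigma_invol: "M_sigma *v (M_sigma *v x) = x"
  by (rule vec3_eqI) (simp_all add: M_sigma_mult inner_3 field_simps)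

lemma M_sigma_norm: "norm (M_sigma *v x) = norm x"
  by (simp add: norm_eq_sqrt_inner M_sigma_inner M_sigma_invol)

text \<open>\<open>M_sigma\<close> is orthogonal and sends \<open>sigma\<close> to its negative, so
  projecting the fixed vector \<open>sigma\<close> along the reflected frequency produces a minus
  sign.\<close>

lemma vdir_mir:
  assumes "k \<in> MM"
  shows "vdir (mir k) = - (M_sigma *v vdir k)"
proof -
  have l: "linear ((*v) M_sigma)" by simp
  have "(M_sigma *v rvec k) \<bullet> sigma = - (rvec k \<bullet> sigma)"
    by (simp add: M_sigma_inner M_sigma_sigma)
  then have sp: "sigma_perp (mir k) = - (M_sigma *v sigma_perp k)"
    by (simp add: sigma_perp_def rvec_mir[OF assms] M_sigma_norm linear_diff[OF l] linear_scale[OF l] M_sigma_sigma)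
  have "norm (sigma_perp (mir k)) = norm (sigma_perp k)"
    by (simp add: sp M_sigma_norm)
  then show ?thesis
    by (simp add: vdir_def sp linear_scale[OF l])
qed

text \<open>An even level is a single permutation orbit. An odd level consists of two, and the
  negated reflection of h^m is a permutation of j^m; the signs in \<open>neg\<close> and
  \<open>mir\<close> cancel along this link.\<close>

lemma orbit_const:
  fixes c :: "int^3 \<Rightarrow> 'a::group_add"
  assumes perm: "\<And>p k. bij p \<Longrightarrow> k \<in> MM \<Longrightarrow> c (permute_vec p k) = c k"
    and neg: "\<And>k. k \<in> MM \<Longrightarrow> c (- k) = - c k"
    and mir: "\<And>k. k \<in> MM \<Longrightarrow> c (mir k) = - c k"
    and k: "k \<in> Mplus n" "k' \<in> Mplus n"
  shows "c k = c k'"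
proof -
  have MM: "k \<in> Mplus n \<Longrightarrow> k \<in> MM" for k by (auto simp: MM_iff)
  have id: "v \<in> perms v" for v :: "int^3"
  proof -
    have "v = permute_vec id v" by (simp add: vec_eq_iff)
    then show ?thesis unfolding perms_def by blast
  qed
  have perms: "c w = c v" if "v \<in> MM" "w \<in> perms v" for v w
    using that perm by (auto simp: perms_def)
  show ?thesis
  proof (cases "even n")
    case True
    then have "c k = c (kfreq (n div 2))" "c k' = c (kfreq (n div 2))"
      using k MM id by (auto simp: Mplus_def intro!: perms)
    then show ?thesis by simp
  next
    case False
    define h j where "h = hfreq (n div 2)" and "j = jfreq (n div 2)"
    have hj: "h \<in> Mplus n" "j \<in> Mplus n"
      using False id by (auto simp: Mplus_def h_def j_def)
    have n: "n = Suc (2 * (n div 2))" using False by presburger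
    have "- mir h = vec3 (j $ 2, j $ 3, j $ 1)"
    proof -
      have "(h $ 1 + h $ 2 + h $ 3) div 3 = 2 ^ n"
        using Mplus_sum[OF hj(1)] by simp
      then show ?thesis
        using n by (intro vec3_eqI) (simp_all add: mir_nth h_def j_def hfreq_def jfreq_def)
    qed
    then have "- mir h \<in> perms j"
      by (simp add: perms_eq)
    then have "c (- mir h) = c j"
      by (rule perms[OF MM[OF hj(2)]])
    then have "c h = c j"
      using neg[of "mir h"] mir[of h] MM[OF hj(1)] mir_MM by simp
    moreover have "c w = c h \<or> c w = c j" if "w \<in> Mplus n" for w
      using that False perms[OF MM[OF hj(1)]] perms[OF MM[OF hj(2)]]
      by (auto simp: Mplus_def h_def j_def)
    ultimately show ?thesis using k by metis
  qed
qed

section \<open>Symmetric fields\<close>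

subsection \<open>Sums over the frequency set\<close>

definition Mpm :: "nat \<Rightarrow> (int^3) set" where
  "Mpm n = Mplus n \<union> uminus ` Mplus n"

lemma mem_Mpm: "k \<in> Mpm n \<longleftrightarrow> k \<in> Mplus n \<or> - k \<in> Mplus n"
  unfolding Mpm_def by (auto simp: image_iff) (metis minus_minus)

lemma finite_Mpm [simp]: "finite (Mpm n)"
  by (simp add: Mpm_def)

lemma sum_Mpm: "(\<Sum>k\<in>Mpm n. f k) = (\<Sum>k\<in>Mplus n. f k + f (- k))"
proof -
  have "(\<Sum>k\<in>Mpm n. f k) = (\<Sum>k\<in>Mplus n. f k) + (\<Sum>k\<in>uminus ` Mplus n. f k)"
    unfolding Mpm_def by (rule sum.union_disjoint) (auto dest: uminus_Mplus)
  also have "(\<Sum>k\<in>uminus ` Mplus n. f k) = (\<Sum>k\<in>Mplus n. f (- k))"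
    by (subst sum.reindex) (auto simp: inj_on_def)
  finally show ?thesis by (simp add: sum.distrib)
qed

lemma Mpm_level: "k \<in> Mpm n \<Longrightarrow> k \<in> Mpm m \<Longrightarrow> n = m"
  using Mplus_level[of k n m] Mplus_level[of "- k" n m] uminus_Mplus[of k n m] uminus_Mplus[of "- k" n m]
  by (auto simp: mem_Mpm)

lemma bij_betw_levels: "bij_betw snd (Sigma UNIV Mpm) MM"
  unfolding bij_betw_def
proof
  show "inj_on snd (Sigma UNIV Mpm)"
    by (auto simp: inj_on_def dest: Mpm_level)
  show "snd ` Sigma UNIV Mpm = MM"
    by (auto simp: MM_iff image_iff mem_Mpm)
qed

text \<open>The levels partition \<open>MM\<close> into finite sets, so sums over the lattice become
  series over the level.\<close>

lemma summable_on_levels_nonneg: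
  fixes f :: "int^3 \<Rightarrow> real"
  assumes nn: "\<And>k. f k \<ge> 0" and z: "\<And>k. k \<notin> MM \<Longrightarrow> f k = 0"
  shows "f summable_on UNIV \<longleftrightarrow> summable (\<lambda>n. \<Sum>k\<in>Mpm n. f k)"
proof -
  have "f summable_on UNIV \<longleftrightarrow> f summable_on MM"
    by (rule summable_on_cong_neutral) (auto simp: z)
  also have "\<dots> \<longleftrightarrow> (\<lambda>p. f (snd p)) summable_on (Sigma UNIV Mpm)"
    by (rule summable_on_reindex_bij_betw [OF bij_betw_levels, symmetric])
  also have "\<dots> \<longleftrightarrow> (\<lambda>n. \<Sum>k\<in>Mpm n. f k) summable_on UNIV"
  proof
    assume "(\<lambda>p. f (snd p)) summable_on (Sigma UNIV Mpm)"
    then have "(\<lambda>n. infsum (\<lambda>k. f (snd (n, k))) (Mpm n)) summable_on UNIV"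
      by (rule summable_on_SigmaD) auto
    then show "(\<lambda>n. \<Sum>k\<in>Mpm n. f k) summable_on UNIV" by simp
  next
    assume "(\<lambda>n. \<Sum>k\<in>Mpm n. f k) summable_on UNIV"
    then show "(\<lambda>p. f (snd p)) summable_on (Sigma UNIV Mpm)"
      by (rule summable_on_SigmaI [rotated]) (auto simp: nn intro: has_sum_finite)
  qed
  also have "\<dots> \<longleftrightarrow> summable (\<lambda>n. \<Sum>k\<in>Mpm n. f k)"
    by (rule summable_on_UNIV_nonneg_real_iff) (simp add: nn sum_nonneg)
  finally show ?thesis .
qed

lemma sums_levels:
  fixes f :: "int^3 \<Rightarrow> 'a::banach"
  assumes z: "\<And>k. k \<notin> MM \<Longrightarrow> f k = 0" and sm: "f summable_on UNIV"
  shows "(\<lambda>n. \<Sum>k\<in>Mpm n. f k) sums infsum f UNIV"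
proof -
  have "(f has_sum infsum f UNIV) UNIV" using sm by simp
  then have "(f has_sum infsum f UNIV) MM"
    by (subst has_sum_cong_neutral [where T = UNIV and g = f]) (auto simp: z)
  then have "((\<lambda>p. f (snd p)) has_sum infsum f UNIV) (Sigma UNIV Mpm)"
    by (subst has_sum_reindex_bij_betw [OF bij_betw_levels])
  then have "((\<lambda>n. \<Sum>k\<in>Mpm n. f k) has_sum infsum f UNIV) UNIV"
    by (rule has_sum_SigmaD) (auto intro: has_sum_finite)
  then show ?thesis by (rule has_sum_imp_sums)
qed

subsection \<open>The fields with prescribed symmetric coefficients\<close>

definition mode :: "nat \<Rightarrow> vfield" where
  "mode n x = - 2 *\<^sub>R (\<Sum>k\<in>Mplus n. sin (2 * pi * (rvec k \<bullet> x)) *\<^sub>R vdir k)"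

definition usym :: "(nat \<Rightarrow> real) \<Rightarrow> vfield" where
  "usym \<psi> x = (\<Sum>n. \<psi> n *\<^sub>R mode n x)"

text \<open>The weight of \<open>Hdot s\<close> on level \<open>n\<close> exceeds \<open>25 ^ n\<close> when \<open>s > 5/2\<close>, hence the rate \<open>1/5\<close>.\<close>

definition decay :: "(nat \<Rightarrow> real) \<Rightarrow> bool" where
  "decay \<psi> \<longleftrightarrow> (\<exists>C. \<forall>n. \<bar>\<psi> n\<bar> \<le> C * (1/5) ^ n)"

text \<open>Origin of the signs: -2 sin t = i (exp (i t) - exp (-i t)). Both uses of
  \<open>THE\<close> are unambiguous because distinct levels are disjoint.\<close>

definition cf :: "(nat \<Rightarrow> real) \<Rightarrow> int^3 \<Rightarrow> complex" where
  "cf \<psi> k = (if \<exists>n. k \<in> Mplus n then \<i> * \<psi> (THE n. k \<in> Mplus n)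
     else if \<exists>n. - k \<in> Mplus n then - \<i> * \<psi> (THE n. - k \<in> Mplus n) else 0)"

definition scoef :: "(nat \<Rightarrow> real) \<Rightarrow> int^3 \<Rightarrow> complex^3" where
  "scoef \<psi> k = cf \<psi> k *s cvec (vdir k)"

lemma cf_plus: "k \<in> Mplus n \<Longrightarrow> cf \<psi> k = \<i> * \<psi> n"
proof -
  assume k: "k \<in> Mplus n"
  then have "(THE n. k \<in> Mplus n) = n" by (blast intro: the_equality Mplus_level)
  then show ?thesis using k by (auto simp: cf_def)
qed

lemma cf_minus: "- k \<in> Mplus n \<Longrightarrow> cf \<psi> k = - \<i> * \<psi> n"
proof -
  assume k: "- k \<in> Mplus n"
  then have "(THE n. - k \<in> Mplus n) = n" by (blast intro: the_equality Mplus_level)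
  moreover have "\<not> (\<exists>n. k \<in> Mplus n)" using uminus_Mplus k by blast
  ultimately show ?thesis using k by (auto simp: cf_def)
qed

lemma cf_zero: "k \<notin> MM \<Longrightarrow> cf \<psi> k = 0"
  by (auto simp: cf_def MM_iff)

lemma norm_cf: "k \<in> Mpm n \<Longrightarrow> norm (cf \<psi> k) = \<bar>\<psi> n\<bar>"
  by (auto simp: mem_Mpm cf_plus cf_minus norm_mult)

lemma vdir_MM_norm: "k \<in> Mpm n \<Longrightarrow> norm (vdir k) = 1"
  using norm_vdir[of k n] norm_vdir[of "- k" n] by (auto simp: mem_Mpm vdir_uminus)

lemma cvec_nth [simp]: "cvec v $ i = complex_of_real (v $ i)"
  by (simp add: cvec_def)

lemma scoef_nth: "scoef \<psi> k $ i = cf \<psi> k * complex_of_real (vdir k $ i)"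
  by (simp add: scoef_def)

text \<open>The weight \<open>4 ^ n\<close> leaves room for the factor \<open>3 * 2 ^ n\<close> of
  one derivative, and 4/5 < 1 still gives a geometric majorant.\<close>

lemma summable_decay4: "decay \<psi> \<Longrightarrow> summable (\<lambda>n. 4 ^ n * \<bar>\<psi> n\<bar>)"
proof -
  assume "decay \<psi>"
  then obtain C where C: "\<And>n. \<bar>\<psi> n\<bar> \<le> C * (1/5) ^ n" by (auto simp: decay_def)
  show ?thesis
  proof (rule summable_comparison_test')
    show "summable (\<lambda>n. C * (4/5) ^ n :: real)" by (intro summable_mult summable_geometric) simp
    fix n
    have "4 ^ n * \<bar>\<psi> n\<bar> \<le> 4 ^ n * (C * (1/5) ^ n)" by (intro mult_left_mono C) simp
    then show "norm (4 ^ n * \<bar>\<psi> n\<bar>) \<le> C * (4/5) ^ n" by (simp add: power_divide mult_ac)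
  qed
qed

lemma card_Mpm: "card (Mpm n) = 12"
proof -
  have "card (Mpm n) = (\<Sum>k\<in>Mpm n. 1)" by simp
  also have "\<dots> = 12" unfolding sum_Mpm by (simp add: card_Mplus)
  finally show ?thesis .
qed

lemma norm_rvec_Mpm: "k \<in> Mpm n \<Longrightarrow> norm (rvec k) = sqrt (Kn n)"
  using norm_rvec_sq[of k n] norm_rvec_sq[of "- k" n]
  by (metis mem_Mpm norm_minus_cancel norm_ge_zero real_sqrt_unique rvec_simps(2))

lemma norm_rvec_le: "k \<in> Mpm n \<Longrightarrow> norm (rvec k) \<le> 3 * 2 ^ n"
proof -
  assume k: "k \<in> Mpm n"
  have "(3::real) ^ n \<le> 4 ^ n" by (rule power_mono) auto
  then have "Kn n \<le> 9 * 4 ^ n" unfolding Kn_def using zero_le_power[of "4::real" n] by linarith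
  also have "\<dots> = (3 * 2 ^ n)\<^sup>2" by (simp add: power_mult_distrib power_mult [symmetric] mult.commute[of n] power_mult)
  finally have "sqrt (Kn n) \<le> 3 * 2 ^ n" by (simp add: real_le_lsqrt)
  then show ?thesis by (simp add: norm_rvec_Mpm[OF k])
qed

lemma summable_on_decay:
  assumes "decay \<psi>" and z: "\<And>k. k \<notin> MM \<Longrightarrow> a k = 0"
    and b: "\<And>n k. k \<in> Mpm n \<Longrightarrow> norm (a k) \<le> B * 4 ^ n * \<bar>\<psi> n\<bar>"
  shows "(\<lambda>k. norm (a k)) summable_on UNIV"
proof (subst summable_on_levels_nonneg)
  show "summable (\<lambda>n. \<Sum>k\<in>Mpm n. norm (a k))"
  proof (rule summable_comparison_test')
    show "summable (\<lambda>n. 12 * B * (4 ^ n * \<bar>\<psi> n\<bar>))"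
      by (intro summable_mult summable_decay4 assms)
    fix n
    have "(\<Sum>k\<in>Mpm n. norm (a k)) \<le> (\<Sum>k\<in>Mpm n. B * 4 ^ n * \<bar>\<psi> n\<bar>)"
      by (intro sum_mono b)
    then show "norm (\<Sum>k\<in>Mpm n. norm (a k)) \<le> 12 * B * (4 ^ n * \<bar>\<psi> n\<bar>)"
      by (simp add: card_Mpm sum_nonneg mult_ac)
  qed
qed (auto simp: z)

lemma vdir_nth_le: "k \<in> Mpm n \<Longrightarrow> \<bar>vdir k $ i\<bar> \<le> 1"
  using component_le_norm_cart[of "vdir k" i] vdir_MM_norm[of k n] by simp

lemma summable_scoef:
  assumes "decay \<psi>"
  shows "(\<lambda>k. norm (scoef \<psi> k $ i)) summable_on UNIV"
proof (rule summable_on_decay [OF assms])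
  fix n k assume k: "k \<in> Mpm n"
  have "\<bar>\<psi> n\<bar> * \<bar>vdir k $ i\<bar> \<le> \<bar>\<psi> n\<bar> * 1"
    by (intro mult_left_mono vdir_nth_le[OF k]) simp
  also have "\<dots> \<le> 1 * 4 ^ n * \<bar>\<psi> n\<bar>"
    using mult_right_mono[of 1 "4 ^ n" "\<bar>\<psi> n\<bar>"] by simp
  finally show "norm (scoef \<psi> k $ i) \<le> 1 * 4 ^ n * \<bar>\<psi> n\<bar>"
    by (simp add: scoef_nth norm_mult norm_cf[OF k])
qed (simp add: scoef_nth cf_zero)

lemma summable_dscoef:
  assumes "decay \<psi>"
  shows "(\<lambda>k. norm (2 * complex_of_real pi * \<i> * complex_of_real (rvec k \<bullet> h) * scoef \<psi> k $ i)) summable_on UNIV"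
proof (rule summable_on_decay [OF assms])
  fix n k assume k: "k \<in> Mpm n"
  have "\<bar>rvec k \<bullet> h\<bar> \<le> 3 * 2 ^ n * norm h"
    using Cauchy_Schwarz_ineq2[of "rvec k" h] mult_right_mono[OF norm_rvec_le[OF k], of "norm h"] by simp
  also have "\<dots> \<le> 3 * 4 ^ n * norm h" by (intro mult_mono power_mono) auto
  finally have "\<bar>rvec k \<bullet> h\<bar> * (\<bar>\<psi> n\<bar> * \<bar>vdir k $ i\<bar>) \<le> (3 * 4 ^ n * norm h) * (\<bar>\<psi> n\<bar> * 1)"
    by (intro mult_mono vdir_nth_le[OF k] mult_nonneg_nonneg) auto
  then show "norm (2 * complex_of_real pi * \<i> * complex_of_real (rvec k \<bullet> h) * scoef \<psi> k $ i)
      \<le> (6 * pi * norm h) * 4 ^ n * \<bar>\<psi> n\<bar>"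
    by (simp add: scoef_nth norm_mult norm_cf[OF k] mult_ac)
qed (simp add: scoef_nth cf_zero)

lemma mode_nth:
  "complex_of_real (\<psi> n * mode n x $ i) = (\<Sum>k\<in>Mpm n. scoef \<psi> k $ i * fchar k x)"
proof -
  have "scoef \<psi> k $ i * fchar k x + scoef \<psi> (- k) $ i * fchar (- k) x
      = complex_of_real (\<psi> n * (- 2 * (sin (2 * pi * (rvec k \<bullet> x)) * vdir k $ i)))" if "k \<in> Mplus n" for k
    using that by (simp add: scoef_nth cf_plus cf_minus vdir_uminus fchar_cis complex_eq_iff)
  then have "(\<Sum>k\<in>Mpm n. scoef \<psi> k $ i * fchar k x)
      = (\<Sum>k\<in>Mplus n. complex_of_real (\<psi> n * (- 2 * (sin (2 * pi * (rvec k \<bullet> x)) * vdir k $ i))))"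
    unfolding sum_Mpm by (intro sum.cong) auto
  also have "\<dots> = complex_of_real (\<psi> n * mode n x $ i)"
    by (simp add: mode_def sum_distrib_left sum_negf del: of_real_mult)
  finally show ?thesis ..
qed

lemma norm_mode_le: "norm (mode n x) \<le> 12"
proof -
  have "norm (\<Sum>k\<in>Mplus n. sin (2 * pi * (rvec k \<bullet> x)) *\<^sub>R vdir k) \<le> (\<Sum>k\<in>Mplus n. 1)"
    by (rule sum_norm_le) (simp add: norm_vdir)
  then show ?thesis by (simp add: mode_def card_Mplus)
qed

lemma summable_usym:
  assumes "decay \<psi>"
  shows "summable (\<lambda>n. norm (\<psi> n *\<^sub>R mode n x))"
proof (rule summable_comparison_test')
  show "summable (\<lambda>n. 12 * (4 ^ n * \<bar>\<psi> n\<bar>))"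
    by (intro summable_mult summable_decay4 assms)
  fix n
  have "\<bar>\<psi> n\<bar> * norm (mode n x) \<le> \<bar>\<psi> n\<bar> * (12 * 4 ^ n)"
    using norm_mode_le[of n x] by (intro mult_left_mono) (auto intro: order_trans)
  then show "norm (norm (\<psi> n *\<^sub>R mode n x)) \<le> 12 * (4 ^ n * \<bar>\<psi> n\<bar>)" by (simp add: mult_ac)
qed

lemma usym_nth_sums: "decay \<psi> \<Longrightarrow> (\<lambda>n. \<psi> n * mode n x $ i) sums (usym \<psi> x $ i)"
proof -
  assume "decay \<psi>"
  then have "(\<lambda>n. \<psi> n *\<^sub>R mode n x) sums usym \<psi> x"
    unfolding usym_def by (intro summable_sums summable_norm_cancel[OF summable_usym])
  from bounded_linear.sums[OF bounded_linear_vec_nth this, of i] show ?thesis by simp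
qed

lemma usym_nth:
  assumes "decay \<psi>"
  shows "complex_of_real (usym \<psi> x $ i) = cser (\<lambda>k. scoef \<psi> k $ i) x"
proof -
  have "(\<lambda>k. scoef \<psi> k $ i * fchar k x) summable_on UNIV"
    using has_sum_cser[OF summable_scoef[OF assms]] by (rule has_sum_imp_summable)
  then have "(\<lambda>n. \<Sum>k\<in>Mpm n. scoef \<psi> k $ i * fchar k x) sums (\<Sum>\<^sub>\<infinity>k. scoef \<psi> k $ i * fchar k x)"
    by (intro sums_levels) (simp_all add: scoef_nth cf_zero)
  then have "(\<lambda>n. complex_of_real (\<psi> n * mode n x $ i)) sums cser (\<lambda>k. scoef \<psi> k $ i) x"
    by (simp only: cser_def mode_nth)
  moreover have "(\<lambda>n. complex_of_real (\<psi> n * mode n x $ i)) sums complex_of_real (usym \<psi> x $ i)"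
    by (rule sums_of_real) (rule usym_nth_sums[OF assms])
  ultimately show ?thesis by (rule sums_unique2 [symmetric])
qed

lemma fourier_series_scoef:
  assumes "decay \<psi>"
  shows "fourier_series (scoef \<psi>) = usym \<psi>"
proof
  fix x
  have "fourier_series (scoef \<psi>) x $ i = Re (cser (\<lambda>k. scoef \<psi> k $ i) x)" for i
    by (simp add: fourier_series_def cser_def fchar_def)
  then show "fourier_series (scoef \<psi>) x = usym \<psi> x"
    by (simp add: vec_eq_iff usym_nth [OF assms, symmetric])
qed

lemma fcoeff_usym: "decay \<psi> \<Longrightarrow> fcoeff (usym \<psi>) k = scoef \<psi> k"
  by (simp add: vec_eq_iff fcoeff_eq_fc usym_nth fc_cser summable_scoef)

lemma continuous_usym: "decay \<psi> \<Longrightarrow> continuous_on S (usym \<psi>)"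
proof -
  assume d: "decay \<psi>"
  have "continuous_on S (\<lambda>x. Re (cser (\<lambda>k. scoef \<psi> k $ i) x))" for i
    by (intro continuous_intros continuous_cser summable_scoef d)
  then have "continuous_on S (\<lambda>x. usym \<psi> x $ i)" for i
    by (simp add: usym_nth [OF d, symmetric])
  then have "continuous_on S (\<lambda>x. \<chi> i. usym \<psi> x $ i)"
    by (rule continuous_on_vec_lambda)
  then show ?thesis by simp
qed

lemma periodic_usym: "decay \<psi> \<Longrightarrow> periodic (usym \<psi>)"
proof -
  assume d: "decay \<psi>"
  have "complex_of_real (usym \<psi> (x + axis j 1) $ i) = complex_of_real (usym \<psi> x $ i)" for x j i
    by (simp only: usym_nth[OF d] cser_periodic)
  then show ?thesis by (simp add: periodic_def vec_eq_iff)
qed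

lemma cf_inject: "(\<And>k. cf \<psi> k = cf \<phi> k) \<Longrightarrow> \<psi> = \<phi>"
proof
  fix n assume eq: "\<And>k. cf \<psi> k = cf \<phi> k"
  have "Mplus n \<noteq> {}" using card_Mplus[of n] by auto
  then obtain k where "k \<in> Mplus n" by blast
  then show "\<psi> n = \<phi> n" using eq[of k] by (simp add: cf_plus)
qed

lemma scoef_inject:
  assumes "\<And>k. scoef \<psi> k = scoef \<phi> k"
  shows "\<psi> = \<phi>"
proof (rule cf_inject)
  fix k
  show "cf \<psi> k = cf \<phi> k"
  proof (cases "k \<in> MM")
    case True
    then obtain n where "k \<in> Mpm n" by (auto simp: MM_iff mem_Mpm)
    then have "vdir k \<noteq> 0" using vdir_MM_norm by fastforce
    then obtain i where "vdir k $ i \<noteq> 0" by (auto simp: vec_eq_iff)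
    moreover have "scoef \<psi> k $ i = scoef \<phi> k $ i" using assms by simp
    ultimately show ?thesis by (simp add: scoef_nth)
  qed (simp add: cf_zero)
qed

lemma usym_inject: "decay \<psi> \<Longrightarrow> decay \<phi> \<Longrightarrow> usym \<psi> = usym \<phi> \<Longrightarrow> \<psi> = \<phi>"
  by (rule scoef_inject) (metis fcoeff_usym)

subsection \<open>The gradient\<close>

definition dmode :: "nat \<Rightarrow> real^3 \<Rightarrow> real^3 \<Rightarrow> real^3" where
  "dmode n x h = - (4 * pi) *\<^sub>R (\<Sum>k\<in>Mplus n. (cos (2 * pi * (rvec k \<bullet> x)) * (rvec k \<bullet> h)) *\<^sub>R vdir k)"

definition dusym :: "(nat \<Rightarrow> real) \<Rightarrow> real^3 \<Rightarrow> real^3 \<Rightarrow> real^3" where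
  "dusym \<psi> x h = (\<Sum>n. \<psi> n *\<^sub>R dmode n x h)"

lemma mode_has_derivative: "(mode n has_derivative dmode n x) (at x)"
proof -
  have "((\<lambda>x. - 2 *\<^sub>R (\<Sum>k\<in>Mplus n. sin (2 * pi * (rvec k \<bullet> x)) *\<^sub>R vdir k)) has_derivative
      (\<lambda>h. - 2 *\<^sub>R (\<Sum>k\<in>Mplus n. (2 * pi * (rvec k \<bullet> h) * cos (2 * pi * (rvec k \<bullet> x))) *\<^sub>R vdir k))) (at x)"
    by (auto intro!: derivative_eq_intros sum.cong simp: mult_ac)
  moreover have "(\<lambda>h. - 2 *\<^sub>R (\<Sum>k\<in>Mplus n. (2 * pi * (rvec k \<bullet> h) * cos (2 * pi * (rvec k \<bullet> x))) *\<^sub>R vdir k)) = dmode n x"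
    by (simp add: fun_eq_iff dmode_def scaleR_sum_right mult_ac)
  ultimately show ?thesis by (simp add: mode_def [abs_def])
qed

lemma norm_dmode_le: "norm (dmode n x h) \<le> 72 * pi * 4 ^ n * norm h"
proof -
  have "norm (\<Sum>k\<in>Mplus n. (cos (2 * pi * (rvec k \<bullet> x)) * (rvec k \<bullet> h)) *\<^sub>R vdir k) \<le> (\<Sum>k\<in>Mplus n. 3 * 4 ^ n * norm h)"
  proof (rule sum_norm_le)
    fix k assume k: "k \<in> Mplus n"
    have "\<bar>cos (2 * pi * (rvec k \<bullet> x))\<bar> * \<bar>rvec k \<bullet> h\<bar> \<le> 1 * (norm (rvec k) * norm h)"
      by (intro mult_mono Cauchy_Schwarz_ineq2) auto
    also have "\<dots> \<le> 3 * 2 ^ n * norm h"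
      using norm_rvec_le[of k n] k by (simp add: mem_Mpm mult_right_mono)
    also have "\<dots> \<le> 3 * 4 ^ n * norm h" by (intro mult_mono power_mono) auto
    finally show "norm ((cos (2 * pi * (rvec k \<bullet> x)) * (rvec k \<bullet> h)) *\<^sub>R vdir k) \<le> 3 * 4 ^ n * norm h"
      by (simp add: norm_vdir[OF k] abs_mult)
  qed
  then show ?thesis by (simp add: dmode_def card_Mplus mult_ac)
qed

lemma summable_dusym:
  assumes "decay \<psi>"
  shows "summable (\<lambda>n. norm (\<psi> n *\<^sub>R dmode n x h))"
proof (rule summable_comparison_test')
  show "summable (\<lambda>n. 72 * pi * norm h * (4 ^ n * \<bar>\<psi> n\<bar>))"
    by (intro summable_mult summable_decay4 assms)
  fix n
  show "norm (norm (\<psi> n *\<^sub>R dmode n x h)) \<le> 72 * pi * norm h * (4 ^ n * \<bar>\<psi> n\<bar>)"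
    using mult_left_mono[OF norm_dmode_le[of n x h], of "\<bar>\<psi> n\<bar>"] by (simp add: mult_ac)
qed

lemma dusym_linear:
  assumes "decay \<psi>"
  shows "dusym \<psi> x (a *\<^sub>R h + b *\<^sub>R g) = a *\<^sub>R dusym \<psi> x h + b *\<^sub>R dusym \<psi> x g"
proof -
  have s: "summable (\<lambda>n. \<psi> n *\<^sub>R dmode n x h)" for h
    by (rule summable_norm_cancel[OF summable_dusym[OF assms]])
  interpret l: bounded_linear "dmode n x" for n
    using mode_has_derivative by (rule has_derivative_bounded_linear)
  have "(\<lambda>n. \<psi> n *\<^sub>R dmode n x (a *\<^sub>R h + b *\<^sub>R g)) sums (a *\<^sub>R dusym \<psi> x h + b *\<^sub>R dusym \<psi> x g)"
  proof -
    have "(\<lambda>n. a *\<^sub>R (\<psi> n *\<^sub>R dmode n x h) + b *\<^sub>R (\<psi> n *\<^sub>R dmode n x g)) sums (a *\<^sub>R dusym \<psi> x h + b *\<^sub>R dusym \<psi> x g)"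
      unfolding dusym_def by (intro sums_add sums_scaleR_right summable_sums s)
    then show ?thesis
      by (simp add: l.add l.scaleR scaleR_add_right mult.commute)
  qed
  then show ?thesis unfolding dusym_def by (simp add: sums_unique [symmetric])
qed

text \<open>Term by term differentiation; the tails of the summable majorant \<open>?b\<close> bound
  the error of the derivatives uniformly in space.\<close>

lemma usym_has_derivative:
  assumes d: "decay \<psi>"
  shows "(usym \<psi> has_derivative dusym \<psi> x) (at x)"
proof -
  let ?b = "\<lambda>n. 72 * pi * (4 ^ n * \<bar>\<psi> n\<bar>)"
  have sb: "summable ?b" by (intro summable_mult summable_decay4 d)
  have nb: "norm (\<psi> n *\<^sub>R dmode n x h) \<le> ?b n * norm h" for n x h
    using mult_left_mono[OF norm_dmode_le[of n x h], of "\<bar>\<psi> n\<bar>"] by (simp add: mult_ac)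
  have "\<exists>g. \<forall>x\<in>UNIV. (\<lambda>n. \<psi> n *\<^sub>R mode n x) sums (g x) \<and> (g has_derivative dusym \<psi> x) (at x within UNIV)"
  proof (rule has_derivative_series [where f' = "\<lambda>n x h. \<psi> n *\<^sub>R dmode n x h" and x = 0])
    show "((\<lambda>x. \<psi> n *\<^sub>R mode n x) has_derivative (\<lambda>h. \<psi> n *\<^sub>R dmode n x h)) (at x within UNIV)" for n x
      by (intro derivative_intros mode_has_derivative)
    show "\<forall>\<^sub>F n in sequentially. \<forall>x\<in>UNIV. \<forall>h. norm ((\<Sum>i<n. \<psi> i *\<^sub>R dmode i x h) - dusym \<psi> x h) \<le> e * norm h"
      if "e > 0" for e
    proof -
      have "(\<lambda>n. (\<Sum>i. ?b i) - (\<Sum>i<n. ?b i)) \<longlonglongrightarrow> (\<Sum>i. ?b i) - (\<Sum>i. ?b i)"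
        by (intro tendsto_intros summable_LIMSEQ sb)
      then have "(\<lambda>n. \<Sum>i. ?b (i + n)) \<longlonglongrightarrow> 0"
        by (simp add: suminf_minus_initial_segment[OF sb])
      then have "\<forall>\<^sub>F n in sequentially. (\<Sum>i. ?b (i + n)) < e"
        using \<open>e > 0\<close> by (rule order_tendstoD)
      then show ?thesis
      proof eventually_elim
        case (elim n)
        show ?case
        proof (intro ballI allI)
          fix x h
          have s: "summable (\<lambda>n. norm (\<psi> n *\<^sub>R dmode n x h))" by (rule summable_dusym[OF d])
          have "norm ((\<Sum>i<n. \<psi> i *\<^sub>R dmode i x h) - dusym \<psi> x h) = norm (\<Sum>i. \<psi> (i + n) *\<^sub>R dmode (i + n) x h)"
            unfolding dusym_def suminf_minus_initial_segment[OF summable_norm_cancel[OF s]]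
            by (rule norm_minus_commute)
          also have "\<dots> \<le> (\<Sum>i. norm (\<psi> (i + n) *\<^sub>R dmode (i + n) x h))"
            using s by (intro summable_norm summable_ignore_initial_segment)
          also have "\<dots> \<le> (\<Sum>i. ?b (i + n) * norm h)"
            using s sb by (intro suminf_le nb summable_ignore_initial_segment[of _ n] summable_mult2
              summable_ignore_initial_segment[where f = ?b])
          also have "\<dots> = (\<Sum>i. ?b (i + n)) * norm h"
            using sb by (intro suminf_mult2 [symmetric] summable_ignore_initial_segment[where f = ?b])
          also have "\<dots> \<le> e * norm h"
            using elim by (intro mult_right_mono) auto
          finally show "norm ((\<Sum>i<n. \<psi> i *\<^sub>R dmode i x h) - dusym \<psi> x h) \<le> e * norm h" .
        qed
      qed
    qed
    show "(\<lambda>n. \<psi> n *\<^sub>R mode n 0) sums usym \<psi> 0"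
      unfolding usym_def by (intro summable_sums summable_norm_cancel[OF summable_usym] d)
  qed auto
  then obtain g where g: "\<And>x. (\<lambda>n. \<psi> n *\<^sub>R mode n x) sums (g x)" "\<And>x. (g has_derivative dusym \<psi> x) (at x)"
    by auto
  then have "g = usym \<psi>"
    by (auto simp: usym_def sums_iff)
  then show ?thesis using g(2) by simp
qed

lemma convect_usym: "decay \<psi> \<Longrightarrow> convect (usym \<psi>) x = dusym \<psi> x (usym \<psi> x)"
  unfolding convect_def by (metis usym_has_derivative frechet_derivative_at)

lemma dusym_nth:
  assumes d: "decay \<psi>"
  shows "complex_of_real (dusym \<psi> x h $ i)
    = cser (\<lambda>k. 2 * complex_of_real pi * \<i> * complex_of_real (rvec k \<bullet> h) * scoef \<psi> k $ i) x"
proof -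
  let ?a = "\<lambda>k. 2 * complex_of_real pi * \<i> * complex_of_real (rvec k \<bullet> h) * scoef \<psi> k $ i"
  have "(\<lambda>k. ?a k * fchar k x) summable_on UNIV"
    using has_sum_cser[OF summable_dscoef[OF d]] by (rule has_sum_imp_summable)
  then have "(\<lambda>n. \<Sum>k\<in>Mpm n. ?a k * fchar k x) sums (\<Sum>\<^sub>\<infinity>k. ?a k * fchar k x)"
    by (intro sums_levels) (simp_all add: scoef_nth cf_zero)
  moreover have "(\<Sum>k\<in>Mpm n. ?a k * fchar k x) = complex_of_real (\<psi> n * dmode n x h $ i)" for n
  proof -
    have "?a k * fchar k x + ?a (- k) * fchar (- k) x
        = complex_of_real (\<psi> n * (- (4 * pi) * (cos (2 * pi * (rvec k \<bullet> x)) * (rvec k \<bullet> h) * vdir k $ i)))" if "k \<in> Mplus n" for k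
      using that by (simp add: scoef_nth cf_plus cf_minus vdir_uminus fchar_cis complex_eq_iff)
    then have "(\<Sum>k\<in>Mpm n. ?a k * fchar k x)
        = (\<Sum>k\<in>Mplus n. complex_of_real (\<psi> n * (- (4 * pi) * (cos (2 * pi * (rvec k \<bullet> x)) * (rvec k \<bullet> h) * vdir k $ i))))"
      unfolding sum_Mpm by (intro sum.cong) auto
    also have "\<dots> = complex_of_real (\<psi> n * dmode n x h $ i)"
      by (simp add: dmode_def sum_distrib_left sum_negf del: of_real_mult)
    finally show ?thesis .
  qed
  ultimately have "(\<lambda>n. complex_of_real (\<psi> n * dmode n x h $ i)) sums cser ?a x"
    by (simp only: cser_def)
  moreover have "(\<lambda>n. complex_of_real (\<psi> n * dmode n x h $ i)) sums complex_of_real (dusym \<psi> x h $ i)"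
  proof (rule sums_of_real)
    have "(\<lambda>n. \<psi> n *\<^sub>R dmode n x h) sums dusym \<psi> x h"
      unfolding dusym_def by (rule summable_sums) (rule summable_norm_cancel[OF summable_dusym[OF d]])
    from bounded_linear.sums[OF bounded_linear_vec_nth this, of i]
    show "(\<lambda>n. \<psi> n * dmode n x h $ i) sums (dusym \<psi> x h $ i)" by simp
  qed
  ultimately show ?thesis by (rule sums_unique2 [symmetric])
qed

subsection \<open>The nonlinearity\<close>

text \<open>The factor \<open>2 * pi\<close> of a derivative times the common value of
  \<open>sum_down\<close> and \<open>sum_up\<close>.\<close>

definition Ac :: "nat \<Rightarrow> real" where "Ac n = 2 * pi * 2 ^ n * Pn (Suc n)"

definition Gs :: "(nat \<Rightarrow> real) \<Rightarrow> nat \<Rightarrow> real" where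
  "Gs \<psi> n = (if n = 0 then 0 else Ac (n - 1) * (\<psi> (n - 1))\<^sup>2) - Ac n * \<psi> n * \<psi> (Suc n)"

lemma has_sum_sum:
  fixes f :: "'i \<Rightarrow> 'a \<Rightarrow> 'b::topological_comm_monoid_add"
  assumes "finite I" "\<And>i. i \<in> I \<Longrightarrow> (f i has_sum S i) A"
  shows "((\<lambda>x. \<Sum>i\<in>I. f i x) has_sum (\<Sum>i\<in>I. S i)) A"
  using assms by (induction I rule: finite_induct) (auto intro: has_sum_add)

text \<open>Convolution formula for the sum over j of u_j times the j-th partial derivative of u_i:
  \<open>h\<close> is the advecting frequency and \<open>k - h\<close> the advected one.\<close>

lemma fc_convect:
  assumes d: "decay \<psi>"
  shows "((\<lambda>h. 2 * complex_of_real pi * \<i> * cf \<psi> h * cf \<psi> (k - h) * complex_of_real (vdir h \<bullet> rvec (k - h))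
      * complex_of_real (vdir (k - h) $ i)) has_sum fcoeff (convect (usym \<psi>)) k $ i) UNIV"
proof -
  let ?c = "\<lambda>j k. scoef \<psi> k $ j"
  let ?d = "\<lambda>j k. 2 * complex_of_real pi * \<i> * complex_of_real (rvec k \<bullet> axis j 1) * scoef \<psi> k $ i"
  have dc: "(\<lambda>k. norm (?d j k)) summable_on UNIV" for j
    by (rule summable_dscoef[OF d])
  have conv: "complex_of_real (convect (usym \<psi>) x $ i) = (\<Sum>j\<in>UNIV. cser (?c j) x * cser (?d j) x)" for x
  proof -
    have lin: "dusym \<psi> x u = (\<Sum>j\<in>UNIV. u $ j *\<^sub>R dusym \<psi> x (axis j 1))" for u
    proof -
      have u: "u = (u $ 1 *\<^sub>R axis 1 1 + 1 *\<^sub>R (u $ 2 *\<^sub>R axis 2 1 + u $ 3 *\<^sub>R axis 3 1))"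
        by (simp add: vec_eq_iff axis_def forall_3)
      show ?thesis
        by (subst u, subst dusym_linear[OF d], subst dusym_linear[OF d]) (simp add: sum_3 add.assoc)
    qed
    have "convect (usym \<psi>) x $ i = (\<Sum>j\<in>UNIV. usym \<psi> x $ j * dusym \<psi> x (axis j 1) $ i)"
      unfolding convect_usym[OF d] by (subst lin) simp
    then show ?thesis
      by (simp add: usym_nth[OF d] dusym_nth[OF d])
  qed
  have bound: "norm (cser (?d j) x) \<le> (\<Sum>\<^sub>\<infinity>k. norm (?d j k))" for j x
  proof -
    have "norm (cser (?d j) x) \<le> (\<Sum>\<^sub>\<infinity>k. norm (?d j k * fchar k x))"
      unfolding cser_def by (rule norm_infsum_bound) (use dc in \<open>simp add: norm_mult\<close>)
    then show ?thesis by (simp add: norm_mult)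
  qed
  have "((\<lambda>h. ?c j h * fc (cser (?d j)) (k - h)) has_sum fc (\<lambda>x. cser (?c j) x * cser (?d j) x) k) UNIV" for j
    by (rule fc_cser_mult [OF summable_scoef[OF d] continuous_cser[OF dc] bound])
  then have "((\<lambda>h. ?c j h * ?d j (k - h)) has_sum fc (\<lambda>x. cser (?c j) x * cser (?d j) x) k) UNIV" for j
    by (simp only: fc_cser[OF dc])
  then have "((\<lambda>h. \<Sum>j\<in>UNIV. ?c j h * ?d j (k - h)) has_sum (\<Sum>j\<in>UNIV. fc (\<lambda>x. cser (?c j) x * cser (?d j) x) k)) UNIV"
    by (intro has_sum_sum) auto
  moreover have "(\<Sum>j\<in>UNIV. fc (\<lambda>x. cser (?c j) x * cser (?d j) x) k) = fcoeff (convect (usym \<psi>)) k $ i"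
    unfolding fcoeff_eq_fc conv
    by (rule fc_sum [symmetric]) (intro finite continuous_on_mult continuous_cser summable_scoef d dc)+
  moreover have "(\<Sum>j\<in>UNIV. ?c j h * ?d j (k - h)) = 2 * complex_of_real pi * \<i> * cf \<psi> h * cf \<psi> (k - h)
      * complex_of_real (vdir h \<bullet> rvec (k - h)) * complex_of_real (vdir (k - h) $ i)" for h
  proof -
    have "complex_of_real (vdir h \<bullet> rvec (k - h)) = (\<Sum>j\<in>UNIV. complex_of_real (vdir h $ j) * complex_of_real (rvec (k - h) \<bullet> axis j 1))"
      by (simp add: inner_vec_def[of "vdir h"] inner_axis del: rvec_simps(4))
    then show ?thesis
      by (simp add: sum_distrib_left sum_distrib_right scoef_nth mult_ac del: rvec_simps(4))
  qed
  ultimately show ?thesis by simp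
qed

lemma fcoeff_uminus: "fcoeff u (- k) $ i = cnj (fcoeff u k $ i)"
  using fc_cnj[of "\<lambda>x. complex_of_real (u x $ i)" "- k"] by (simp add: fcoeff_eq_fc)

lemma Mplus_coord_sum_neg: "p \<in> Mplus a \<Longrightarrow> r \<in> Mplus b \<Longrightarrow> k \<in> Mplus n \<Longrightarrow> p + r + k \<noteq> 0"
proof
  assume *: "p \<in> Mplus a" "r \<in> Mplus b" "k \<in> Mplus n" "p + r + k = 0"
  then have "(p + r + k) $ 1 + (p + r + k) $ 2 + (p + r + k) $ 3 = 0" by simp
  then have "3 * 2 ^ a + 3 * 2 ^ b + 3 * 2 ^ n = (0::int)"
    using *(1-3)[THEN Mplus_sum] by simp
  moreover have "(0::int) < 2 ^ a" "(0::int) < 2 ^ b" "(0::int) < 2 ^ n" by simp_all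
  ultimately show False by linarith
qed

text \<open>Only triads with two frequencies of level \<open>m\<close> and one of level \<open>m + 1\<close> interact, and in the
  triads \<open>k = h + (k - h)\<close> with \<open>h\<close> of the higher level the transport factor vanishes.\<close>

lemma convect_coeff_plus:
  assumes d: "decay \<psi>" and k: "k \<in> Mplus n"
  shows "(\<Sum>i\<in>UNIV. complex_of_real (vdir k $ i) * fcoeff (convect (usym \<psi>)) k $ i) = - \<i> * Gs \<psi> n"
proof -
  define Q where "Q h = 2 * complex_of_real pi * \<i> * cf \<psi> h * cf \<psi> (k - h)
    * complex_of_real ((vdir h \<bullet> rvec (k - h)) * (vdir (k - h) \<bullet> vdir k))" for h
  \<comment> \<open>\<open>S1\<close> lists the splittings of \<open>k\<close> into two frequencies
    of the level below; \<open>S2\<close> lists the partners \<open>p\<close> that lift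
    \<open>k\<close> to the level above, which enter as \<open>h = - p\<close> with advected
    frequency \<open>k + p\<close>.\<close>
  define S1 where "S1 = (if n = 0 then {} else {h \<in> Mplus (n - 1). k - h \<in> Mplus (n - 1)})"
  define S2 where "S2 = {p \<in> Mplus n. k + p \<in> Mplus (Suc n)}"
  have fin: "finite S1" "finite S2"
    by (simp_all add: S1_def S2_def)
  have disj: "S1 \<inter> uminus ` S2 = {}"
    using uminus_Mplus by (force simp: S1_def S2_def)
  have "((\<lambda>h. \<Sum>i\<in>UNIV. complex_of_real (vdir k $ i) * (2 * complex_of_real pi * \<i> * cf \<psi> h * cf \<psi> (k - h)
      * complex_of_real (vdir h \<bullet> rvec (k - h)) * complex_of_real (vdir (k - h) $ i)))
      has_sum (\<Sum>i\<in>UNIV. complex_of_real (vdir k $ i) * fcoeff (convect (usym \<psi>)) k $ i)) UNIV"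
    by (intro has_sum_sum has_sum_cmult_right fc_convect d) simp
  moreover have "(\<Sum>i\<in>UNIV. complex_of_real (vdir k $ i) * (2 * complex_of_real pi * \<i> * cf \<psi> h * cf \<psi> (k - h)
      * complex_of_real (vdir h \<bullet> rvec (k - h)) * complex_of_real (vdir (k - h) $ i))) = Q h" for h
    by (simp add: Q_def inner_vec_def[of "vdir (k - h)"] sum_distrib_left mult_ac del: rvec_simps(4))
  ultimately have hs: "(Q has_sum (\<Sum>i\<in>UNIV. complex_of_real (vdir k $ i) * fcoeff (convect (usym \<psi>)) k $ i)) UNIV"
    by simp
  have Q0: "Q h = 0" if h: "h \<notin> S1 \<union> uminus ` S2" for h
  proof (cases "h \<in> MM \<and> k - h \<in> MM")
    case False
    then show ?thesis by (auto simp: Q_def cf_zero)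
  next
    case True
    then obtain a b where ab: "h \<in> Mplus a \<or> - h \<in> Mplus a" "k - h \<in> Mplus b \<or> - (k - h) \<in> Mplus b"
      unfolding MM_iff by blast
    then consider "h \<in> Mplus a" "k - h \<in> Mplus b" | "h \<in> Mplus a" "h - k \<in> Mplus b"
      | "- h \<in> Mplus a" "k - h \<in> Mplus b" | "- h \<in> Mplus a" "h - k \<in> Mplus b"
      by auto
    then show ?thesis
    proof cases
      case 1
      then have "a = b \<and> n = Suc a" using triad_levels[of h a "k - h" b n] k by simp
      then show ?thesis using 1 h by (auto simp: S1_def)
    next
      case 2
      then have ab: "n = b \<and> a = Suc n" using triad_levels[of k n "h - k" b a] k by simp
      have "vdir (k + (h - k)) \<bullet> rvec (h - k) = 0"
        by (rule triad_sum_vdir_rvec[of k n]) (use 2 k ab in auto)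
      then have "vdir h \<bullet> rvec (k - h) = 0"
        by (simp add: inner_diff_right)
      then show ?thesis by (simp only: Q_def) simp
    next
      case 3
      then have "n = a \<and> b = Suc n" using triad_levels[of k n "- h" a b] k by simp
      then have "- h \<in> S2" using 3 by (simp add: S2_def)
      then have "h \<in> uminus ` S2" by (metis image_eqI minus_minus)
      then show ?thesis using h by blast
    next
      case 4
      then show ?thesis using Mplus_coord_sum_neg[OF 4 k] by simp
    qed
  qed
  have "(Q has_sum (\<Sum>h\<in>S1 \<union> uminus ` S2. Q h)) UNIV"
    by (rule has_sum_finite_neutralI) (use fin Q0 in auto)
  with hs have "(\<Sum>i\<in>UNIV. complex_of_real (vdir k $ i) * fcoeff (convect (usym \<psi>)) k $ i) = (\<Sum>h\<in>S1 \<union> uminus ` S2. Q h)"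
    by (rule has_sum_unique)
  also have "\<dots> = (\<Sum>h\<in>S1. Q h) + (\<Sum>p\<in>S2. Q (- p))"
    using fin disj by (subst sum.union_disjoint) (auto simp: sum.reindex)
  also have "(\<Sum>h\<in>S1. Q h) = - \<i> * (if n = 0 then 0 else Ac (n - 1) * (\<psi> (n - 1))\<^sup>2)"
  proof (cases "n = 0")
    case False
    then obtain m where m: "n = Suc m" by (cases n) auto
    have "Q h = (- 2 * complex_of_real pi * \<i> * complex_of_real ((\<psi> m)\<^sup>2)) * complex_of_real ((vdir h \<bullet> rvec (k - h)) * (vdir (k - h) \<bullet> vdir k))"
      if "h \<in> S1" for h
      using that by (simp add: Q_def S1_def m cf_plus[of h m] cf_plus[of "k - h" m] power2_eq_square del: rvec_simps(4))
    then have "(\<Sum>h\<in>S1. Q h) = (- 2 * complex_of_real pi * \<i> * complex_of_real ((\<psi> m)\<^sup>2)) *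
        complex_of_real (\<Sum>h\<in>S1. (vdir h \<bullet> rvec (k - h)) * (vdir (k - h) \<bullet> vdir k))"
      by (simp only: of_real_sum sum_distrib_left) (rule sum.cong, auto)
    also have "(\<Sum>h\<in>S1. (vdir h \<bullet> rvec (k - h)) * (vdir (k - h) \<bullet> vdir k)) = 2 ^ m * Pn (Suc m)"
      using sum_down[of k m] k m by (simp add: S1_def del: rvec_simps(4))
    finally show ?thesis by (simp add: m Ac_def mult_ac)
  qed (simp add: S1_def)
  also have "(\<Sum>p\<in>S2. Q (- p)) = \<i> * (Ac n * \<psi> n * \<psi> (Suc n))"
  proof -
    have "Q (- p) = (2 * complex_of_real pi * \<i> * complex_of_real (\<psi> n * \<psi> (Suc n))) * complex_of_real ((vdir p \<bullet> rvec (k + p)) * (vdir (k + p) \<bullet> vdir k))"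
      if "p \<in> S2" for p
      using that by (simp add: Q_def S2_def cf_minus[of "- p" n] cf_plus[of "k + p" "Suc n"] vdir_uminus del: rvec_simps(3))
    then have "(\<Sum>p\<in>S2. Q (- p)) = (2 * complex_of_real pi * \<i> * complex_of_real (\<psi> n * \<psi> (Suc n))) *
        complex_of_real (\<Sum>p\<in>S2. (vdir p \<bullet> rvec (k + p)) * (vdir (k + p) \<bullet> vdir k))"
      by (simp only: of_real_sum sum_distrib_left) (rule sum.cong, auto)
    also have "(\<Sum>p\<in>S2. (vdir p \<bullet> rvec (k + p)) * (vdir (k + p) \<bullet> vdir k)) = 2 ^ n * Pn (Suc n)"
      unfolding S2_def by (rule sum_up[OF k])
    finally show ?thesis by (simp add: Ac_def mult_ac)
  qed
  finally show ?thesis by (simp add: Gs_def algebra_simps)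
qed

lemma convect_coeff:
  assumes d: "decay \<psi>" and k: "k \<in> MM"
  shows "(\<Sum>i\<in>UNIV. complex_of_real (vdir k $ i) * fcoeff (convect (usym \<psi>)) k $ i) = cf (\<lambda>n. - Gs \<psi> n) k"
proof -
  obtain n where "k \<in> Mplus n \<or> - k \<in> Mplus n" using k by (auto simp: MM_iff)
  then show ?thesis
  proof
    assume "k \<in> Mplus n"
    then show ?thesis by (simp only: convect_coeff_plus[OF d] cf_plus) simp
  next
    assume n: "- k \<in> Mplus n"
    have "(\<Sum>i\<in>UNIV. complex_of_real (vdir k $ i) * fcoeff (convect (usym \<psi>)) k $ i)
        = cnj (\<Sum>i\<in>UNIV. complex_of_real (vdir (- k) $ i) * fcoeff (convect (usym \<psi>)) (- k) $ i)"
      by (simp add: vdir_uminus fcoeff_uminus)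
    also have "\<dots> = cf (\<lambda>n. - Gs \<psi> n) k"
      by (simp only: convect_coeff_plus[OF d n] cf_minus[OF n]) simp
    finally show ?thesis .
  qed
qed

section \<open>Size of the couplings, decay of the nonlinear term and the heat semigroup\<close>

lemma Pn_le_2: "Pn n \<le> 2"
proof -
  have "6 * 3 ^ n / Kn n \<le> 6 * 3 ^ n / (2 * 3 ^ n)"
    by (intro divide_left_mono) (auto simp: Kn_def intro!: mult_pos_pos add_pos_pos)
  then have "6 * 3 ^ n / Kn n \<le> 4" by simp
  then show ?thesis
    unfolding Pn_def by (intro real_le_lsqrt) auto
qed

lemma Ac_pos [simp]: "Ac n > 0"
  by (simp add: Ac_def)

lemma Ac_le: "Ac n \<le> 4 * pi * 2 ^ n"
  using mult_left_mono[OF Pn_le_2[of "Suc n"], of "2 * pi * 2 ^ n"] by (simp add: Ac_def)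

text \<open>Products decay at the squared rate 1/25, and 2/25 < 1/5 absorbs the growth of
  \<open>Ac\<close>.\<close>

lemma Gs_bound:
  assumes C: "\<And>n. \<bar>\<psi> n\<bar> \<le> C * (1/5) ^ n"
  shows "\<bar>Gs \<psi> n\<bar> \<le> (64 * pi * C\<^sup>2) * (1/5) ^ n"
proof -
  have "C \<ge> 0" using C[of 0] by simp
  have A: "\<bar>Ac m * \<psi> a * \<psi> b\<bar> \<le> (4 * pi * C\<^sup>2) * (2 ^ m * ((1/5) ^ a * (1/5) ^ b))" for m a b
  proof -
    have "\<bar>Ac m * \<psi> a * \<psi> b\<bar> = Ac m * (\<bar>\<psi> a\<bar> * \<bar>\<psi> b\<bar>)"
      by (simp add: abs_mult less_imp_le)
    also have "\<dots> \<le> (4 * pi * 2 ^ m) * ((C * (1/5) ^ a) * (C * (1/5) ^ b))"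
      by (intro mult_mono Ac_le C mult_nonneg_nonneg) (auto simp: \<open>C \<ge> 0\<close>)
    finally show ?thesis by (simp add: power2_eq_square mult_ac)
  qed
  have q: "(2::real) ^ m * ((1/5) ^ m * (1/5) ^ m) \<le> (1/5) ^ m" for m
  proof -
    have "(2::real) ^ m * ((1/5) ^ m * (1/5) ^ m) = (2 * ((1/5) * (1/5))) ^ m"
      by (simp only: power_mult_distrib)
    also have "\<dots> \<le> (1/5) ^ m" by (rule power_mono) auto
    finally show ?thesis .
  qed
  have K: "0 \<le> 4 * pi * C\<^sup>2" by simp
  have 1: "\<bar>Ac n * \<psi> n * \<psi> (Suc n)\<bar> \<le> (4 * pi * C\<^sup>2) * (1/5) ^ n"
  proof -
    have "2 ^ n * ((1/5) ^ n * (1/5) ^ Suc n) \<le> (1/5::real) ^ n" using q[of n] by simp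
    from mult_left_mono[OF this K] show ?thesis using A[of n n "Suc n"] by linarith
  qed
  \<comment> \<open>Shifting the rate from n - 1 to n costs a factor 5, hence 20 in place of
    4.\<close>
  have 2: "\<bar>if n = 0 then 0 else Ac (n - 1) * (\<psi> (n - 1))\<^sup>2\<bar> \<le> (20 * pi * C\<^sup>2) * (1/5) ^ n"
  proof (cases n)
    case (Suc m)
    have "\<bar>Ac m * \<psi> m * \<psi> m\<bar> \<le> (4 * pi * C\<^sup>2) * (1/5) ^ m"
      using mult_left_mono[OF q[of m] K] A[of m m m] by linarith
    then show ?thesis by (simp add: Suc power2_eq_square mult_ac)
  qed simp
  have "\<bar>Gs \<psi> n\<bar> \<le> (20 * pi * C\<^sup>2) * (1/5) ^ n + (4 * pi * C\<^sup>2) * (1/5) ^ n"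
    unfolding Gs_def using 1 2 by linarith
  also have "\<dots> = (24 * pi * C\<^sup>2) * (1/5) ^ n" by (simp add: algebra_simps)
  also have "\<dots> \<le> (64 * pi * C\<^sup>2) * (1/5) ^ n" by (intro mult_right_mono) auto
  finally show ?thesis .
qed

lemma decay_Gs: "decay \<psi> \<Longrightarrow> decay (Gs \<psi>)"
  unfolding decay_def using Gs_bound by blast

lemma decay_uminus: "decay \<psi> \<Longrightarrow> decay (\<lambda>n. - \<psi> n)"
  by (simp add: decay_def)

lemma decay_mult_le1:
  assumes "decay \<psi>" "\<And>n. \<bar>m n\<bar> \<le> 1"
  shows "decay (\<lambda>n. m n * \<psi> n)"
proof -
  obtain C where C: "\<And>n. \<bar>\<psi> n\<bar> \<le> C * (1/5) ^ n" using assms(1) by (auto simp: decay_def)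
  have "\<bar>m n * \<psi> n\<bar> \<le> C * (1/5) ^ n" for n
    using mult_mono[OF assms(2)[of n] C[of n]] by (simp add: abs_mult)
  then show ?thesis by (auto simp: decay_def)
qed

text \<open>The projected nonlinearity stays in the symmetric family, with coefficients
  \<open>- Gs \<psi> n\<close>; this turns each equation for fields into one for sequences.\<close>

lemma proj_convect:
  assumes d: "decay \<psi>"
  shows "proj_M (convect (usym \<psi>)) = usym (\<lambda>n. - Gs \<psi> n)"
proof -
  have "(if k \<in> MM then (\<Sum>i\<in>UNIV. complex_of_real (vdir k $ i) * fcoeff (convect (usym \<psi>)) k $ i) *s cvec (vdir k)
      else 0) = scoef (\<lambda>n. - Gs \<psi> n) k" for k
    by (cases "k \<in> MM") (simp_all add: scoef_def convect_coeff[OF d] cf_zero)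
  then show ?thesis
    by (simp only: proj_M_def fourier_series_scoef[OF decay_uminus[OF decay_Gs[OF d]]])
qed

definition dsp :: "real \<Rightarrow> nat \<Rightarrow> real" where
  "dsp \<alpha> n = (4 * pi\<^sup>2 * Kn n) powr \<alpha>"

lemma frac_symbol_Mpm: "k \<in> Mpm n \<Longrightarrow> frac_symbol \<alpha> k = dsp \<alpha> n"
  using norm_rvec_sq[of k n] norm_rvec_sq[of "- k" n] by (auto simp: frac_symbol_def dsp_def mem_Mpm)

lemma dsp_pos [simp]: "dsp \<alpha> n > 0"
  by (simp add: dsp_def)

lemma heat_usym:
  assumes d: "decay \<psi>" and "\<nu> \<ge> 0" "t \<ge> 0"
  shows "heat_op \<nu> \<alpha> t (usym \<psi>) = usym (\<lambda>n. exp (- \<nu> * t * dsp \<alpha> n) * \<psi> n)"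
proof -
  have d': "decay (\<lambda>n. exp (- \<nu> * t * dsp \<alpha> n) * \<psi> n)"
    using assms by (intro decay_mult_le1) (auto simp: less_imp_le)
  have "complex_of_real (exp (- \<nu> * t * frac_symbol \<alpha> k)) *s fcoeff (usym \<psi>) k
      = scoef (\<lambda>n. exp (- \<nu> * t * dsp \<alpha> n) * \<psi> n) k" for k
  proof (cases "k \<in> MM")
    case True
    then obtain n where n: "k \<in> Mpm n" by (auto simp: MM_iff mem_Mpm)
    show ?thesis
      using n unfolding fcoeff_usym[OF d] frac_symbol_Mpm[OF n]
      by (auto simp: vec_eq_iff scoef_nth mem_Mpm cf_plus cf_minus)
  next
    case False
    then show ?thesis
      by (simp add: fcoeff_usym[OF d] vec_eq_iff scoef_nth cf_zero)
  qed
  then show ?thesis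
    by (simp only: heat_op_def fourier_series_scoef[OF d'])
qed

section \<open>Function spaces\<close>

lemma dsp_ge:
  assumes "s > 5/2"
  shows "25 ^ n \<le> dsp s n"
proof -
  have "(1::real) * 4 ^ n \<le> 4 * pi\<^sup>2 * Kn n"
  proof (rule mult_mono)
    have "1 * 1 \<le> pi * pi" by (rule mult_mono) (use pi_gt3 in auto)
    then show "1 \<le> 4 * pi\<^sup>2" by (simp add: power2_eq_square)
    show "4 ^ n \<le> Kn n" unfolding Kn_def using zero_le_power[of "4::real" n] zero_le_power[of "3::real" n] by linarith
  qed auto
  then have le: "4 ^ n \<le> 4 * pi\<^sup>2 * Kn n" by simp
  \<comment> \<open>At the exponent 5/2 the base 4 becomes 32, which exceeds the 25 = 5 * 5 behind
    the decay rate 1/5.\<close>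
  have "(25::real) ^ n \<le> 32 ^ n" by (rule power_mono) auto
  also have "(32::real) ^ n = (4 ^ n) powr (5/2)"
  proof -
    have "(4::real) powr (5/2) = (2 powr 2) powr (5/2)" by simp
    also have "\<dots> = 32" unfolding powr_powr by simp
    finally show ?thesis by (simp add: powr_power [symmetric] powr_realpow [symmetric] powr_powr mult.commute)
  qed
  also have "\<dots> \<le> (4 * pi\<^sup>2 * Kn n) powr (5/2)" by (rule powr_mono2) (use le in auto)
  also have "(4 * pi\<^sup>2 * Kn n) powr (5/2) \<le> (4 * pi\<^sup>2 * Kn n) powr s"
    using assms order_trans[OF _ le, of 1] by (intro powr_mono) auto
  finally show ?thesis by (simp add: dsp_def)
qed

lemma dsp_Suc_le:
  assumes "s \<ge> 0"
  shows "dsp s (Suc n) \<le> 4 powr s * dsp s n"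
proof -
  have "4 * pi\<^sup>2 * Kn (Suc n) \<le> 4 * (4 * pi\<^sup>2 * Kn n)"
    by (simp add: Kn_def)
  then have "dsp s (Suc n) \<le> (4 * (4 * pi\<^sup>2 * Kn n)) powr s"
    unfolding dsp_def using assms by (intro powr_mono2) (auto simp: less_imp_le)
  also have "\<dots> = 4 powr s * dsp s n"
    unfolding dsp_def by (rule powr_mult)
  finally show ?thesis .
qed

lemma dsp_0 [simp]: "dsp 0 n = 1"
  by (simp add: dsp_def)

lemma bound_of_summable:
  assumes s: "s > 5/2" and sm: "summable (\<lambda>n. dsp s n * (\<psi> n)\<^sup>2)"
  shows "\<bar>\<psi> n\<bar> \<le> sqrt (\<Sum>n. dsp s n * (\<psi> n)\<^sup>2) * (1/5) ^ n"
proof -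
  have "(5 ^ n * \<bar>\<psi> n\<bar>)\<^sup>2 = 25 ^ n * (\<psi> n)\<^sup>2"
    by (simp add: power_mult_distrib power_mult [symmetric] mult.commute[of n]) (simp add: power_mult)
  also have "\<dots> \<le> dsp s n * (\<psi> n)\<^sup>2"
    by (intro mult_right_mono dsp_ge s) simp
  also have "\<dots> = (\<Sum>i\<in>{n}. dsp s i * (\<psi> i)\<^sup>2)" by simp
  also have "\<dots> \<le> (\<Sum>n. dsp s n * (\<psi> n)\<^sup>2)"
    by (rule sum_le_suminf[OF sm]) (auto simp: less_imp_le)
  finally have "5 ^ n * \<bar>\<psi> n\<bar> \<le> sqrt (\<Sum>n. dsp s n * (\<psi> n)\<^sup>2)"
    by (rule real_le_rsqrt)
  then show ?thesis by (simp add: field_simps power_divide)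
qed

lemma decay_of_summable:
  "s > 5/2 \<Longrightarrow> summable (\<lambda>n. dsp s n * (\<psi> n)\<^sup>2) \<Longrightarrow> decay \<psi>"
  unfolding decay_def using bound_of_summable by blast

lemma norm_scoef: "k \<in> Mpm n \<Longrightarrow> norm (scoef \<psi> k) = \<bar>\<psi> n\<bar>"
proof -
  assume k: "k \<in> Mpm n"
  have "norm (cvec (vdir k)) = norm (vdir k)"
    by (simp add: norm_vec_def L2_set_def)
  then have 1: "norm (cvec (vdir k)) = 1"
    by (simp add: vdir_MM_norm[OF k])
  have "norm (c *s v) = norm c * norm v" for c :: complex and v :: "complex^3"
    by (simp add: norm_vec_def L2_set_def norm_mult power_mult_distrib sum_distrib_left [symmetric] real_sqrt_mult)
  then show ?thesis by (simp add: scoef_def 1 norm_cf[OF k])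
qed

lemma scoef_zero: "k \<notin> MM \<Longrightarrow> scoef \<psi> k = 0"
  by (simp add: scoef_def cf_zero vec_eq_iff)

lemma frac_symbol_nonneg [simp]: "frac_symbol s k \<ge> 0"
  by (simp add: frac_symbol_def)

lemma Hdot_sum_levels:
  "(\<Sum>k\<in>Mpm n. frac_symbol s k * (norm (scoef \<psi> k))\<^sup>2) = 12 * (dsp s n * (\<psi> n)\<^sup>2)"
proof -
  have "(\<Sum>k\<in>Mpm n. frac_symbol s k * (norm (scoef \<psi> k))\<^sup>2) = (\<Sum>k\<in>Mpm n. dsp s n * (\<psi> n)\<^sup>2)"
    by (intro sum.cong) (simp_all add: frac_symbol_Mpm norm_scoef)
  then show ?thesis by (simp add: card_Mpm)
qed

lemma Hdot_summable_iff:
  "(\<lambda>k. frac_symbol s k * (norm (scoef \<psi> k))\<^sup>2) summable_on (UNIV - {0}) \<longleftrightarrow> summable (\<lambda>n. dsp s n * (\<psi> n)\<^sup>2)"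
proof -
  have "(\<lambda>k. frac_symbol s k * (norm (scoef \<psi> k))\<^sup>2) summable_on (UNIV - {0})
      \<longleftrightarrow> (\<lambda>k. frac_symbol s k * (norm (scoef \<psi> k))\<^sup>2) summable_on UNIV"
    by (rule summable_on_cong_neutral) (auto simp: scoef_zero)
  also have "\<dots> \<longleftrightarrow> summable (\<lambda>n. 12 * (dsp s n * (\<psi> n)\<^sup>2))"
    by (subst summable_on_levels_nonneg) (auto simp: scoef_zero Hdot_sum_levels)
  also have "\<dots> \<longleftrightarrow> summable (\<lambda>n. dsp s n * (\<psi> n)\<^sup>2)"
    by (rule summable_cmult_iff[THEN trans]) simp
  finally show ?thesis .
qed

lemma Hdot_norm_usym:
  assumes d: "decay \<psi>" and sm: "summable (\<lambda>n. dsp s n * (\<psi> n)\<^sup>2)"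
  shows "Hdot_norm s (usym \<psi>) = sqrt (12 * (\<Sum>n. dsp s n * (\<psi> n)\<^sup>2))"
proof -
  have "(\<Sum>\<^sub>\<infinity>k\<in>UNIV - {0}. frac_symbol s k * (norm (scoef \<psi> k))\<^sup>2)
      = (\<Sum>\<^sub>\<infinity>k\<in>UNIV. frac_symbol s k * (norm (scoef \<psi> k))\<^sup>2)"
    by (rule infsum_cong_neutral) (auto simp: scoef_zero)
  moreover have "(\<lambda>n. \<Sum>k\<in>Mpm n. frac_symbol s k * (norm (scoef \<psi> k))\<^sup>2) sums (\<Sum>\<^sub>\<infinity>k\<in>UNIV. frac_symbol s k * (norm (scoef \<psi> k))\<^sup>2)"
  proof (rule sums_levels)
    show "(\<lambda>k. frac_symbol s k * (norm (scoef \<psi> k))\<^sup>2) summable_on UNIV"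
      using sm by (subst summable_on_levels_nonneg) (auto simp: scoef_zero Hdot_sum_levels intro: summable_mult)
  qed (simp add: scoef_zero)
  moreover have "(\<lambda>n. 12 * (dsp s n * (\<psi> n)\<^sup>2)) sums (12 * (\<Sum>n. dsp s n * (\<psi> n)\<^sup>2))"
    by (intro sums_mult summable_sums sm)
  ultimately have "(\<Sum>\<^sub>\<infinity>k\<in>UNIV - {0}. frac_symbol s k * (norm (scoef \<psi> k))\<^sup>2) = 12 * (\<Sum>n. dsp s n * (\<psi> n)\<^sup>2)"
    by (simp add: Hdot_sum_levels sums_unique2)
  then show ?thesis by (simp add: Hdot_norm_def fcoeff_usym[OF d])
qed

lemma usym_mem_Hdot_M:
  assumes d: "decay \<psi>" and sm: "summable (\<lambda>n. dsp s n * (\<psi> n)\<^sup>2)"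
  shows "usym \<psi> \<in> Hdot_M s"
proof -
  have c: "continuous_on UNIV (usym \<psi>)" by (rule continuous_usym[OF d])
  have "(LINT x:cube|lebesgue. usym \<psi> x) = 0"
  proof -
    have "complex_of_real ((LINT x:cube|lebesgue. usym \<psi> x) $ i) = fcoeff (usym \<psi>) 0 $ i" for i
    proof -
      have "integrable lebesgue (\<lambda>x. indicator cube x *\<^sub>R usym \<psi> x)"
        using integrable_cube(2)[OF c] by (simp add: set_integrable_def)
      then have "(LINT x:cube|lebesgue. usym \<psi> x) $ i = (LINT x|lebesgue. (indicator cube x *\<^sub>R usym \<psi> x) $ i)"
        unfolding set_lebesgue_integral_def
        by (rule integral_bounded_linear[OF bounded_linear_vec_nth, symmetric])
      then have "complex_of_real ((LINT x:cube|lebesgue. usym \<psi> x) $ i) = (LINT x|lebesgue. complex_of_real (indicator cube x * usym \<psi> x $ i))"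
        by (simp only: integral_complex_of_real) simp
      then show ?thesis
        by (simp add: fcoeff_eq_fc fc_def set_lebesgue_integral_def scaleR_conv_of_real)
    qed
    then show ?thesis by (simp add: fcoeff_usym[OF d] scoef_zero vec_eq_iff)
  qed
  moreover have "usym \<psi> \<in> borel_measurable lebesgue"
    using borel_measurable_continuous_onI[OF c] by (simp add: measurable_completion)
  moreover have "set_integrable lebesgue cube (\<lambda>x. (norm (usym \<psi> x))\<^sup>2)"
    by (intro integrable_cube continuous_intros c)
  ultimately have "mean_zero_L2 (usym \<psi>)"
    by (simp add: mean_zero_L2_def periodic_usym[OF d])
  moreover have "\<exists>c. scoef \<psi> k = c *s cvec (vdir k)" for k
    unfolding scoef_def by blast
  ultimately show ?thesis
    using sm scoef_zero by (auto simp: Hdot_M_def Hdot_def fcoeff_usym[OF d] Hdot_summable_iff)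
qed

section \<open>Linear combinations, truncations and recovery of the coefficients\<close>

lemma usym_lincomb:
  assumes "decay \<psi>" "decay \<phi>"
  shows "a *\<^sub>R usym \<psi> x + b *\<^sub>R usym \<phi> x = usym (\<lambda>n. a * \<psi> n + b * \<phi> n) x"
proof -
  have "(\<lambda>n. a *\<^sub>R (\<psi> n *\<^sub>R mode n x) + b *\<^sub>R (\<phi> n *\<^sub>R mode n x)) sums (a *\<^sub>R usym \<psi> x + b *\<^sub>R usym \<phi> x)"
    unfolding usym_def
    by (intro sums_add sums_scaleR_right summable_sums summable_norm_cancel[OF summable_usym] assms)
  then show ?thesis
    by (simp add: usym_def sums_iff algebra_simps)
qed

lemma usym_diff: "decay \<psi> \<Longrightarrow> decay \<phi> \<Longrightarrow> usym \<psi> x - usym \<phi> x = usym (\<lambda>n. \<psi> n - \<phi> n) x"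
  using usym_lincomb[of \<psi> \<phi> 1 x "-1"] by simp

lemma decay_lincomb:
  assumes "decay \<psi>" "decay \<phi>"
  shows "decay (\<lambda>n. a * \<psi> n + b * \<phi> n)"
proof -
  obtain C D where C: "\<And>n. \<bar>\<psi> n\<bar> \<le> C * (1/5) ^ n" and D: "\<And>n. \<bar>\<phi> n\<bar> \<le> D * (1/5) ^ n"
    using assms by (auto simp: decay_def)
  have "\<bar>a * \<psi> n + b * \<phi> n\<bar> \<le> (\<bar>a\<bar> * C + \<bar>b\<bar> * D) * (1/5) ^ n" for n
  proof -
    have "\<bar>a * \<psi> n + b * \<phi> n\<bar> \<le> \<bar>a\<bar> * \<bar>\<psi> n\<bar> + \<bar>b\<bar> * \<bar>\<phi> n\<bar>"
      by (metis abs_mult abs_triangle_ineq)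
    also have "\<dots> \<le> \<bar>a\<bar> * (C * (1/5) ^ n) + \<bar>b\<bar> * (D * (1/5) ^ n)"
      by (intro add_mono mult_left_mono C D) auto
    finally show ?thesis by (simp add: algebra_simps)
  qed
  then show ?thesis by (auto simp: decay_def)
qed

lemma decay_diff: "decay \<psi> \<Longrightarrow> decay \<phi> \<Longrightarrow> decay (\<lambda>n. \<psi> n - \<phi> n)"
  using decay_lincomb[of \<psi> \<phi> 1 "-1"] by simp

lemma decay_finite: "decay (\<lambda>n. if n < N then \<phi> n else 0)"
proof -
  have "\<bar>if n < N then \<phi> n else 0\<bar> \<le> (\<Sum>i<N. \<bar>\<phi> i\<bar> * 5 ^ i) * (1/5) ^ n" for n
  proof (cases "n < N")
    case True
    then have "\<bar>\<phi> n\<bar> * 5 ^ n \<le> (\<Sum>i<N. \<bar>\<phi> i\<bar> * 5 ^ i)"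
      by (intro member_le_sum) auto
    then show ?thesis using True by (simp add: field_simps power_divide)
  qed (simp add: sum_nonneg)
  then show ?thesis unfolding decay_def by blast
qed

lemma sym_partial_sum_usym: "sym_partial_sum \<phi> N = usym (\<lambda>n. if n < N then \<phi> n else 0)"
proof
  fix x
  have "usym (\<lambda>n. if n < N then \<phi> n else 0) x = (\<Sum>n<N. (if n < N then \<phi> n else 0) *\<^sub>R mode n x)"
    unfolding usym_def by (rule suminf_finite) auto
  also have "\<dots> = sym_partial_sum \<phi> N x"
    by (simp add: sym_partial_sum_def mode_def scaleR_sum_right mult_ac)
  finally show "sym_partial_sum \<phi> N x = usym (\<lambda>n. if n < N then \<phi> n else 0) x" ..
qed

lemma decay_summable_sq: "decay \<psi> \<Longrightarrow> summable (\<lambda>n. (\<psi> n)\<^sup>2)"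
proof -
  assume "decay \<psi>"
  then obtain C where C: "\<And>n. \<bar>\<psi> n\<bar> \<le> C * (1/5) ^ n" by (auto simp: decay_def)
  show ?thesis
  proof (rule summable_comparison_test')
    show "summable (\<lambda>n. C\<^sup>2 * (1/25) ^ n :: real)" by (intro summable_mult summable_geometric) simp
    fix n
    have "(\<psi> n)\<^sup>2 \<le> (C * (1/5) ^ n)\<^sup>2" using power_mono[OF C[of n], of 2] by simp
    also have "\<dots> = C\<^sup>2 * (1/25) ^ n"
      by (simp add: power_mult_distrib power_mult [symmetric] mult.commute[of n]) (simp add: power_mult power_divide)
    finally show "norm ((\<psi> n)\<^sup>2) \<le> C\<^sup>2 * (1/25) ^ n" by simp
  qed
qed

text \<open>The squared norm of a remainder is 12 times a tail of a convergent series. Conversely,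
  each difference of coefficients is bounded by that norm as soon as the truncation includes its
  index, so the limit determines the sequence.\<close>

lemma sym_coeffs_usym:
  assumes d: "decay \<psi>"
  shows "sym_coeffs (usym \<psi>) = \<psi>"
proof -
  let ?D = "\<lambda>\<phi> N n. \<psi> n - (if n < N then \<phi> n else 0)"
  have dD: "decay (?D \<phi> N)" for \<phi> N by (intro decay_diff d decay_finite)
  have N: "Hdot_norm 0 (\<lambda>x. usym \<psi> x - sym_partial_sum \<phi> N x) = sqrt (12 * (\<Sum>n. (?D \<phi> N n)\<^sup>2))" for \<phi> N
    using Hdot_norm_usym[OF dD[of N \<phi>], of 0] decay_summable_sq[OF dD]
    by (simp add: sym_partial_sum_usym usym_diff[OF d decay_finite])
  show ?thesis
    unfolding sym_coeffs_def N
  proof (rule the_equality)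
    have sm: "summable (\<lambda>n. (\<psi> n)\<^sup>2)" by (rule decay_summable_sq[OF d])
    have "(\<Sum>n. (?D \<psi> N n)\<^sup>2) = (\<Sum>n. (\<psi> n)\<^sup>2) - (\<Sum>n<N. (\<psi> n)\<^sup>2)" for N
    proof -
      have "(\<lambda>n. (\<psi> n)\<^sup>2 - (if n < N then (\<psi> n)\<^sup>2 else 0)) sums ((\<Sum>n. (\<psi> n)\<^sup>2) - (\<Sum>n<N. (\<psi> n)\<^sup>2))"
        by (intro sums_diff summable_sums sm) (use sums_If_finite[of "\<lambda>n. n < N" "\<lambda>n. (\<psi> n)\<^sup>2"] in \<open>simp add: lessThan_def\<close>)
      moreover have "(\<lambda>n. (\<psi> n)\<^sup>2 - (if n < N then (\<psi> n)\<^sup>2 else 0)) = (\<lambda>n. (?D \<psi> N n)\<^sup>2)" by auto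
      ultimately show ?thesis by (simp add: sums_iff)
    qed
    moreover have "(\<lambda>N. sqrt (12 * ((\<Sum>n. (\<psi> n)\<^sup>2) - (\<Sum>n<N. (\<psi> n)\<^sup>2)))) \<longlonglongrightarrow> sqrt (12 * ((\<Sum>n. (\<psi> n)\<^sup>2) - (\<Sum>n. (\<psi> n)\<^sup>2)))"
      by (intro tendsto_intros summable_LIMSEQ sm)
    ultimately show "(\<lambda>N. sqrt (12 * (\<Sum>n. (?D \<psi> N n)\<^sup>2))) \<longlonglongrightarrow> 0" by simp
  next
    fix \<phi> assume lim: "(\<lambda>N. sqrt (12 * (\<Sum>n. (?D \<phi> N n)\<^sup>2))) \<longlonglongrightarrow> 0"
    show "\<phi> = \<psi>"
    proof
      fix n
      have "\<bar>\<psi> n - \<phi> n\<bar> \<le> sqrt (12 * (\<Sum>n. (?D \<phi> N n)\<^sup>2))" if "N > n" for N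
      proof (rule real_le_rsqrt)
        have "(?D \<phi> N n)\<^sup>2 = (\<Sum>i\<in>{n}. (?D \<phi> N i)\<^sup>2)" by simp
        also have "\<dots> \<le> (\<Sum>n. (?D \<phi> N n)\<^sup>2)"
          by (rule sum_le_suminf[OF decay_summable_sq[OF dD]]) auto
        finally show "\<bar>\<psi> n - \<phi> n\<bar>\<^sup>2 \<le> 12 * (\<Sum>n. (?D \<phi> N n)\<^sup>2)"
          using that order_trans[OF zero_le_power2, of "\<psi> n - \<phi> n"] by fastforce
      qed
      then have "\<bar>\<psi> n - \<phi> n\<bar> \<le> 0"
        by (intro tendsto_lowerbound[OF lim]) (auto simp: eventually_sequentially intro!: exI[of _ "Suc n"])
      then show "\<phi> n = \<psi> n" by simp
    qed
  qed
qed

subsection \<open>Representation of symmetric fields\<close>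

text \<open>Composition with \<open>T\<close> moves frequencies by \<open>g\<close>. Only the
  frequencies in \<open>MM\<close> have to remain integral, so that the reflection
  \<open>M_sigma\<close>, which does not preserve the lattice, is covered.\<close>

lemma fc_cser_compose:
  assumes sm: "(\<lambda>k. norm (a k)) summable_on UNIV" and z: "\<And>k. k \<notin> MM \<Longrightarrow> a k = 0"
    and g: "\<And>k. k \<in> MM \<Longrightarrow> g k \<in> MM" "\<And>k. k \<in> MM \<Longrightarrow> g' k \<in> MM"
      "\<And>k. k \<in> MM \<Longrightarrow> g' (g k) = k" "\<And>k. k \<in> MM \<Longrightarrow> g (g' k) = k"
    and T: "\<And>k x. k \<in> MM \<Longrightarrow> rvec k \<bullet> T x = rvec (g k) \<bullet> x"
    and k: "k \<in> MM"
  shows "fc (\<lambda>x. cser a (T x)) k = a (g' k)"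
proof -
  let ?b = "\<lambda>k. if k \<in> MM then a (g' k) else 0"
  have bij: "bij_betw g MM MM"
    by (rule bij_betw_byWitness[where f' = g']) (use g in auto)
  have "(\<lambda>k. norm (?b k)) summable_on UNIV \<longleftrightarrow> (\<lambda>k. norm (a (g' k))) summable_on MM"
    by (rule summable_on_cong_neutral) auto
  also have "\<dots> \<longleftrightarrow> (\<lambda>k. norm (a (g' (g k)))) summable_on MM"
    by (rule summable_on_reindex_bij_betw[OF bij, symmetric])
  also have "\<dots> \<longleftrightarrow> (\<lambda>k. norm (a k)) summable_on MM"
    by (rule summable_on_cong) (simp add: g)
  also have "\<dots> \<longleftrightarrow> (\<lambda>k. norm (a k)) summable_on UNIV"
    by (rule summable_on_cong_neutral) (auto simp: z)
  finally have smb: "(\<lambda>k. norm (?b k)) summable_on UNIV" using sm by simp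
  have "cser a (T x) = cser ?b x" for x
  proof -
    have "cser a (T x) = (\<Sum>\<^sub>\<infinity>k\<in>MM. a (g' (g k)) * fchar (g k) x)"
      unfolding cser_def by (rule infsum_cong_neutral) (auto simp: z g fchar_def T)
    also have "\<dots> = (\<Sum>\<^sub>\<infinity>k\<in>MM. a (g' k) * fchar k x)"
      by (rule infsum_reindex_bij_betw[OF bij])
    also have "\<dots> = cser ?b x"
      unfolding cser_def by (rule infsum_cong_neutral) auto
    finally show ?thesis .
  qed
  then show ?thesis using fc_cser[OF smb, of k] k by simp
qed

text \<open>The coefficients lie along \<open>vdir k\<close> with a scalar \<open>c k\<close>.
  Oddness and reality make \<open>c k\<close> imaginary, the three symmetries make it constant on
  each \<open>Mplus n\<close> by \<open>orbit_const\<close>, and Fourier inversion recovers the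
  field.\<close>

lemma representation:
  assumes s: "s > 5/2" and u: "u \<in> Hdot_M s" and cont: "continuous_on UNIV u"
    and odd: "odd_field u" and perm: "permutation_symmetric u" and mirror: "mirror_symmetric u"
  obtains \<psi> where "summable (\<lambda>n. dsp s n * (\<psi> n)\<^sup>2)" "u = usym \<psi>"
proof -
  define a where "a i k = fcoeff u k $ i" for i k
  have per: "\<And>x i. u (x + axis i 1) = u x"
    and sm: "(\<lambda>k. frac_symbol s k * (norm (fcoeff u k))\<^sup>2) summable_on (UNIV - {0})"
    and supp: "\<And>k. k \<notin> MM \<Longrightarrow> fcoeff u k = 0"
    and line: "\<And>k. k \<in> MM \<Longrightarrow> \<exists>c. fcoeff u k = c *s cvec (vdir k)"
    using u by (auto simp: Hdot_M_def Hdot_def mean_zero_L2_def periodic_def)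
  have z: "\<And>k i. k \<notin> MM \<Longrightarrow> a i k = 0"
    by (simp add: a_def supp)
  define Z where "Z = (\<Sum>\<^sub>\<infinity>k\<in>UNIV - {0}. frac_symbol s k * (norm (fcoeff u k))\<^sup>2)"
  have le: "norm (fcoeff u k) \<le> sqrt Z * (1/5) ^ n" if k: "k \<in> Mpm n" for n k
  proof -
    have "k \<noteq> 0" using k zero_notin_MM by (auto simp: mem_Mpm MM_iff)
    then have "frac_symbol s k * (norm (fcoeff u k))\<^sup>2 \<le> Z"
      using finite_sum_le_infsum[OF sm, of "{k}"] by (simp add: Z_def frac_symbol_def)
    then have "25 ^ n * (norm (fcoeff u k))\<^sup>2 \<le> Z"
      using mult_right_mono[OF dsp_ge[OF s, of n], of "(norm (fcoeff u k))\<^sup>2"] by (simp add: frac_symbol_Mpm[OF k])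
    moreover have "(5 ^ n * norm (fcoeff u k))\<^sup>2 = 25 ^ n * (norm (fcoeff u k))\<^sup>2"
      by (simp add: power_mult_distrib power_mult [symmetric] mult.commute[of n]) (simp add: power_mult)
    ultimately have "5 ^ n * norm (fcoeff u k) \<le> sqrt Z"
      by (intro real_le_rsqrt) simp
    then show ?thesis by (simp add: field_simps power_divide)
  qed
  have d5: "decay (\<lambda>n. (1/5) ^ n)"
    by (auto simp: decay_def intro!: exI[of _ 1])
  have "Z \<ge> 0" unfolding Z_def by (intro infsum_nonneg) (simp add: frac_symbol_def)
  have sma: "(\<lambda>k. norm (a i k)) summable_on UNIV" for i
  proof (rule summable_on_decay[OF d5 _ , where B = "sqrt Z"])
    fix n k assume k: "k \<in> Mpm n"
    have "norm (a i k) \<le> norm (fcoeff u k)"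
      unfolding a_def by (rule Finite_Cartesian_Product.norm_nth_le)
    also have "\<dots> \<le> sqrt Z * (1/5) ^ n" by (rule le[OF k])
    also have "\<dots> \<le> sqrt Z * 4 ^ n * \<bar>(1/5) ^ n\<bar>"
      using \<open>Z \<ge> 0\<close> one_le_power[of "4::real" n] by (simp add: mult_right_mono mult_le_cancel_left1)
    finally show "norm (a i k) \<le> sqrt Z * 4 ^ n * \<bar>(1/5) ^ n\<bar>" .
  qed (simp add: z)
  have cu: "continuous_on UNIV (\<lambda>x. complex_of_real (u x $ i))" for i
    by (intro continuous_intros cont)
  have ua: "complex_of_real (u x $ i) = cser (a i) x" for x i
  proof -
    have fa: "fc (\<lambda>x. complex_of_real (u x $ i)) = a i"
      by (simp add: fun_eq_iff a_def fcoeff_eq_fc)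
    show ?thesis
      using fourier_inversion[OF cu, of i x] sma[of i] by (simp add: fa per)
  qed
  have fa: "fc (cser (a i)) k = a i k" for i k by (rule fc_cser[OF sma])
  have a_odd: "a i (- k) = - a i k" if "k \<in> MM" for i k
  proof -
    have "a i (- k) = fc (\<lambda>x. cser (a i) (- x)) k"
      by (rule fc_cser_compose[where g = uminus, symmetric]) (use sma z that in auto)
    also have "\<dots> = fc (\<lambda>x. - 1 * cser (a i) x) k"
      using odd by (simp add: ua [symmetric] odd_field_def)
    finally show ?thesis by (simp only: fc_cmult fa) simp
  qed
  have a_perm: "a i (permute_vec p k) = a (p i) k" if "bij p" "k \<in> MM" for i p k
  proof -
    have bi: "bij (inv p)" using \<open>bij p\<close> by (rule bij_imp_bij_inv)
    have cancel: "permute_vec p (permute_vec (inv p) v) = v" "permute_vec (inv p) (permute_vec p v) = v" for v :: "'x^3"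
      using \<open>bij p\<close> by (simp_all add: vec_eq_iff bij_is_inj bij_is_surj surj_f_inv_f)
    have "a i (permute_vec p k) = fc (\<lambda>x. cser (a i) (permute_vec p x)) k"
    proof (rule fc_cser_compose[where g = "permute_vec (inv p)", symmetric])
      fix k :: "int^3" and x :: "real^3"
      show "rvec k \<bullet> permute_vec p x = rvec (permute_vec (inv p) k) \<bullet> x"
        using permute_inner[OF \<open>bij p\<close>, of "permute_vec (inv p) (rvec k)" x] by (simp add: cancel rvec_permute)
    qed (use sma z that cancel permute_MM bi in auto)
    also have "(\<lambda>x. cser (a i) (permute_vec p x)) = cser (a (p i))"
      using perm \<open>bij p\<close> by (simp add: fun_eq_iff ua [symmetric] permutation_symmetric_def)
    finally show ?thesis by (simp add: fa)
  qed
  have a_mir: "a i (mir k) = a i k - 2/3 * (a 1 k + a 2 k + a 3 k)" if "k \<in> MM" for i k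
  proof -
    have "a i (mir k) = fc (\<lambda>x. cser (a i) (M_sigma *v x)) k"
      by (rule fc_cser_compose[where g = mir, symmetric])
        (use sma z that mir_MM mir_mir in \<open>auto simp: rvec_mir M_sigma_inner\<close>)
    also have "(\<lambda>x. cser (a i) (M_sigma *v x)) = (\<lambda>x. cser (a i) x - 2/3 * (cser (a 1) x + cser (a 2) x + cser (a 3) x))"
    proof
      fix x
      have "u (M_sigma *v x) = M_sigma *v u x"
        using mirror by (metis M_sigma_invol mirror_symmetric_def)
      then have "u (M_sigma *v x) $ i = u x $ i - 2/3 * (u x $ 1 + u x $ 2 + u x $ 3)"
        by (simp add: M_sigma_mult inner_3)
      then show "cser (a i) (M_sigma *v x) = cser (a i) x - 2/3 * (cser (a 1) x + cser (a 2) x + cser (a 3) x)"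
        by (simp add: ua [symmetric])
    qed
    also have "fc \<dots> k = a i k - 2/3 * (a 1 k + a 2 k + a 3 k)"
    proof -
      have "fc (\<lambda>x. cser (a i) x - 2/3 * (cser (a 1) x + cser (a 2) x + cser (a 3) x)) k
          = fc (cser (a i)) k - fc (\<lambda>x. 2/3 * (cser (a 1) x + cser (a 2) x + cser (a 3) x)) k"
        by (intro fc_diff continuous_intros continuous_cser sma)
      also have "fc (\<lambda>x. 2/3 * (cser (a 1) x + cser (a 2) x + cser (a 3) x)) k
          = 2/3 * (fc (\<lambda>x. cser (a 1) x + cser (a 2) x) k + fc (cser (a 3)) k)"
        unfolding fc_cmult by (subst fc_add) (intro refl continuous_intros continuous_cser sma)+
      also have "fc (\<lambda>x. cser (a 1) x + cser (a 2) x) k = a 1 k + a 2 k"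
        by (subst fc_add) (intro continuous_cser sma, intro continuous_cser sma, simp add: fa)
      finally show ?thesis by (simp only: fa)
    qed
    finally show ?thesis .
  qed
  define c where "c k = (\<Sum>i\<in>UNIV. complex_of_real (vdir k $ i) * a i k)" for k
  have ac: "fcoeff u k = c k *s cvec (vdir k)" if k: "k \<in> MM" for k
  proof -
    obtain b where b: "fcoeff u k = b *s cvec (vdir k)" using line[OF k] by blast
    obtain n where "k \<in> Mpm n" using k by (auto simp: MM_iff mem_Mpm)
    then have "vdir k \<bullet> vdir k = 1" by (simp add: vdir_MM_norm power2_norm_eq_inner [symmetric])
    then have "(\<Sum>i\<in>UNIV. complex_of_real (vdir k $ i) * complex_of_real (vdir k $ i)) = 1"
      by (simp add: inner_vec_def flip: of_real_mult of_real_sum)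
    then have "c k = b"
      by (simp add: c_def a_def b mult.left_commute[of _ b] flip: sum_distrib_left)
    then show ?thesis using b by simp
  qed
  have c_perm: "c (permute_vec p k) = c k" if "bij p" "k \<in> MM" for p k
  proof -
    have "c (permute_vec p k) = (\<Sum>i\<in>UNIV. complex_of_real (vdir k $ p i) * a (p i) k)"
      using that by (simp add: c_def vdir_permute a_perm)
    then show ?thesis
      using sum.reindex_bij_betw[OF \<open>bij p\<close>, of "\<lambda>i. complex_of_real (vdir k $ i) * a i k"] by (simp add: c_def)
  qed
  have c_odd: "c (- k) = - c k" if "k \<in> MM" for k
    using that by (simp add: c_def vdir_uminus a_odd sum_negf)
  \<comment> \<open>The coefficient vector transforms by \<open>M_sigma\<close> and
    \<open>vdir\<close> by its negative; as the reflection preserves inner products, a minus sign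
    remains.\<close>
  have c_mir: "c (mir k) = - c k" if "k \<in> MM" for k
    unfolding c_def sum_3 vdir_mir[OF that] a_mir[OF that] M_sigma_mult inner_3
    by (simp add: algebra_simps)
  have c_cnj: "c (- k) = cnj (c k)" for k
    by (simp add: c_def vdir_uminus a_def fcoeff_uminus)
  define \<psi> where "\<psi> n = Im (c (SOME k. k \<in> Mplus n))" for n
  have c_plus: "c k = \<i> * \<psi> n" if k: "k \<in> Mplus n" for k n
  proof -
    have "(SOME k. k \<in> Mplus n) \<in> Mplus n" using k by (rule someI)
    then have "c (SOME k. k \<in> Mplus n) = c k"
      by (intro orbit_const[of c, OF c_perm c_odd c_mir _ k])
    moreover have "Re (c k) = 0"
      using c_odd[of k] c_cnj[of k] k by (auto simp: MM_iff complex_eq_iff)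
    ultimately show ?thesis by (simp add: \<psi>_def complex_eq_iff)
  qed
  have "c k = cf \<psi> k" if kM: "k \<in> MM" for k
  proof -
    obtain n where "k \<in> Mplus n \<or> - k \<in> Mplus n" using kM by (auto simp: MM_iff)
    then show ?thesis
    proof
      assume "- k \<in> Mplus n"
      then show ?thesis using c_plus[of "- k" n] c_odd[OF kM] cf_minus[of k n \<psi>]
        by (metis add.inverse_inverse mult_minus_left)
    qed (simp add: c_plus cf_plus)
  qed
  then have fu: "fcoeff u k = scoef \<psi> k" for k
    by (cases "k \<in> MM") (simp_all add: ac scoef_def supp cf_zero vec_eq_iff)
  then have sm\<psi>: "summable (\<lambda>n. dsp s n * (\<psi> n)\<^sup>2)"
    using sm by (simp add: Hdot_summable_iff)
  moreover have "u = usym \<psi>"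
  proof
    fix x
    have "complex_of_real (u x $ i) = complex_of_real (usym \<psi> x $ i)" for i
      unfolding ua usym_nth[OF decay_of_summable[OF s sm\<psi>]] by (simp add: a_def [abs_def] fu)
    then show "u x = usym \<psi> x" by (simp add: vec_eq_iff)
  qed
  ultimately show thesis by (rule that)
qed

section \<open>The coefficient equations\<close>

text \<open>The factor is \<open>4 * pi\<close>, from differentiating -2 sin (2 pi k . x), times the
  \<open>3 * 2 ^ n * Pn n\<close> of \<open>sum_vdir_tensor\<close>.\<close>

definition lamf :: "(nat \<Rightarrow> real) \<Rightarrow> real" where
  "lamf \<psi> = (\<Sum>n. 12 * pi * 2 ^ n * Pn n * \<psi> n)"

lemma lamf_term_le: "\<bar>12 * pi * 2 ^ n * Pn n * x\<bar> \<le> 24 * pi * (4 ^ n * \<bar>x\<bar>)"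
proof -
  have "\<bar>12 * pi * 2 ^ n * Pn n * x\<bar> = 12 * pi * \<bar>x\<bar> * (2 ^ n * Pn n)"
    by (simp add: abs_mult less_imp_le)
  also have "\<dots> \<le> 12 * pi * \<bar>x\<bar> * (4 ^ n * 2)"
    using Pn_le_2[of n] by (intro mult_left_mono mult_mono power_mono) (auto simp: less_imp_le)
  finally show ?thesis by (simp add: mult_ac)
qed

lemma summable_lamf: "decay \<psi> \<Longrightarrow> summable (\<lambda>n. 12 * pi * 2 ^ n * Pn n * \<psi> n)"
  by (rule summable_comparison_test'[OF summable_mult[OF summable_decay4]])
    (use lamf_term_le in auto)

lemma term_le_lamf:
  assumes "decay \<psi>" "\<And>n. \<psi> n \<ge> 0"
  shows "12 * pi * 2 ^ n * Pn n * \<psi> n \<le> lamf \<psi>"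
proof -
  have "(\<Sum>i\<in>{n}. 12 * pi * 2 ^ i * Pn i * \<psi> i) \<le> lamf \<psi>"
    unfolding lamf_def by (rule sum_le_suminf[OF summable_lamf]) (use assms in \<open>auto simp: less_imp_le\<close>)
  then show ?thesis by simp
qed

lemma lamf_nonneg: "decay \<psi> \<Longrightarrow> (\<And>n. \<psi> n \<ge> 0) \<Longrightarrow> lamf \<psi> \<ge> 0"
  unfolding lamf_def by (intro suminf_nonneg summable_lamf) (auto simp: less_imp_le)

text \<open>A crude ratio: 6 is the factor that turns the \<open>2 * pi\<close> of \<open>Ac\<close>
  into the \<open>12 * pi\<close> of \<open>lamf\<close>.\<close>

lemma Pn_Suc_le: "Pn (Suc n) \<le> 6 * Pn n"
proof -
  have "Kn n \<le> Kn (Suc n)" by (simp add: Kn_def)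
  have "6 * 3 ^ Suc n / Kn (Suc n) \<le> 6 * 3 ^ Suc n / Kn n"
    by (intro divide_left_mono \<open>Kn n \<le> Kn (Suc n)\<close>) (auto intro: mult_pos_pos)
  also have "\<dots> \<le> 36 * (6 * 3 ^ n / Kn n)"
    using Kn_pos[of n] by (simp add: divide_simps)
  finally have "Pn (Suc n) \<le> sqrt (36 * (6 * 3 ^ n / Kn n))"
    unfolding Pn_def by (rule real_sqrt_le_mono)
  also have "\<dots> = 6 * Pn n" unfolding Pn_def real_sqrt_mult by simp
  finally show ?thesis .
qed

text \<open>The left side equals one third of the single term of index \<open>Suc n\<close> of
  \<open>lamf\<close>; this is the origin of the rate 1/3 in the energy estimate.\<close>

lemma Ac_up_le_lamf: "decay \<psi> \<Longrightarrow> (\<And>n. \<psi> n \<ge> 0) \<Longrightarrow> 4 * Ac n * \<psi> (Suc n) \<le> lamf \<psi> / 3"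
  using term_le_lamf[of \<psi> "Suc n"] by (simp add: Ac_def mult_ac)

lemma Ac_self_le_lamf:
  assumes "decay \<psi>" "\<And>n. \<psi> n \<ge> 0"
  shows "Ac n * \<psi> n \<le> lamf \<psi>"
proof -
  have "Ac n * \<psi> n \<le> (2 * pi * 2 ^ n * (6 * Pn n)) * \<psi> n"
    unfolding Ac_def by (intro mult_right_mono mult_left_mono Pn_Suc_le assms) auto
  also have "\<dots> = 12 * pi * 2 ^ n * Pn n * \<psi> n" by simp
  also have "\<dots> \<le> lamf \<psi>" by (rule term_le_lamf[OF assms])
  finally show ?thesis .
qed

section \<open>Positivity and energy estimate for the shell model\<close>

lemma nondecreasing_from_deriv:
  assumes "0 \<le> t" "\<And>\<tau>. \<tau> \<in> {0..t} \<Longrightarrow> (f has_real_derivative f' \<tau>) (at \<tau> within {0..t})"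
    and "\<And>\<tau>. \<tau> \<in> {0..t} \<Longrightarrow> f' \<tau> \<ge> 0"
  shows "f 0 \<le> (f t :: real)"
proof (rule DERIV_nonneg_imp_increasing_open[OF assms(1)])
  show "\<exists>y. (f has_real_derivative y) (at x) \<and> y \<ge> 0" if "0 < x" "x < t" for x
    using assms(2)[of x] assms(3)[of x] that by (auto simp: at_within_Icc_at)
  show "continuous_on {0..t} f"
    using assms(2) by (rule DERIV_continuous_on)
qed

lemma time_dom_Icc: "t \<in> time_dom T \<Longrightarrow> {0..t} \<subseteq> time_dom T"
proof
  fix x assume "t \<in> time_dom T" "x \<in> {0..t}"
  then show "x \<in> time_dom T"
    using le_less_trans[of "ereal x" "ereal t" T] by (simp add: time_dom_def)
qed

lemma time_dom_nonneg: "t \<in> time_dom T \<Longrightarrow> 0 \<le> t"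
  by (simp add: time_dom_def)

text \<open>\<open>bounded\<close> asks for the decay uniformly on compact time intervals, which
  makes the gradient continuous in time. Derivatives are taken within the time domain and are
  therefore one-sided at 0.\<close>

locale shell_model =
  fixes d :: "nat \<Rightarrow> real" and T :: ereal and \<psi> :: "real \<Rightarrow> nat \<Rightarrow> real"
  assumes d_nonneg: "\<And>n. d n \<ge> 0"
    and bounded: "\<And>t. t \<in> time_dom T \<Longrightarrow> \<exists>C. \<forall>\<tau>\<in>{0..t}. \<forall>n. \<bar>\<psi> \<tau> n\<bar> \<le> C * (1/5) ^ n"
    and ode: "\<And>t n. t \<in> time_dom T \<Longrightarrow>
      ((\<lambda>\<tau>. \<psi> \<tau> n) has_real_derivative (Gs (\<psi> t) n - d n * \<psi> t n)) (at t within time_dom T)"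
    and init: "\<And>n. \<psi> 0 n \<ge> 0"
begin

lemma ode_Icc:
  assumes "t \<in> time_dom T" "\<tau> \<in> {0..t}"
  shows "((\<lambda>\<tau>. \<psi> \<tau> n) has_real_derivative (Gs (\<psi> \<tau>) n - d n * \<psi> \<tau> n)) (at \<tau> within {0..t})"
  using ode[of \<tau> n] time_dom_Icc[OF assms(1)] assms(2)
  by (blast intro: has_field_derivative_subset)

lemma cont: "t \<in> time_dom T \<Longrightarrow> continuous_on {0..t} (\<lambda>\<tau>. \<psi> \<tau> n)"
  using ode_Icc by (rule DERIV_continuous_on)

lemma decay_\<psi>: "t \<in> time_dom T \<Longrightarrow> decay (\<psi> t)"
  using bounded[of t] time_dom_nonneg[of t T] unfolding decay_def by (meson atLeastAtMost_iff order_refl)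

text \<open>The next shell enters only through the integrating factor, where its sign does not
  matter; hence every shell can be treated by itself, without induction over
  \<open>n\<close>.\<close>

lemma nonneg:
  assumes t: "t \<in> time_dom T"
  shows "\<psi> t n \<ge> 0"
proof -
  define b where "b \<tau> = d n + Ac n * \<psi> \<tau> (Suc n)" for \<tau>
  define B where "B \<tau> = integral {0..\<tau>} b" for \<tau>
  have bc: "continuous_on {0..t} b"
    unfolding b_def by (intro continuous_intros cont t)
  have B: "(B has_real_derivative b \<tau>) (at \<tau> within {0..t})" if "\<tau> \<in> {0..t}" for \<tau>
    unfolding B_def by (rule integral_has_real_derivative[OF bc that])
  let ?src = "\<lambda>\<tau>. if n = 0 then 0 else Ac (n - 1) * (\<psi> \<tau> (n - 1))\<^sup>2"
  have "exp (B 0) * \<psi> 0 n \<le> exp (B t) * \<psi> t n"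
  proof (rule nondecreasing_from_deriv[where f = "\<lambda>\<tau>. exp (B \<tau>) * \<psi> \<tau> n" and f' = "\<lambda>\<tau>. exp (B \<tau>) * ?src \<tau>"])
    fix \<tau> assume \<tau>: "\<tau> \<in> {0..t}"
    have "((\<lambda>\<tau>. exp (B \<tau>) * \<psi> \<tau> n) has_real_derivative
        exp (B \<tau>) * b \<tau> * \<psi> \<tau> n + (Gs (\<psi> \<tau>) n - d n * \<psi> \<tau> n) * exp (B \<tau>)) (at \<tau> within {0..t})"
      by (intro DERIV_mult DERIV_chain2[OF DERIV_exp] B \<tau> ode_Icc t)
    moreover have "exp (B \<tau>) * b \<tau> * \<psi> \<tau> n + (Gs (\<psi> \<tau>) n - d n * \<psi> \<tau> n) * exp (B \<tau>) = exp (B \<tau>) * ?src \<tau>"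
      by (simp add: Gs_def b_def algebra_simps)
    ultimately show "((\<lambda>\<tau>. exp (B \<tau>) * \<psi> \<tau> n) has_real_derivative exp (B \<tau>) * ?src \<tau>) (at \<tau> within {0..t})"
      by simp
    show "exp (B \<tau>) * ?src \<tau> \<ge> 0" by (simp add: less_imp_le)
  qed (use t time_dom_nonneg in auto)
  moreover have "exp (B 0) * \<psi> 0 n \<ge> 0" using init by simp
  ultimately have "exp (B t) * \<psi> t n \<ge> 0" by linarith
  then show ?thesis by (simp add: zero_le_mult_iff)
qed

lemma lam_nonneg: "t \<in> time_dom T \<Longrightarrow> lamf (\<psi> t) \<ge> 0"
  by (intro lamf_nonneg decay_\<psi> nonneg)

lemma lam_cont:
  assumes t: "t \<in> time_dom T"
  shows "continuous_on {0..t} (\<lambda>\<tau>. lamf (\<psi> \<tau>))"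
proof -
  obtain C where C: "\<And>\<tau> n. \<tau> \<in> {0..t} \<Longrightarrow> \<bar>\<psi> \<tau> n\<bar> \<le> C * (1/5) ^ n"
    using bounded[OF t] by blast
  have "uniform_limit {0..t} (\<lambda>N \<tau>. \<Sum>n<N. 12 * pi * 2 ^ n * Pn n * \<psi> \<tau> n) (\<lambda>\<tau>. lamf (\<psi> \<tau>)) sequentially"
    unfolding lamf_def
  proof (rule Weierstrass_m_test)
    show "summable (\<lambda>n. 24 * pi * C * (4/5) ^ n :: real)"
      by (intro summable_mult summable_geometric) simp
    fix n \<tau> assume "\<tau> \<in> {0..t}"
    then have "4 ^ n * \<bar>\<psi> \<tau> n\<bar> \<le> 4 ^ n * (C * (1/5) ^ n)"
      by (intro mult_left_mono C) auto
    then have "24 * pi * (4 ^ n * \<bar>\<psi> \<tau> n\<bar>) \<le> 24 * pi * (4 ^ n * (C * (1/5) ^ n))"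
      by (intro mult_left_mono) auto
    then have "24 * pi * (4 ^ n * \<bar>\<psi> \<tau> n\<bar>) \<le> 24 * pi * C * (4/5) ^ n"
      by (simp add: power_divide mult_ac)
    then show "norm (12 * pi * 2 ^ n * Pn n * \<psi> \<tau> n) \<le> 24 * pi * C * (4/5) ^ n"
      using lamf_term_le[of n "\<psi> \<tau> n"] unfolding real_norm_def by linarith
  qed
  then show ?thesis
    by (rule uniform_limit_theorem[rotated]) (auto intro!: always_eventually continuous_intros cont t)
qed

definition Lam :: "real \<Rightarrow> real" where
  "Lam t = integral {0..t} (\<lambda>\<tau>. lamf (\<psi> \<tau>))"

lemma Lam_deriv: "t \<in> time_dom T \<Longrightarrow> \<tau> \<in> {0..t} \<Longrightarrow> (Lam has_real_derivative lamf (\<psi> \<tau>)) (at \<tau> within {0..t})"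
  unfolding Lam_def by (rule integral_has_real_derivative[OF lam_cont])

lemma Lam_0 [simp]: "Lam 0 = 0"
  by (simp add: Lam_def)

lemma Lam_nonneg: "t \<in> time_dom T \<Longrightarrow> Lam t \<ge> 0"
  unfolding Lam_def
  by (intro integral_nonneg integrable_continuous_interval lam_cont) (use time_dom_Icc lam_nonneg in blast)+

text \<open>Summation by parts; the telescoped boundary term has a sign.\<close>

lemma energy_sum:
  "(\<Sum>n<N. 3 ^ n * (2 * x n * Gs x n)) =
    (\<Sum>n<N. 3 ^ n * (4 * Ac n * x (Suc n)) * (x n)\<^sup>2)
      - (if N = 0 then 0 else 2 * 3 ^ N * Ac (N - 1) * (x (N - 1))\<^sup>2 * x N)"
proof (induction N)
  case (Suc N)
  then show ?case by (cases N) (simp_all add: Gs_def power2_eq_square algebra_simps)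
qed simp

text \<open>Gronwall on finite truncations, which can be differentiated term by term; the rate does
  not depend on \<open>N\<close>, so the limit can be taken afterwards.\<close>

lemma energy_partial:
  assumes t: "t \<in> time_dom T"
  shows "(\<Sum>n<N. 3 ^ n * (\<psi> t n)\<^sup>2) \<le> (\<Sum>n<N. 3 ^ n * (\<psi> 0 n)\<^sup>2) * exp (Lam t / 3)"
proof -
  define E where "E \<tau> = (\<Sum>n<N. 3 ^ n * (\<psi> \<tau> n)\<^sup>2)" for \<tau>
  define E' where "E' \<tau> = (\<Sum>n<N. 3 ^ n * (2 * \<psi> \<tau> n * (Gs (\<psi> \<tau>) n - d n * \<psi> \<tau> n)))" for \<tau>
  have E: "(E has_real_derivative E' \<tau>) (at \<tau> within {0..t})" if "\<tau> \<in> {0..t}" for \<tau>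
    unfolding E_def E'_def
    by (auto intro!: derivative_eq_intros ode_Icc[OF t that] sum.cong simp: mult_ac)
  have le: "E' \<tau> \<le> lamf (\<psi> \<tau>) / 3 * E \<tau>" if \<tau>: "\<tau> \<in> {0..t}" for \<tau>
  proof -
    have dom: "\<tau> \<in> time_dom T" using time_dom_Icc[OF t] \<tau> by blast
    note nn = nonneg[OF dom]
    have "E' \<tau> \<le> (\<Sum>n<N. 3 ^ n * (2 * \<psi> \<tau> n * Gs (\<psi> \<tau>) n))"
      unfolding E'_def using nn d_nonneg
      by (intro sum_mono mult_left_mono) (auto simp: mult_le_cancel_left1)
    also have "\<dots> \<le> (\<Sum>n<N. 3 ^ n * (4 * Ac n * \<psi> \<tau> (Suc n)) * (\<psi> \<tau> n)\<^sup>2)"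
      unfolding energy_sum using nn by (auto simp: less_imp_le)
    also have "\<dots> \<le> (\<Sum>n<N. lamf (\<psi> \<tau>) / 3 * (3 ^ n * (\<psi> \<tau> n)\<^sup>2))"
    proof (intro sum_mono)
      fix n
      have "(4 * Ac n * \<psi> \<tau> (Suc n)) * (3 ^ n * (\<psi> \<tau> n)\<^sup>2) \<le> lamf (\<psi> \<tau>) / 3 * (3 ^ n * (\<psi> \<tau> n)\<^sup>2)"
        by (intro mult_right_mono Ac_up_le_lamf decay_\<psi> dom nn) auto
      then show "3 ^ n * (4 * Ac n * \<psi> \<tau> (Suc n)) * (\<psi> \<tau> n)\<^sup>2 \<le> lamf (\<psi> \<tau>) / 3 * (3 ^ n * (\<psi> \<tau> n)\<^sup>2)"
        by (simp add: mult_ac)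
    qed
    finally show ?thesis by (simp add: E_def sum_distrib_left)
  qed
  have "- (exp (- Lam 0 / 3) * E 0) \<le> - (exp (- Lam t / 3) * E t)"
  proof (rule nondecreasing_from_deriv[where f = "\<lambda>\<tau>. - (exp (- Lam \<tau> / 3) * E \<tau>)"
        and f' = "\<lambda>\<tau>. exp (- Lam \<tau> / 3) * (lamf (\<psi> \<tau>) / 3 * E \<tau> - E' \<tau>)"])
    fix \<tau> assume \<tau>: "\<tau> \<in> {0..t}"
    show "((\<lambda>\<tau>. - (exp (- Lam \<tau> / 3) * E \<tau>)) has_real_derivative
        exp (- Lam \<tau> / 3) * (lamf (\<psi> \<tau>) / 3 * E \<tau> - E' \<tau>)) (at \<tau> within {0..t})"
      by (auto intro!: derivative_eq_intros Lam_deriv[OF t \<tau>] E[OF \<tau>] simp: algebra_simps)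
    show "exp (- Lam \<tau> / 3) * (lamf (\<psi> \<tau>) / 3 * E \<tau> - E' \<tau>) \<ge> 0"
      using le[OF \<tau>] by simp
  qed (use t time_dom_nonneg in auto)
  then have "exp (- Lam t / 3) * E t \<le> E 0" by simp
  then have "exp (Lam t / 3) * (exp (- Lam t / 3) * E t) \<le> exp (Lam t / 3) * E 0"
    by (intro mult_left_mono) auto
  then have "E t \<le> exp (Lam t / 3) * E 0"
    by (simp add: mult.assoc[symmetric] exp_add[symmetric])
  then show ?thesis by (simp add: E_def mult.commute)
qed

end

text \<open>In closed form the sum of \<open>q ^ (n - j) * a j\<close> over j up to n, a discrete
  convolution with a geometric kernel.\<close>

fun env :: "real \<Rightarrow> (nat \<Rightarrow> real) \<Rightarrow> nat \<Rightarrow> real" where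
  "env q a 0 = a 0"
| "env q a (Suc n) = a (Suc n) + q * env q a n"

text \<open>Since \<open>A\<^sub>n \<psi>\<^sub>n\<close> is bounded by the gradient, each shell is driven linearly by the previous
  one, so a bound on the time integral of the gradient propagates every geometrically stable decay
  of the initial data.\<close>

lemma (in shell_model) env_bound:
  assumes q: "q > 0" and t: "t \<in> time_dom T"
  shows "\<psi> t n \<le> exp (Lam t / q) * env q (\<psi> 0) n"
  using t
proof (induction n arbitrary: t)
  case 0
  have dec: "\<psi> t 0 \<le> \<psi> 0 0"
  proof -
    have "- \<psi> 0 0 \<le> - \<psi> t 0"
    proof (rule nondecreasing_from_deriv[where f = "\<lambda>\<tau>. - \<psi> \<tau> 0" and f' = "\<lambda>\<tau>. - (Gs (\<psi> \<tau>) 0 - d 0 * \<psi> \<tau> 0)"])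
      fix \<tau> assume \<tau>: "\<tau> \<in> {0..t}"
      then have "\<tau> \<in> time_dom T" using time_dom_Icc[OF 0] by blast
      then show "- (Gs (\<psi> \<tau>) 0 - d 0 * \<psi> \<tau> 0) \<ge> 0"
        using nonneg d_nonneg by (simp add: Gs_def less_imp_le)
      show "((\<lambda>\<tau>. - \<psi> \<tau> 0) has_real_derivative - (Gs (\<psi> \<tau>) 0 - d 0 * \<psi> \<tau> 0)) (at \<tau> within {0..t})"
        by (intro DERIV_minus ode_Icc 0 \<tau>)
    qed (use 0 time_dom_nonneg in auto)
    then show ?thesis by simp
  qed
  have "Lam t \<ge> 0" by (rule Lam_nonneg[OF 0])
  then have "1 * \<psi> 0 0 \<le> exp (Lam t / q) * \<psi> 0 0"
    using q init by (intro mult_right_mono) auto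
  then show ?case using dec by simp
next
  case (Suc n)
  have env_nonneg: "env q (\<psi> 0) n \<ge> 0" for n
    using q init by (induction n) auto
  have Lam0: "Lam t \<ge> 0" by (rule Lam_nonneg[OF Suc.prems])
  \<comment> \<open>The factor \<open>q\<close> cancels the 1/q from differentiating the
    exponential, so the first term grows at the rate \<open>lamf (\<psi> \<tau>)\<close> times the
    induction bound for shell \<open>n\<close>, which dominates the source of shell
    \<open>Suc n\<close>.\<close>
  define F where "F \<tau> = q * exp (Lam \<tau> / q) * env q (\<psi> 0) n - \<psi> \<tau> (Suc n)" for \<tau>
  have "F 0 \<le> F t"
  proof (rule nondecreasing_from_deriv[where f' = "\<lambda>\<tau>. lamf (\<psi> \<tau>) * (exp (Lam \<tau> / q) * env q (\<psi> 0) n)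
      - (Gs (\<psi> \<tau>) (Suc n) - d (Suc n) * \<psi> \<tau> (Suc n))"])
    fix \<tau> assume \<tau>: "\<tau> \<in> {0..t}"
    then have dom: "\<tau> \<in> time_dom T" using time_dom_Icc[OF Suc.prems] by blast
    show "(F has_real_derivative lamf (\<psi> \<tau>) * (exp (Lam \<tau> / q) * env q (\<psi> 0) n)
      - (Gs (\<psi> \<tau>) (Suc n) - d (Suc n) * \<psi> \<tau> (Suc n))) (at \<tau> within {0..t})"
      unfolding F_def using q
      by (auto intro!: derivative_eq_intros Lam_deriv[OF Suc.prems \<tau>] ode_Icc[OF Suc.prems \<tau>])
    have "Gs (\<psi> \<tau>) (Suc n) - d (Suc n) * \<psi> \<tau> (Suc n) \<le> (Ac n * \<psi> \<tau> n) * \<psi> \<tau> n"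
    proof -
      have "0 \<le> Ac (Suc n) * \<psi> \<tau> (Suc n) * \<psi> \<tau> (Suc (Suc n))" "0 \<le> d (Suc n) * \<psi> \<tau> (Suc n)"
        using nonneg[OF dom] d_nonneg by (simp_all add: less_imp_le)
      then show ?thesis by (simp add: Gs_def power2_eq_square)
    qed
    also have "\<dots> \<le> lamf (\<psi> \<tau>) * (exp (Lam \<tau> / q) * env q (\<psi> 0) n)"
      using nonneg[OF dom] lam_nonneg[OF dom]
      by (intro mult_mono Ac_self_le_lamf decay_\<psi> dom Suc.IH) auto
    finally show "lamf (\<psi> \<tau>) * (exp (Lam \<tau> / q) * env q (\<psi> 0) n)
      - (Gs (\<psi> \<tau>) (Suc n) - d (Suc n) * \<psi> \<tau> (Suc n)) \<ge> 0" by simp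
  qed (use Suc.prems time_dom_nonneg in auto)
  then have "\<psi> t (Suc n) \<le> \<psi> 0 (Suc n) + q * exp (Lam t / q) * env q (\<psi> 0) n - q * env q (\<psi> 0) n"
    by (simp add: F_def)
  also have "\<dots> \<le> \<psi> 0 (Suc n) + q * exp (Lam t / q) * env q (\<psi> 0) n"
    using q env_nonneg by simp
  also have "\<dots> \<le> exp (Lam t / q) * \<psi> 0 (Suc n) + q * exp (Lam t / q) * env q (\<psi> 0) n"
    using mult_right_mono[of 1 "exp (Lam t / q)" "\<psi> 0 (Suc n)"] init q Lam0 by simp
  finally show ?case by (simp add: algebra_simps)
qed

section \<open>Stability of the weighted space under envelopes\<close>

lemma env_nonneg: "q \<ge> 0 \<Longrightarrow> (\<And>n. a n \<ge> 0) \<Longrightarrow> env q a n \<ge> 0"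
  by (induction n) auto

lemma env_mono: "q \<ge> 0 \<Longrightarrow> (\<And>n. a n \<le> b n) \<Longrightarrow> env q a n \<le> env q b n"
  by (induction n) (auto intro!: add_mono mult_left_mono)

lemma env_cmult: "env q (\<lambda>n. c * a n) n = c * env q a n"
  by (induction n) (auto simp: algebra_simps)

text \<open>The weights grow by at most \<open>4 powr s\<close> per level, and this \<open>q\<close>
  makes \<open>4 powr s\<close> times its square equal to 1/4; with the factor 2 from squaring a
  sum, the recursion contracts by 1/2.\<close>

lemma summable_env:
  assumes s: "s \<ge> 0" and q: "q = 2 powr (- s) / 2"
    and a: "\<And>n. a n \<ge> 0" "summable (\<lambda>n. dsp s n * (a n)\<^sup>2)"
  shows "summable (\<lambda>n. dsp s n * (env q a n)\<^sup>2)"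
proof -
  let ?x = "\<lambda>n. dsp s n * (env q a n)\<^sup>2"
  let ?b = "\<lambda>n. dsp s n * (a n)\<^sup>2"
  have q0: "q > 0" by (simp add: q)
  have q2: "4 powr s * q\<^sup>2 = 1/4"
  proof -
    have "4 powr s = 2 powr s * 2 powr s"
      using powr_mult[of 2 2 s] by simp
    then show ?thesis by (simp add: q power2_eq_square powr_minus field_simps)
  qed
  have step: "?x (Suc n) \<le> 2 * ?b (Suc n) + ?x n / 2" for n
  proof -
    have "(a (Suc n) + q * env q a n)\<^sup>2 \<le> 2 * (a (Suc n))\<^sup>2 + 2 * (q * env q a n)\<^sup>2"
      using sum_squares_bound[of "a (Suc n)" "q * env q a n"] by (simp add: power2_sum)
    then have "?x (Suc n) \<le> dsp s (Suc n) * (2 * (a (Suc n))\<^sup>2 + 2 * (q * env q a n)\<^sup>2)"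
      by (simp add: less_imp_le mult_left_mono)
    also have "\<dots> = 2 * ?b (Suc n) + dsp s (Suc n) * (2 * (q * env q a n)\<^sup>2)"
      by (simp add: algebra_simps)
    also have "dsp s (Suc n) * (2 * (q * env q a n)\<^sup>2) \<le> (4 powr s * dsp s n) * (2 * (q * env q a n)\<^sup>2)"
      by (intro mult_right_mono dsp_Suc_le s) simp
    also have "\<dots> = 2 * (4 powr s * q\<^sup>2) * ?x n"
      by (simp add: power_mult_distrib mult_ac)
    finally show ?thesis unfolding q2 by simp
  qed
  have "(\<Sum>n<N. ?x n) \<le> 4 * (\<Sum>n<N. ?b n)" for N
  proof -
    \<comment> \<open>Counting the last term twice closes the induction, since \<open>step\<close>
      trades two copies of a term for four of the corresponding \<open>?b\<close> and one copy of
      the preceding term.\<close>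
    have "(\<Sum>n<N. ?x n) + (if N = 0 then 0 else ?x (N - 1)) \<le> 4 * (\<Sum>n<N. ?b n)"
    proof (induction N)
      case (Suc N)
      show ?case
      proof (cases N)
        case 0
        have "?b 0 \<ge> 0" by (simp add: less_imp_le)
        then show ?thesis by (simp add: 0)
      next
        case (Suc m)
        have "2 * ?x (Suc m) \<le> 4 * ?b (Suc m) + ?x m" using step[of m] by simp
        then show ?thesis using Suc.IH by (simp add: Suc del: env.simps)
      qed
    qed simp
    moreover have "(if N = 0 then 0 else ?x (N - 1)) \<ge> 0" by (simp add: less_imp_le)
    ultimately show ?thesis by linarith
  qed
  also have "4 * (\<Sum>n<N. ?b n) \<le> 4 * (\<Sum>n. ?b n)" for N
    by (intro mult_left_mono sum_le_suminf a) (auto simp: less_imp_le)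
  finally show ?thesis
    by (intro summableI_nonneg_bounded[where x = "4 * (\<Sum>n. ?b n)"]) (auto simp: less_imp_le)
qed

subsection \<open>Local existence\<close>

text \<open>Lipschitz bound in the supremum norm with weight \<open>M\<close>. The hypothesis
  \<open>\<kappa>\<close> controls the absolute majorant of the nonlinearity at \<open>M\<close>
  itself; bilinearity on the ball of radius 2 contributes the factor 2 + 2.\<close>

lemma Gs_lipschitz:
  assumes M: "\<And>n. M n > 0"
    and \<kappa>: "\<And>n. (if n = 0 then 0 else Ac (n - 1) * (M (n - 1))\<^sup>2) + Ac n * M n * M (Suc n) \<le> \<kappa> * M n"
    and x: "\<And>n. \<bar>x n\<bar> \<le> 2 * M n" and y: "\<And>n. \<bar>y n\<bar> \<le> 2 * M n" and xy: "\<And>n. \<bar>x n - y n\<bar> \<le> \<eta> * M n"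
  shows "\<bar>Gs x n - Gs y n\<bar> \<le> 4 * \<kappa> * \<eta> * M n"
proof -
  have eta: "\<eta> \<ge> 0"
  proof -
    have "0 \<le> \<eta> * M 0" using xy[of 0] by linarith
    then show ?thesis using M[of 0] by (simp add: zero_le_mult_iff)
  qed
  have prod: "\<bar>x i * x j - y i * y j\<bar> \<le> 4 * \<eta> * (M i * M j)" for i j
  proof -
    have "x i * x j - y i * y j = x i * (x j - y j) + (x i - y i) * y j"
      by (simp add: algebra_simps)
    then have "\<bar>x i * x j - y i * y j\<bar> \<le> \<bar>x i\<bar> * \<bar>x j - y j\<bar> + \<bar>x i - y i\<bar> * \<bar>y j\<bar>"
      by (metis abs_mult abs_triangle_ineq)
    also have "\<dots> \<le> (2 * M i) * (\<eta> * M j) + (\<eta> * M i) * (2 * M j)"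
      using M eta by (intro add_mono mult_mono x y xy) (auto simp: less_imp_le)
    finally show ?thesis by (simp add: algebra_simps)
  qed
  have "\<bar>Gs x n - Gs y n\<bar> \<le> \<bar>if n = 0 then 0 else Ac (n - 1) * (x (n - 1) * x (n - 1) - y (n - 1) * y (n - 1))\<bar>
      + \<bar>Ac n * (x n * x (Suc n) - y n * y (Suc n))\<bar>"
  proof -
    have "Gs x n - Gs y n = (if n = 0 then 0 else Ac (n - 1) * (x (n - 1) * x (n - 1) - y (n - 1) * y (n - 1)))
      - Ac n * (x n * x (Suc n) - y n * y (Suc n))"
      by (simp add: Gs_def power2_eq_square algebra_simps)
    then show ?thesis by (metis abs_triangle_ineq4)
  qed
  also have "\<dots> \<le> (if n = 0 then 0 else Ac (n - 1) * (4 * \<eta> * (M (n - 1) * M (n - 1)))) + Ac n * (4 * \<eta> * (M n * M (Suc n)))"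
  proof (rule add_mono)
    have f: "\<bar>Ac m * (x i * x j - y i * y j)\<bar> \<le> Ac m * (4 * \<eta> * (M i * M j))" for m i j
      unfolding abs_mult[of "Ac m"] abs_of_pos[OF Ac_pos] by (intro mult_left_mono prod less_imp_le[OF Ac_pos])
    show "\<bar>if n = 0 then 0 else Ac (n - 1) * (x (n - 1) * x (n - 1) - y (n - 1) * y (n - 1))\<bar>
        \<le> (if n = 0 then 0 else Ac (n - 1) * (4 * \<eta> * (M (n - 1) * M (n - 1))))"
      using f[of "n - 1" "n - 1" "n - 1"] by (cases "n = 0") simp_all
    show "\<bar>Ac n * (x n * x (Suc n) - y n * y (Suc n))\<bar> \<le> Ac n * (4 * \<eta> * (M n * M (Suc n)))"
      by (rule f)
  qed
  also have "\<dots> = 4 * \<eta> * ((if n = 0 then 0 else Ac (n - 1) * (M (n - 1))\<^sup>2) + Ac n * M n * M (Suc n))"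
    by (simp add: power2_eq_square algebra_simps)
  also have "\<dots> \<le> 4 * \<eta> * (\<kappa> * M n)"
    using eta by (intro mult_left_mono \<kappa>) auto
  finally show ?thesis by (simp add: mult_ac)
qed

lemma Gs_zero [simp]: "Gs (\<lambda>n. 0) n = 0"
  by (simp add: Gs_def)

text \<open>The kernel exp (- d (t - r)) is at most 1, so the bound does not involve
  \<open>d\<close>; existence times thus do not depend on the dissipation rates.\<close>

lemma duhamel_bound:
  fixes g :: "real \<Rightarrow> real"
  assumes "0 \<le> d" "0 \<le> t" "continuous_on {0..t} g" "\<And>r. r \<in> {0..t} \<Longrightarrow> \<bar>g r\<bar> \<le> B"
  shows "\<bar>exp (- d * t) * integral {0..t} (\<lambda>r. exp (d * r) * g r)\<bar> \<le> t * B"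
proof -
  have "norm (integral {0..t} (\<lambda>r. exp (d * r) * g r)) \<le> (exp (d * t) * B) * (t - 0)"
  proof (rule integral_bound)
    show "continuous_on {0..t} (\<lambda>r. exp (d * r) * g r)" by (intro continuous_intros assms)
    fix r assume r: "r \<in> {0..t}"
    have "exp (d * r) * \<bar>g r\<bar> \<le> exp (d * t) * B"
      using r assms(1) assms(4)[OF r] by (intro mult_mono) (auto intro: mult_left_mono)
    then show "norm (exp (d * r) * g r) \<le> exp (d * t) * B" by (simp add: abs_mult)
  qed (use assms in auto)
  then have "exp (- d * t) * \<bar>integral {0..t} (\<lambda>r. exp (d * r) * g r)\<bar> \<le> exp (- d * t) * (exp (d * t) * B * t)"
    by (intro mult_left_mono) auto
  also have "\<dots> = (exp (- d * t) * exp (d * t)) * (t * B)" by (simp only: mult_ac)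
  also have "exp (- d * t) * exp (d * t) = 1" by (simp add: exp_add [symmetric])
  finally show ?thesis by (simp add: abs_mult)
qed

lemma complete_UNIV_bcontfun:
  "complete (UNIV :: ('a::topological_space, 'b::complete_space) bcontfun set)"
proof (rule completeI)
  fix f :: "nat \<Rightarrow> ('a, 'b) bcontfun" assume "Cauchy f"
  then have "uniformly_Cauchy_on UNIV (\<lambda>n. apply_bcontfun (f n))"
    unfolding Cauchy_def uniformly_Cauchy_on_def by (meson dist_bounded le_less_trans)
  then obtain g where "uniform_limit UNIV (\<lambda>n. apply_bcontfun (f n)) g sequentially"
    using Cauchy_uniformly_convergent unfolding uniformly_convergent_on_def by blast
  then show "\<exists>l\<in>UNIV. f \<longlonglongrightarrow> l"
    by (metis UNIV_I uniform_limit_bcontfunE sequentially_bot)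
qed

text \<open>Contraction for the Duhamel formula among sequences of bounded continuous functions of
  time, the n-th one normalised by \<open>M n\<close>. The ball of radius 2 is preserved because the
  image of 0 has norm at most 1 and differences shrink by 1/4.\<close>

lemma local_existence:
  assumes d: "\<And>n. d n \<ge> 0" and M: "\<And>n. M n > 0" and k0: "\<kappa> > 0"
    and \<kappa>: "\<And>n. (if n = 0 then 0 else Ac (n - 1) * (M (n - 1))\<^sup>2) + Ac n * M n * M (Suc n) \<le> \<kappa> * M n"
    and p: "\<And>n. \<bar>p n\<bar> \<le> M n"
  obtains \<delta> :: real and \<xi> where "\<delta> > 0" "\<xi> 0 = p" "\<And>\<tau> n. \<bar>\<xi> \<tau> n\<bar> \<le> 2 * M n"
    "\<And>\<tau> n. \<tau> \<in> {0..\<delta>} \<Longrightarrow>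
      ((\<lambda>\<tau>. \<xi> \<tau> n) has_real_derivative (Gs (\<xi> \<tau>) n - d n * \<xi> \<tau> n)) (at \<tau> within {0..\<delta>})"
proof -
  \<comment> \<open>Chosen so that \<open>\<delta>\<close> times the Lipschitz constant
    \<open>4 * \<kappa>\<close> is 1/4.\<close>
  define \<delta> where "\<delta> = 1 / (16 * \<kappa>)"
  have \<delta>: "\<delta> > 0" "16 * \<kappa> * \<delta> = 1" using k0 by (simp_all add: \<delta>_def)
  \<comment> \<open>Clamping time to \<open>{0..\<delta>}\<close> lets the unknowns live on the
    whole line, with bounds valid at all times.\<close>
  define c where "c \<tau> = min \<delta> (max 0 \<tau>)" for \<tau> :: real
  have c: "0 \<le> c \<tau>" "c \<tau> \<le> \<delta>" for \<tau> using \<delta> by (auto simp: c_def)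
  have c_cont: "continuous_on UNIV c" unfolding c_def by (intro continuous_intros)
  \<comment> \<open>Undoes the normalisation by \<open>M\<close>. Every function of the outer
    discrete index is continuous, so the outer layer only asks for a bound uniform in that
    index.\<close>
  define V where "V \<phi> r m = M m * apply_bcontfun (apply_bcontfun \<phi> m) r" for \<phi> :: "(nat, (real, real) bcontfun) bcontfun" and r m
  define N where "N \<phi> n \<tau> = (1 / M n) * (exp (- d n * c \<tau>) * (p n + integral {0..c \<tau>} (\<lambda>r. exp (d n * r) * Gs (V \<phi> r) n)))" for \<phi> n \<tau>
  define \<Phi> where "\<Phi> \<phi> = Bcontfun (\<lambda>n. Bcontfun (N \<phi> n))" for \<phi>
  have V_cont: "continuous_on S (\<lambda>r. V \<phi> r m)" for S \<phi> m
    unfolding V_def by (intro continuous_intros) auto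
  have G_cont: "continuous_on S (\<lambda>r. Gs (V \<phi> r) n)" for S \<phi> n
    unfolding Gs_def by (cases "n = 0") (auto intro!: continuous_intros V_cont)
  have int_cont: "continuous_on {0..\<delta>} (\<lambda>t. integral {0..t} (\<lambda>r. exp (d n * r) * Gs (V \<phi> r) n))" for \<phi> n
    by (rule indefinite_integral_continuous_1) (intro integrable_continuous_interval continuous_intros G_cont)
  have N_cont: "continuous_on UNIV (N \<phi> n)" for \<phi> n
    unfolding N_def
    by (intro continuous_intros c_cont continuous_on_compose2[OF int_cont c_cont]) (use c in auto)
  have V_le: "\<bar>V \<phi> r m - V \<phi>' r m\<bar> \<le> dist \<phi> \<phi>' * M m" for \<phi> \<phi>' r m
  proof -
    have "\<bar>apply_bcontfun (apply_bcontfun \<phi> m) r - apply_bcontfun (apply_bcontfun \<phi>' m) r\<bar>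
        \<le> dist (apply_bcontfun \<phi> m) (apply_bcontfun \<phi>' m)"
      using dist_bounded[of "apply_bcontfun \<phi> m" r "apply_bcontfun \<phi>' m"] by (simp add: dist_real_def)
    also have "\<dots> \<le> dist \<phi> \<phi>'" by (rule dist_bounded)
    finally have "M m * \<bar>apply_bcontfun (apply_bcontfun \<phi> m) r - apply_bcontfun (apply_bcontfun \<phi>' m) r\<bar> \<le> M m * dist \<phi> \<phi>'"
      using M[of m] by (intro mult_left_mono) auto
    then show ?thesis
      using M[of m] by (simp add: V_def abs_mult right_diff_distrib[symmetric] mult.commute)
  qed
  let ?S = "cball (0 :: (nat, (real, real) bcontfun) bcontfun) 2"
  have V_bd: "\<bar>V \<phi> r m\<bar> \<le> 2 * M m" if "\<phi> \<in> ?S" for \<phi> r m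
  proof -
    have "\<bar>V \<phi> r m - V 0 r m\<bar> \<le> 2 * M m"
    proof -
      have "dist \<phi> 0 * M m \<le> 2 * M m"
        using M[of m] that by (intro mult_right_mono) auto
      then show ?thesis using V_le[of \<phi> r m 0] by linarith
    qed
    then show ?thesis by (simp add: V_def)
  qed
  have G_diff: "\<bar>Gs (V \<phi> r) n - Gs (V \<phi>' r) n\<bar> \<le> 4 * \<kappa> * dist \<phi> \<phi>' * M n" if "\<phi> \<in> ?S" "\<phi>' \<in> ?S" for \<phi> \<phi>' r n
    by (rule Gs_lipschitz[OF M \<kappa> V_bd[OF that(1)] V_bd[OF that(2)] V_le])
  have N_diff: "\<bar>N \<phi> n \<tau> - N \<phi>' n \<tau>\<bar> \<le> dist \<phi> \<phi>' / 4" if S: "\<phi> \<in> ?S" "\<phi>' \<in> ?S" for \<phi> \<phi>' n \<tau>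
  proof -
    let ?g = "\<lambda>r. Gs (V \<phi> r) n - Gs (V \<phi>' r) n"
    have "integral {0..c \<tau>} (\<lambda>r. exp (d n * r) * Gs (V \<phi> r) n) - integral {0..c \<tau>} (\<lambda>r. exp (d n * r) * Gs (V \<phi>' r) n)
        = integral {0..c \<tau>} (\<lambda>r. exp (d n * r) * ?g r)"
      unfolding right_diff_distrib
      by (rule Henstock_Kurzweil_Integration.integral_diff[symmetric])
        (intro integrable_continuous_interval continuous_intros G_cont)+
    then have eq: "N \<phi> n \<tau> - N \<phi>' n \<tau> = (1 / M n) * (exp (- d n * c \<tau>) * integral {0..c \<tau>} (\<lambda>r. exp (d n * r) * ?g r))"
      unfolding N_def by (simp add: algebra_simps flip: add_divide_distrib diff_divide_distrib)
    have "\<bar>N \<phi> n \<tau> - N \<phi>' n \<tau>\<bar> \<le> (1 / M n) * (c \<tau> * (4 * \<kappa> * dist \<phi> \<phi>' * M n))"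
    proof -
      have "\<bar>exp (- d n * c \<tau>) * integral {0..c \<tau>} (\<lambda>r. exp (d n * r) * ?g r)\<bar> \<le> c \<tau> * (4 * \<kappa> * dist \<phi> \<phi>' * M n)"
        by (intro duhamel_bound d c G_diff S continuous_intros G_cont)
      then show ?thesis
        using M[of n] unfolding eq abs_mult[of "1 / M n"] by (intro mult_mono) (auto simp: less_imp_le)
    qed
    also have "\<dots> = c \<tau> * (4 * \<kappa> * dist \<phi> \<phi>')" using M[of n] by simp
    also have "\<dots> \<le> \<delta> * (4 * \<kappa> * dist \<phi> \<phi>')"
      using c k0 by (intro mult_right_mono) auto
    also have "\<dots> = (16 * \<kappa> * \<delta>) * dist \<phi> \<phi>' / 4" by simp
    finally show ?thesis unfolding \<delta> by simp
  qed
  have N0: "\<bar>N 0 n \<tau>\<bar> \<le> 1" for n \<tau>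
  proof -
    have "V 0 r = (\<lambda>n. 0)" for r by (simp add: V_def fun_eq_iff)
    then have "N 0 n \<tau> = (1 / M n) * (exp (- d n * c \<tau>) * p n)"
      by (simp add: N_def)
    then have "\<bar>N 0 n \<tau>\<bar> = exp (- d n * c \<tau>) * \<bar>p n\<bar> / M n"
      using M[of n] by (simp add: abs_mult)
    moreover have "exp (- d n * c \<tau>) * \<bar>p n\<bar> \<le> 1 * M n"
      using d c p by (intro mult_mono) auto
    ultimately show ?thesis using M[of n] by (simp add: divide_le_eq)
  qed
  have N_bd: "\<bar>N \<phi> n \<tau>\<bar> \<le> 2" if "\<phi> \<in> ?S" for \<phi> n \<tau>
  proof -
    have "dist \<phi> 0 \<le> 2" using that by (simp add: dist_commute)
    then have "\<bar>N \<phi> n \<tau> - N 0 n \<tau>\<bar> \<le> 1/2"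
      using N_diff[OF that, of 0 n \<tau>] by simp
    then show ?thesis
      using N0[of n \<tau>] abs_triangle_ineq2[of "N \<phi> n \<tau>" "N 0 n \<tau>"] by linarith
  qed
  have inner: "apply_bcontfun (Bcontfun (N \<phi> n)) \<tau> = N \<phi> n \<tau>" if "\<phi> \<in> ?S" for \<phi> n \<tau>
    by (subst Bcontfun_inverse) (use N_bd[OF that] N_cont in \<open>auto intro!: bcontfun_normI[where b = 2]\<close>)
  have inner_norm: "norm (Bcontfun (N \<phi> n)) \<le> 2" if "\<phi> \<in> ?S" for \<phi> n
    by (rule norm_bound) (use N_bd[OF that] inner[OF that] in auto)
  have outer: "apply_bcontfun (\<Phi> \<phi>) n = Bcontfun (N \<phi> n)" if "\<phi> \<in> ?S" for \<phi> n
    unfolding \<Phi>_def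
    by (subst Bcontfun_inverse) (use inner_norm[OF that] in \<open>auto intro!: bcontfun_normI[where b = 2]\<close>)
  have "\<exists>!\<phi>\<in>?S. \<Phi> \<phi> = \<phi>"
  proof (rule Banach_fix[where c = "1/4"])
    show "complete ?S" by (rule complete_closed_subset[OF closed_cball subset_UNIV complete_UNIV_bcontfun])
    show "\<Phi> ` ?S \<subseteq> ?S"
    proof safe
      fix \<phi> assume S: "\<phi> \<in> ?S"
      have "norm (\<Phi> \<phi>) \<le> 2"
      proof (rule norm_bound)
        show "norm (apply_bcontfun (\<Phi> \<phi>) n) \<le> 2" for n
          unfolding outer[OF S] by (rule inner_norm[OF S])
      qed
      then show "\<Phi> \<phi> \<in> ?S" by simp
    qed
    show "dist (\<Phi> \<phi>) (\<Phi> \<phi>') \<le> 1/4 * dist \<phi> \<phi>'" if "\<phi> \<in> ?S" "\<phi>' \<in> ?S" for \<phi> \<phi>'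
    proof (rule dist_bound)
      fix n
      show "dist (apply_bcontfun (\<Phi> \<phi>) n) (apply_bcontfun (\<Phi> \<phi>') n) \<le> 1/4 * dist \<phi> \<phi>'"
        unfolding outer[OF that(1)] outer[OF that(2)]
      proof (rule dist_bound)
        show "dist (apply_bcontfun (Bcontfun (N \<phi> n)) \<tau>) (apply_bcontfun (Bcontfun (N \<phi>' n)) \<tau>) \<le> 1/4 * dist \<phi> \<phi>'" for \<tau>
          unfolding inner[OF that(1)] inner[OF that(2)] dist_real_def using N_diff[OF that, of n \<tau>] by simp
      qed
    qed
  qed auto
  then obtain \<phi> where \<phi>: "\<phi> \<in> ?S" "\<Phi> \<phi> = \<phi>" by blast
  define \<xi> where "\<xi> \<tau> n = V \<phi> \<tau> n" for \<tau> n
  have \<xi>_eq: "\<xi> \<tau> n = exp (- d n * c \<tau>) * (p n + integral {0..c \<tau>} (\<lambda>r. exp (d n * r) * Gs (V \<phi> r) n))" for \<tau> n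
  proof -
    have "apply_bcontfun (apply_bcontfun \<phi> n) \<tau> = N \<phi> n \<tau>"
      using outer[OF \<phi>(1)] inner[OF \<phi>(1)] \<phi>(2) by metis
    then show ?thesis using M[of n] by (simp add: \<xi>_def V_def N_def)
  qed
  show thesis
  proof (rule that[of \<delta> \<xi>])
    show "\<delta> > 0" by (rule \<delta>)
    show "\<xi> 0 = p" using \<delta> by (auto simp: fun_eq_iff \<xi>_eq c_def)
    show "\<bar>\<xi> \<tau> n\<bar> \<le> 2 * M n" for \<tau> n unfolding \<xi>_def by (rule V_bd[OF \<phi>(1)])
    fix \<tau> n assume \<tau>: "\<tau> \<in> {0..\<delta>}"
    let ?I = "\<lambda>t. p n + integral {0..t} (\<lambda>r. exp (d n * r) * Gs (V \<phi> r) n)"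
    have cg: "continuous_on {0..\<delta>} (\<lambda>r. exp (d n * r) * Gs (V \<phi> r) n)"
      by (intro continuous_intros G_cont)
    have I: "(?I has_real_derivative (exp (d n * \<tau>) * Gs (V \<phi> \<tau>) n)) (at \<tau> within {0..\<delta>})"
      using integral_has_real_derivative[OF cg \<tau>] by (auto intro!: derivative_eq_intros)
    have "((\<lambda>t. exp (- d n * t) * ?I t) has_real_derivative
        (- d n * exp (- d n * \<tau>) * ?I \<tau> + (exp (d n * \<tau>) * Gs (V \<phi> \<tau>) n) * exp (- d n * \<tau>))) (at \<tau> within {0..\<delta>})"
      by (intro DERIV_mult I) (auto intro!: derivative_eq_intros)
    moreover have "- d n * exp (- d n * \<tau>) * ?I \<tau> + (exp (d n * \<tau>) * Gs (V \<phi> \<tau>) n) * exp (- d n * \<tau>)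
        = Gs (\<xi> \<tau>) n - d n * \<xi> \<tau> n"
    proof -
      have "c \<tau> = \<tau>" using \<tau> by (simp add: c_def)
      then have "\<xi> \<tau> n = exp (- d n * \<tau>) * ?I \<tau>" by (simp add: \<xi>_eq)
      moreover have "(exp (d n * \<tau>) * Gs (V \<phi> \<tau>) n) * exp (- d n * \<tau>) = Gs (\<xi> \<tau>) n"
        by (simp add: \<xi>_def[abs_def] exp_minus)
      ultimately show ?thesis by simp
    qed
    ultimately have "((\<lambda>t. exp (- d n * t) * ?I t) has_real_derivative (Gs (\<xi> \<tau>) n - d n * \<xi> \<tau> n)) (at \<tau> within {0..\<delta>})"
      by simp
    then show "((\<lambda>\<tau>. \<xi> \<tau> n) has_real_derivative (Gs (\<xi> \<tau>) n - d n * \<xi> \<tau> n)) (at \<tau> within {0..\<delta>})"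
      by (rule has_field_derivative_transform_within[where d = 1]) (use \<tau> in \<open>auto simp: \<xi>_eq c_def\<close>)
  qed
qed

subsection \<open>Continuation\<close>

text \<open>Each coefficient is Lipschitz in time, with a constant depending on its index, so it has
  a limit at the end time, and the limits still obey the bound \<open>M\<close>. The local solution
  is started from them.\<close>

lemma (in shell_model) continuation:
  assumes T: "T = ereal T0" "T0 > 0" and M: "\<And>n. M n > 0" and k0: "\<kappa> > 0"
    and \<kappa>: "\<And>n. (if n = 0 then 0 else Ac (n - 1) * (M (n - 1))\<^sup>2) + Ac n * M n * M (Suc n) \<le> \<kappa> * M n"
    and dom: "\<And>t n. t \<in> time_dom T \<Longrightarrow> \<psi> t n \<le> M n"
  obtains T1 :: real and \<Psi> where "T1 > T0" "\<And>t. t \<in> time_dom T \<Longrightarrow> \<Psi> t = \<psi> t"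
    "\<And>t n. t \<in> {0..T1} \<Longrightarrow> \<bar>\<Psi> t n\<bar> \<le> 2 * M n"
    "\<And>t n. t \<in> {0..T1} \<Longrightarrow>
      ((\<lambda>t. \<Psi> t n) has_real_derivative (Gs (\<Psi> t) n - d n * \<Psi> t n)) (at t within {0..T1})"
proof -
  have td: "time_dom T = {0..<T0}" by (auto simp: time_dom_def T)
  have \<psi>_le: "\<bar>\<psi> t n\<bar> \<le> M n" if "t \<in> {0..<T0}" for t n
    using dom[of t n] nonneg[of t n] that by (simp add: td)
  have M2: "\<bar>\<psi> t n\<bar> \<le> 2 * M n" if "t \<in> {0..<T0}" for t n
    using \<psi>_le[OF that, of n] M[of n] by linarith
  \<comment> \<open>Comparison with the zero sequence at weighted distance 2, hence
    \<open>4 * \<kappa> * 2\<close>.\<close>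
  have G_le: "\<bar>Gs x n\<bar> \<le> 8 * \<kappa> * M n" if "\<And>n. \<bar>x n\<bar> \<le> 2 * M n" for x n
    using Gs_lipschitz[of M \<kappa> x "\<lambda>n. 0" 2 n] M \<kappa> that by (simp add: less_imp_le)
  have ode': "((\<lambda>\<tau>. \<psi> \<tau> n) has_real_derivative (Gs (\<psi> t) n - d n * \<psi> t n)) (at t within {0..<T0})"
    if "t \<in> {0..<T0}" for t n
    using ode[of t n] that by (simp add: td)
  have "\<exists>l. ((\<lambda>t. \<psi> t n) \<longlongrightarrow> l) (at T0 within {0..<T0})" for n
  proof -
    have "(8 * \<kappa> * M n + d n * M n)-lipschitz_on {0..<T0} (\<lambda>t. \<psi> t n)"
    proof (rule lipschitz_onI)
      fix x y assume xy: "x \<in> {0..<T0}" "y \<in> {0..<T0}"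
      have "norm (\<psi> x n - \<psi> y n) \<le> (8 * \<kappa> * M n + d n * M n) * norm (x - y)"
      proof (rule field_differentiable_bound[of "{0..<T0}"])
        fix t assume t: "t \<in> {0..<T0}"
        show "((\<lambda>t. \<psi> t n) has_real_derivative (Gs (\<psi> t) n - d n * \<psi> t n)) (at t within {0..<T0})"
          by (rule ode'[OF t])
        have "\<bar>d n * \<psi> t n\<bar> \<le> d n * M n"
          using d_nonneg[of n] \<psi>_le[OF t, of n] by (simp add: abs_mult mult_left_mono)
        then show "norm (Gs (\<psi> t) n - d n * \<psi> t n) \<le> 8 * \<kappa> * M n + d n * M n"
          using G_le[of "\<psi> t" n, OF M2[OF t]] unfolding real_norm_def by linarith
      qed (use xy in auto)
      then show "dist (\<psi> x n) (\<psi> y n) \<le> (8 * \<kappa> * M n + d n * M n) * dist x y"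
        by (simp add: dist_norm)
    qed (use k0 M[of n] d_nonneg[of n] in \<open>auto simp: less_imp_le\<close>)
    then have "uniformly_continuous_on {0..<T0} (\<lambda>t. \<psi> t n)"
      by (rule lipschitz_on_uniformly_continuous)
    moreover have "T0 \<in> closure {0..<T0}" using T(2) by simp
    ultimately show ?thesis using uniformly_continuous_on_extension_at_closure by blast
  qed
  then obtain p where p: "\<And>n. ((\<lambda>t. \<psi> t n) \<longlongrightarrow> p n) (at T0 within {0..<T0})" by metis
  have nt: "at T0 within {0..<T0} \<noteq> bot"
    using T(2) by (simp add: trivial_limit_within islimpt_in_closure[symmetric])
  have p_le: "\<bar>p n\<bar> \<le> M n" for n
    by (rule tendsto_upperbound[OF tendsto_rabs[OF p[of n]] _ nt])
      (auto simp: eventually_at_filter \<psi>_le)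
  obtain \<delta> :: real and \<xi> where \<delta>: "\<delta> > 0" and \<xi>0: "\<xi> 0 = p" and \<xi>_le: "\<And>\<tau> n. \<bar>\<xi> \<tau> n\<bar> \<le> 2 * M n"
    and \<xi>: "\<And>\<tau> n. \<tau> \<in> {0..\<delta>} \<Longrightarrow>
      ((\<lambda>\<tau>. \<xi> \<tau> n) has_real_derivative (Gs (\<xi> \<tau>) n - d n * \<xi> \<tau> n)) (at \<tau> within {0..\<delta>})"
    by (rule local_existence[OF d_nonneg M k0 \<kappa> p_le]) (rule that; assumption)
  define \<Psi> where "\<Psi> t = (if t < T0 then \<psi> t else \<xi> (t - T0))" for t
  define T1 where "T1 = T0 + \<delta>"
  define f where "f n t = Gs (\<Psi> t) n - d n * \<Psi> t n" for n t
  have \<Psi>_le: "\<bar>\<Psi> t n\<bar> \<le> 2 * M n" if "t \<in> {0..T1}" for t n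
    using that M2[of t n] \<xi>_le by (auto simp: \<Psi>_def)
  have cont_left: "continuous_on {0..T0} (\<lambda>t. \<Psi> t n)" for n
    unfolding continuous_on_def
  proof
    fix t assume t: "t \<in> {0..T0}"
    show "((\<lambda>t. \<Psi> t n) \<longlongrightarrow> \<Psi> t n) (at t within {0..T0})"
    proof (cases "t = T0")
      case True
      have "at T0 within {0..T0} = at T0 within {0..<T0}"
        by (rule at_within_nhd[of _ UNIV]) auto
      moreover have "((\<lambda>t. \<Psi> t n) \<longlongrightarrow> p n) (at T0 within {0..<T0})"
        using p[of n] by (rule Lim_transform_within[where d = 1]) (auto simp: \<Psi>_def)
      ultimately show ?thesis using True by (simp add: \<Psi>_def \<xi>0)
    next
      case False
      then have t': "t \<in> {0..<T0}" using t by auto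
      have "at t within {0..T0} = at t within {0..<T0}"
        by (rule at_within_nhd[of _ "{..<T0}"]) (use t' in auto)
      moreover have "((\<lambda>t. \<psi> t n) \<longlongrightarrow> \<psi> t n) (at t within {0..<T0})"
        using DERIV_continuous[OF ode'[OF t', of n]] by (simp add: continuous_within)
      then have "((\<lambda>t. \<Psi> t n) \<longlongrightarrow> \<psi> t n) (at t within {0..<T0})"
        by (rule Lim_transform_within[where d = 1]) (auto simp: \<Psi>_def)
      ultimately show ?thesis using t' by (simp add: \<Psi>_def)
    qed
  qed
  have cont_right: "continuous_on {T0..T1} (\<lambda>t. \<Psi> t n)" for n
  proof -
    have "continuous_on {0..\<delta>} (\<lambda>t. \<xi> t n)" using \<xi> by (rule DERIV_continuous_on)
    then have "continuous_on {T0..T1} (\<lambda>t. \<xi> (t - T0) n)"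
      by (rule continuous_on_compose2) (auto intro!: continuous_intros simp: T1_def)
    then show ?thesis by (rule continuous_on_eq) (simp add: \<Psi>_def)
  qed
  have "{0..T1} = {0..T0} \<union> {T0..T1}" using T(2) \<delta> by (auto simp: T1_def)
  then have cont: "continuous_on {0..T1} (\<lambda>t. \<Psi> t n)" for n
    using continuous_on_closed_Un[OF _ _ cont_left cont_right] by simp
  have f_cont: "continuous_on {0..T1} (f n)" for n
    unfolding f_def Gs_def by (cases "n = 0") (auto intro!: continuous_intros cont)
  have deriv: "((\<lambda>t. \<Psi> t n) has_real_derivative f n t) (at t)" if t: "t \<in> {0<..<T1} - {T0}" for t n
  proof (cases "t < T0")
    case True
    have "at t within {0..<T0} = at t"
      by (rule at_within_open_subset[of _ "{0<..<T0}"]) (use t True in auto)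
    then have "((\<lambda>t. \<psi> t n) has_real_derivative f n t) (at t)"
      using ode'[of t n] t True by (simp add: f_def \<Psi>_def[abs_def])
    then show ?thesis
      by (rule has_field_derivative_transform_within_open[of _ _ _ "{..<T0}"]) (use True in \<open>auto simp: \<Psi>_def\<close>)
  next
    case False
    then have t': "t - T0 \<in> {0<..<\<delta>}" using t by (auto simp: T1_def)
    have "at (t - T0) within {0..\<delta>} = at (t - T0)"
      by (rule at_within_open_subset[of _ "{0<..<\<delta>}"]) (use t' in auto)
    then have "((\<lambda>t. \<xi> t n) has_real_derivative f n t) (at (t - T0))"
      using \<xi>[of "t - T0" n] t' False by (simp add: f_def \<Psi>_def)
    then have "((\<lambda>t. \<xi> (t - T0) n) has_real_derivative f n t * 1) (at t)"
      by (intro DERIV_chain2[where f = "\<lambda>t. \<xi> t n"]) (auto intro!: derivative_eq_intros)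
    then have "((\<lambda>t. \<xi> (t - T0) n) has_real_derivative f n t) (at t)" by simp
    then show ?thesis
      by (rule has_field_derivative_transform_within_open[of _ _ _ "{T0<..}"]) (use t False in \<open>auto simp: \<Psi>_def\<close>)
  qed
  \<comment> \<open>The derivative at the junction is obtained indirectly: \<open>\<Psi>\<close> is
    continuous and differentiable off \<open>T0\<close>, so it is the integral of
    \<open>f n\<close>, and \<open>f n\<close> is continuous across \<open>T0\<close>.\<close>
  have int: "\<Psi> t n = \<Psi> 0 n + integral {0..t} (f n)" if t: "t \<in> {0..T1}" for t n
  proof -
    have "(f n has_integral (\<Psi> t n - \<Psi> 0 n)) {0..t}"
    proof (rule fundamental_theorem_of_calculus_interior_strong[of "{T0}"])
      show "continuous_on {0..t} (\<lambda>t. \<Psi> t n)"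
        using cont by (rule continuous_on_subset) (use t in auto)
      show "((\<lambda>t. \<Psi> t n) has_vector_derivative f n x) (at x)" if "x \<in> {0<..<t} - {T0}" for x
        using deriv[of x n] that t by (simp add: has_real_derivative_iff_has_vector_derivative)
    qed (use t in auto)
    then show ?thesis by (simp add: integral_unique)
  qed
  show thesis
  proof (rule that[of T1 \<Psi>])
    show "T1 > T0" using \<delta> by (simp add: T1_def)
    show "\<Psi> t = \<psi> t" if "t \<in> time_dom T" for t using that by (simp add: td \<Psi>_def)
    show "\<bar>\<Psi> t n\<bar> \<le> 2 * M n" if "t \<in> {0..T1}" for t n by (rule \<Psi>_le[OF that])
    fix t n assume t: "t \<in> {0..T1}"
    have "((\<lambda>t. \<Psi> 0 n + integral {0..t} (f n)) has_real_derivative f n t) (at t within {0..T1})"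
      using integral_has_real_derivative[OF f_cont t] by (auto intro!: derivative_eq_intros)
    then have "((\<lambda>t. \<Psi> t n) has_real_derivative f n t) (at t within {0..T1})"
      by (rule has_field_derivative_transform_within[where d = 1]) (use t in \<open>auto simp: int [symmetric]\<close>)
    then show "((\<lambda>t. \<Psi> t n) has_real_derivative (Gs (\<Psi> t) n - d n * \<Psi> t n)) (at t within {0..T1})"
      by (simp add: f_def)
  qed
qed

text \<open>The majorant \<open>M\<close> has to be positive, dominate the solution, be square
  summable with the weights, and satisfy \<open>q * M n \<le> M (Suc n)\<close>; the last property
  keeps the source from the previous shell below a multiple of \<open>M n\<close>. An envelope
  provides all four.\<close>

lemma (in shell_model) extension:
  assumes T: "T = ereal T0" "T0 > 0" and s: "s > 5/2"
    and sm0: "summable (\<lambda>n. dsp s n * (\<psi> 0 n)\<^sup>2)"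
    and L: "\<And>t. t \<in> time_dom T \<Longrightarrow> Lam t \<le> L"
  obtains T1 :: real and \<Psi> E K where "T1 > T0" "\<And>t. t \<in> time_dom T \<Longrightarrow> \<Psi> t = \<psi> t"
    "summable (\<lambda>n. dsp s n * (E n)\<^sup>2)" "\<And>t n. t \<in> {0..T1} \<Longrightarrow> \<bar>\<Psi> t n\<bar> \<le> E n"
    "\<And>t n. t \<in> {0..T1} \<Longrightarrow> \<bar>Gs (\<Psi> t) n\<bar> \<le> K * E n"
    "\<And>t n. t \<in> {0..T1} \<Longrightarrow>
      ((\<lambda>t. \<Psi> t n) has_real_derivative (Gs (\<Psi> t) n - d n * \<Psi> t n)) (at t within {0..T1})"
proof -
  define q where "q = 2 powr (- s) / 2"
  have q: "q > 0" by (simp add: q_def)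
  \<comment> \<open>The second summand makes every term positive, as needed for dividing by
    \<open>M n\<close>; its weighted squares are \<open>(1/4) ^ n\<close>.\<close>
  define a where "a n = exp (L / q) * \<psi> 0 n + (1/2) ^ n / sqrt (dsp s n)" for n
  have a_pos: "a n > 0" for n
    unfolding a_def using init[of n] by (intro add_nonneg_pos) auto
  define M where "M = env q a"
  have M_pos: "M n > 0" for n
    unfolding M_def using a_pos q by (induction n) (auto intro: add_pos_pos)
  have sma: "summable (\<lambda>n. dsp s n * (a n)\<^sup>2)"
  proof (rule summable_comparison_test')
    show "summable (\<lambda>n. 2 * (exp (L / q))\<^sup>2 * (dsp s n * (\<psi> 0 n)\<^sup>2) + 2 * (1/4) ^ n)"
      by (intro summable_add summable_mult sm0 summable_geometric) simp
    fix n
    have "(a n)\<^sup>2 \<le> 2 * (exp (L / q) * \<psi> 0 n)\<^sup>2 + 2 * ((1/2) ^ n / sqrt (dsp s n))\<^sup>2"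
      unfolding a_def using sum_squares_bound[of "exp (L / q) * \<psi> 0 n" "(1/2) ^ n / sqrt (dsp s n)"]
      by (simp add: power2_sum)
    then have "dsp s n * (a n)\<^sup>2 \<le> dsp s n * (2 * (exp (L / q) * \<psi> 0 n)\<^sup>2 + 2 * ((1/2) ^ n / sqrt (dsp s n))\<^sup>2)"
      by (intro mult_left_mono) (auto simp: less_imp_le)
    also have "dsp s n * ((1/2) ^ n / sqrt (dsp s n))\<^sup>2 = (1/4) ^ n"
    proof -
      have "((1/2::real) ^ n)\<^sup>2 = (1/4) ^ n"
        by (simp add: power_mult [symmetric] mult.commute[of n]) (simp add: power_mult power_divide)
      then show ?thesis by (simp add: power_divide[of _ "sqrt (dsp s n)"] less_imp_le)
          (simp add: less_imp_neq[OF dsp_pos, symmetric])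
    qed
    then have "dsp s n * (2 * (exp (L / q) * \<psi> 0 n)\<^sup>2 + 2 * ((1/2) ^ n / sqrt (dsp s n))\<^sup>2)
        = 2 * (exp (L / q))\<^sup>2 * (dsp s n * (\<psi> 0 n)\<^sup>2) + 2 * (1/4) ^ n"
      by (simp add: power_mult_distrib distrib_left mult.left_commute[of "dsp s n"])
    finally show "norm (dsp s n * (a n)\<^sup>2) \<le> 2 * (exp (L / q))\<^sup>2 * (dsp s n * (\<psi> 0 n)\<^sup>2) + 2 * (1/4) ^ n"
      by (simp add: less_imp_le)
  qed
  have smM: "summable (\<lambda>n. dsp s n * (M n)\<^sup>2)"
    unfolding M_def by (rule summable_env[OF _ q_def _ sma]) (use s a_pos in \<open>auto simp: less_imp_le\<close>)
  define C where "C = sqrt (\<Sum>n. dsp s n * (M n)\<^sup>2)"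
  have C: "M n \<le> C * (1/5) ^ n" for n
    using bound_of_summable[OF s smM, of n] unfolding C_def by linarith
  have C0: "C > 0" using C[of 0] M_pos[of 0] by simp
  have M_step: "q * M n \<le> M (Suc n)" for n
    using a_pos[of "Suc n"] by (simp add: M_def)
  \<comment> \<open>The growth \<open>2 ^ n\<close> against the decay \<open>(1/5) ^ n\<close>
    leaves \<open>(2/5) ^ n\<close>, so coupling times majorant stays bounded.\<close>
  have AM: "Ac n * M n \<le> 4 * pi * C" for n
  proof -
    have "Ac n * M n \<le> (4 * pi * 2 ^ n) * (C * (1/5) ^ n)"
      by (intro mult_mono Ac_le C) (auto simp: less_imp_le M_pos)
    also have "\<dots> = 4 * pi * C * (2/5) ^ n" by (simp add: power_divide)
    also have "\<dots> \<le> 4 * pi * C * 1" using C0 by (intro mult_left_mono power_le_one) auto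
    finally show ?thesis by simp
  qed
  \<comment> \<open>The first summand pays for the source from the shell below, the second for the
    transfer to the shell above.\<close>
  define \<kappa> where "\<kappa> = 4 * pi * C / q + 4 * pi * C"
  have k0: "\<kappa> > 0" unfolding \<kappa>_def using C0 q by (intro add_pos_pos) auto
  have \<kappa>: "(if n = 0 then 0 else Ac (n - 1) * (M (n - 1))\<^sup>2) + Ac n * M n * M (Suc n) \<le> \<kappa> * M n" for n
  proof -
    have "(if n = 0 then 0 else Ac (n - 1) * (M (n - 1))\<^sup>2) \<le> 4 * pi * C / q * M n"
    proof (cases n)
      case (Suc m)
      have "Ac m * (M m)\<^sup>2 = (Ac m * M m) * M m" by (simp add: power2_eq_square)
      also have "\<dots> \<le> (4 * pi * C) * (M (Suc m) / q)"
      proof (rule mult_mono[OF AM])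
        show "M m \<le> M (Suc m) / q" using M_step[of m] q by (simp add: field_simps)
      qed (use M_pos[of m] C0 in \<open>auto simp: less_imp_le\<close>)
      finally show ?thesis by (simp add: Suc)
    qed (use C0 q M_pos[of n] in \<open>simp add: less_imp_le\<close>)
    moreover have "Ac n * M n * M (Suc n) \<le> 4 * pi * C * M n"
    proof -
      have "2 ^ n * M (Suc n) \<le> C"
      proof -
        have "2 ^ n * M (Suc n) \<le> 2 ^ n * (C * (1/5) ^ Suc n)" by (intro mult_left_mono C) auto
        also have "\<dots> = C / 5 * (2/5) ^ n" by (simp add: power_divide)
        also have "\<dots> \<le> C / 5 * 1" using C0 by (intro mult_left_mono power_le_one) auto
        finally show ?thesis using C0 by simp
      qed
      then have "(4 * pi) * (2 ^ n * M (Suc n)) \<le> 4 * pi * C" by (intro mult_left_mono) auto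
      moreover have "Ac n * M (Suc n) \<le> (4 * pi * 2 ^ n) * M (Suc n)"
        using Ac_le[of n] M_pos[of "Suc n"] by (intro mult_right_mono) (auto simp: less_imp_le)
      ultimately have "Ac n * M (Suc n) \<le> 4 * pi * C"
        unfolding mult.assoc by (rule order_trans[rotated])
      then have "(Ac n * M (Suc n)) * M n \<le> (4 * pi * C) * M n"
        using M_pos[of n] by (intro mult_right_mono) auto
      then show ?thesis by (simp add: mult_ac)
    qed
    ultimately show ?thesis by (simp add: \<kappa>_def distrib_right)
  qed
  have dom: "\<psi> t n \<le> M n" if t: "t \<in> time_dom T" for t n
  proof -
    have "\<psi> t n \<le> exp (Lam t / q) * env q (\<psi> 0) n" by (rule env_bound[OF q t])
    also have "\<dots> \<le> exp (L / q) * env q (\<psi> 0) n"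
      using L[OF t] q init by (intro mult_right_mono env_nonneg) (auto simp: divide_right_mono)
    also have "\<dots> = env q (\<lambda>n. exp (L / q) * \<psi> 0 n) n" by (simp add: env_cmult)
    also have "\<dots> \<le> M n"
      unfolding M_def using q by (intro env_mono) (auto simp: a_def less_imp_le)
    finally show ?thesis .
  qed
  show thesis
  proof (rule continuation[OF T M_pos k0 \<kappa> dom])
    fix T1 \<Psi>
    assume *: "T0 < T1" "\<And>t. t \<in> time_dom T \<Longrightarrow> \<Psi> t = \<psi> t"
      "\<And>t n. t \<in> {0..T1} \<Longrightarrow> \<bar>\<Psi> t n\<bar> \<le> 2 * M n"
      "\<And>t n. t \<in> {0..T1} \<Longrightarrow>
        ((\<lambda>t. \<Psi> t n) has_real_derivative (Gs (\<Psi> t) n - d n * \<Psi> t n)) (at t within {0..T1})"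
    show thesis
    \<comment> \<open>The majorant returned is \<open>2 * M n\<close>, the radius of the ball, so
      the bound \<open>8 * \<kappa> * M n\<close> on the nonlinearity reads
      \<open>4 * \<kappa>\<close> times it.\<close>
    proof (rule that[of T1 \<Psi> "\<lambda>n. 2 * M n" "4 * \<kappa>", OF *(1,2) _ *(3) _ *(4)])
      show "summable (\<lambda>n. dsp s n * (2 * M n)\<^sup>2)"
        using summable_mult[OF smM, of 4] by (simp add: power_mult_distrib mult_ac)
      show "\<bar>Gs (\<Psi> t) n\<bar> \<le> 4 * \<kappa> * (2 * M n)" if "t \<in> {0..T1}" for t n
        using Gs_lipschitz[of M \<kappa> "\<Psi> t" "\<lambda>n. 0" 2 n] M_pos \<kappa> *(3)[OF that] by (simp add: less_imp_le)
    qed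
  qed
qed

section \<open>From the equations to the coefficients and back\<close>

lemma tendsto_suminf_dominated:
  fixes f :: "'a \<Rightarrow> nat \<Rightarrow> real"
  assumes lim: "\<And>n. ((\<lambda>x. f x n) \<longlongrightarrow> g n) F"
    and bd: "\<forall>\<^sub>F x in F. \<forall>n. \<bar>f x n\<bar> \<le> M n" and sm: "summable M"
  shows "((\<lambda>x. \<Sum>n. f x n) \<longlongrightarrow> (\<Sum>n. g n)) F"
proof (cases "F = bot")
  case False
  show ?thesis
  proof (rule tannerys_theorem[where M = M and F = F, THEN conjunct2, THEN conjunct2])
    show "\<forall>\<^sub>F (k, n) in at_top \<times>\<^sub>F F. norm (f n k) \<le> M k"
      unfolding eventually_prod_filter using bd
      by (intro exI[of _ "\<lambda>_. True"] exI[of _ "\<lambda>x. \<forall>n. \<bar>f x n\<bar> \<le> M n"]) auto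
  qed (use lim sm False in auto)
qed simp

lemma summable_dsp_lincomb:
  assumes "summable (\<lambda>n. dsp s n * (\<psi> n)\<^sup>2)" "summable (\<lambda>n. dsp s n * (\<phi> n)\<^sup>2)"
  shows "summable (\<lambda>n. dsp s n * (a * \<psi> n + b * \<phi> n)\<^sup>2)"
proof (rule summable_comparison_test')
  show "summable (\<lambda>n. 2 * a\<^sup>2 * (dsp s n * (\<psi> n)\<^sup>2) + 2 * b\<^sup>2 * (dsp s n * (\<phi> n)\<^sup>2))"
    by (intro summable_add summable_mult assms)
  fix n
  have "(a * \<psi> n + b * \<phi> n)\<^sup>2 \<le> 2 * (a * \<psi> n)\<^sup>2 + 2 * (b * \<phi> n)\<^sup>2"
    using sum_squares_bound[of "a * \<psi> n" "b * \<phi> n"] by (simp add: power2_sum)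
  then have "dsp s n * (a * \<psi> n + b * \<phi> n)\<^sup>2 \<le> dsp s n * (2 * (a * \<psi> n)\<^sup>2 + 2 * (b * \<phi> n)\<^sup>2)"
    by (intro mult_left_mono) (auto simp: less_imp_le)
  then show "norm (dsp s n * (a * \<psi> n + b * \<phi> n)\<^sup>2) \<le> 2 * a\<^sup>2 * (dsp s n * (\<psi> n)\<^sup>2) + 2 * b\<^sup>2 * (dsp s n * (\<phi> n)\<^sup>2)"
    by (simp add: less_imp_le power_mult_distrib algebra_simps)
qed

lemma summable_dsp_diff:
  "summable (\<lambda>n. dsp s n * (\<psi> n)\<^sup>2) \<Longrightarrow> summable (\<lambda>n. dsp s n * (\<phi> n)\<^sup>2) \<Longrightarrow>
    summable (\<lambda>n. dsp s n * (\<psi> n - \<phi> n)\<^sup>2)"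
  using summable_dsp_lincomb[of s \<psi> \<phi> 1 "-1"] by simp

lemma summable_dsp_dominated:
  assumes "summable (\<lambda>n. dsp s n * (E n)\<^sup>2)" "\<And>n. \<bar>\<psi> n\<bar> \<le> C * E n"
  shows "summable (\<lambda>n. dsp s n * (\<psi> n)\<^sup>2)"
proof (rule summable_comparison_test')
  show "summable (\<lambda>n. C\<^sup>2 * (dsp s n * (E n)\<^sup>2))" by (intro summable_mult assms)
  fix n
  have "(\<psi> n)\<^sup>2 \<le> (C * E n)\<^sup>2" using power_mono[OF assms(2)[of n], of 2] by simp
  then have "dsp s n * (\<psi> n)\<^sup>2 \<le> dsp s n * (C * E n)\<^sup>2"
    by (intro mult_left_mono) (auto simp: less_imp_le)
  then show "norm (dsp s n * (\<psi> n)\<^sup>2) \<le> C\<^sup>2 * (dsp s n * (E n)\<^sup>2)"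
    by (simp add: less_imp_le power_mult_distrib mult_ac)
qed

lemma coeff_le_Hdot_norm:
  assumes s: "s > 5/2" and sm: "summable (\<lambda>n. dsp s n * (\<psi> n)\<^sup>2)"
  shows "5 ^ n * \<bar>\<psi> n\<bar> \<le> Hdot_norm s (usym \<psi>)"
proof -
  let ?S = "\<Sum>n. dsp s n * (\<psi> n)\<^sup>2"
  have "?S \<ge> 0" by (intro suminf_nonneg sm) (auto simp: less_imp_le)
  then have "sqrt ?S \<le> Hdot_norm s (usym \<psi>)"
    unfolding Hdot_norm_usym[OF decay_of_summable[OF s sm] sm] by simp
  moreover have "5 ^ n * \<bar>\<psi> n\<bar> \<le> sqrt ?S"
    using bound_of_summable[OF s sm, of n] by (simp add: field_simps power_divide)
  ultimately show ?thesis by linarith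
qed

text \<open>Convergence of each coefficient under a common majorant gives convergence in norm; this
  is the bridge from scalar equations to paths in the function space.\<close>

lemma Hdot_norm_tendsto_zero:
  assumes s: "s > 5/2" and E: "summable (\<lambda>n. dsp s n * (E n)\<^sup>2)"
    and bd: "\<forall>\<^sub>F x in F. \<forall>n. \<bar>f x n\<bar> \<le> C * E n" and lim: "\<And>n. ((\<lambda>x. f x n) \<longlongrightarrow> 0) F"
  shows "((\<lambda>x. Hdot_norm s (usym (f x))) \<longlongrightarrow> 0) F"
proof -
  have "((\<lambda>x. \<Sum>n. dsp s n * (f x n)\<^sup>2) \<longlongrightarrow> (\<Sum>n. dsp s n * 0\<^sup>2)) F"
  proof (rule tendsto_suminf_dominated)
    show "((\<lambda>x. dsp s n * (f x n)\<^sup>2) \<longlongrightarrow> dsp s n * 0\<^sup>2) F" for n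
      by (intro tendsto_intros lim)
    show "summable (\<lambda>n. C\<^sup>2 * (dsp s n * (E n)\<^sup>2))" by (intro summable_mult E)
    show "\<forall>\<^sub>F x in F. \<forall>n. \<bar>dsp s n * (f x n)\<^sup>2\<bar> \<le> C\<^sup>2 * (dsp s n * (E n)\<^sup>2)"
      using bd
    proof eventually_elim
      case (elim x)
      show ?case
      proof
        fix n
        have "(f x n)\<^sup>2 \<le> (C * E n)\<^sup>2" using power_mono[of "\<bar>f x n\<bar>" "C * E n" 2] elim by simp
        then have "dsp s n * (f x n)\<^sup>2 \<le> dsp s n * (C * E n)\<^sup>2"
          by (intro mult_left_mono) (auto simp: less_imp_le)
        then show "\<bar>dsp s n * (f x n)\<^sup>2\<bar> \<le> C\<^sup>2 * (dsp s n * (E n)\<^sup>2)"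
          by (simp add: less_imp_le power_mult_distrib mult_ac)
      qed
    qed
  qed
  then have "((\<lambda>x. sqrt (12 * (\<Sum>n. dsp s n * (f x n)\<^sup>2))) \<longlongrightarrow> sqrt (12 * 0)) F"
    by (intro tendsto_intros) simp
  moreover have "\<forall>\<^sub>F x in F. sqrt (12 * (\<Sum>n. dsp s n * (f x n)\<^sup>2)) = Hdot_norm s (usym (f x))"
    using bd
  proof eventually_elim
    case (elim x)
    then have "summable (\<lambda>n. dsp s n * (f x n)\<^sup>2)" by (intro summable_dsp_dominated[OF E, of _ C]) auto
    then show ?case by (simp add: Hdot_norm_usym decay_of_summable[OF s])
  qed
  ultimately show ?thesis by (simp add: tendsto_cong)
qed

lemma cont_path_usym:
  assumes s: "s > 5/2" and E: "summable (\<lambda>n. dsp s n * (E n)\<^sup>2)"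
    and bd: "\<And>t n. t \<in> time_dom T \<Longrightarrow> \<bar>f t n\<bar> \<le> C * E n"
    and cont: "\<And>n. continuous_on (time_dom T) (\<lambda>t. f t n)"
  shows "cont_path s T (\<lambda>t. usym (f t))"
  unfolding cont_path_def
proof (intro conjI ballI)
  fix t assume t: "t \<in> time_dom T"
  have sm: "summable (\<lambda>n. dsp s n * (f t n)\<^sup>2)" if "t \<in> time_dom T" for t
    by (rule summable_dsp_dominated[OF E bd[OF that]])
  note dec = decay_of_summable[OF s sm]
  show "usym (f t) \<in> Hdot_M s" by (rule usym_mem_Hdot_M[OF dec[OF t] sm[OF t]])
  show "continuous_on UNIV (usym (f t))" by (rule continuous_usym[OF dec[OF t]])
  have "((\<lambda>\<tau>. Hdot_norm s (usym (\<lambda>n. f \<tau> n - f t n))) \<longlongrightarrow> 0) (at t within time_dom T)"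
  proof (rule Hdot_norm_tendsto_zero[OF s E, where C = "2 * C"])
    show "\<forall>\<^sub>F \<tau> in at t within time_dom T. \<forall>n. \<bar>f \<tau> n - f t n\<bar> \<le> 2 * C * E n"
      unfolding eventually_at_filter
    proof (intro always_eventually allI impI)
      fix \<tau> n assume \<tau>: "\<tau> \<in> time_dom T"
      show "\<bar>f \<tau> n - f t n\<bar> \<le> 2 * C * E n"
        using bd[OF \<tau>, of n] bd[OF t, of n] abs_triangle_ineq4[of "f \<tau> n" "f t n"] by linarith
    qed
    show "((\<lambda>\<tau>. f \<tau> n - f t n) \<longlongrightarrow> 0) (at t within time_dom T)" for n
      using cont[of n] t by (auto simp: continuous_on_def intro: LIM_zero)
  qed
  then show "((\<lambda>\<tau>. Hdot_norm s (\<lambda>x. usym (f \<tau>) x - usym (f t) x)) \<longlongrightarrow> 0) (at t within time_dom T)"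
    by (rule Lim_transform_eventually)
      (auto simp: eventually_at_filter usym_diff[OF dec dec[OF t]] intro!: always_eventually)
qed

lemma path_coeffs:
  assumes s: "s > 5/2" and path: "cont_path s T u"
    and sym: "\<And>t. t \<in> time_dom T \<Longrightarrow> odd_field (u t) \<and> permutation_symmetric (u t) \<and> mirror_symmetric (u t)"
    and t: "t \<in> time_dom T"
  shows "summable (\<lambda>n. dsp s n * (sym_coeffs (u t) n)\<^sup>2)" "decay (sym_coeffs (u t))" "u t = usym (sym_coeffs (u t))"
proof -
  have "u t \<in> Hdot_M s" "continuous_on UNIV (u t)" using path t by (auto simp: cont_path_def)
  then obtain \<psi> where \<psi>: "summable (\<lambda>n. dsp s n * (\<psi> n)\<^sup>2)" "u t = usym \<psi>"
    using representation[OF s, of "u t"] sym[OF t] by metis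
  then have "sym_coeffs (u t) = \<psi>" by (simp add: sym_coeffs_usym decay_of_summable[OF s])
  with \<psi> show "summable (\<lambda>n. dsp s n * (sym_coeffs (u t) n)\<^sup>2)" "decay (sym_coeffs (u t))" "u t = usym (sym_coeffs (u t))"
    by (simp_all add: decay_of_summable[OF s])
qed

context
  fixes s T u \<psi>
  assumes s: "s > 5/2" and path: "cont_path s T u"
    and sm: "\<And>t. t \<in> time_dom T \<Longrightarrow> summable (\<lambda>n. dsp s n * (\<psi> t n)\<^sup>2)"
    and u: "\<And>t. t \<in> time_dom T \<Longrightarrow> u t = usym (\<psi> t)"
begin

lemma path_decay: "t \<in> time_dom T \<Longrightarrow> decay (\<psi> t)"
  by (rule decay_of_summable[OF s sm])

lemma path_diff:
  assumes "\<tau> \<in> time_dom T" "t \<in> time_dom T"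
  shows "5 ^ n * \<bar>\<psi> \<tau> n - \<psi> t n\<bar> \<le> Hdot_norm s (\<lambda>x. u \<tau> x - u t x)"
proof -
  have "Hdot_norm s (\<lambda>x. u \<tau> x - u t x) = Hdot_norm s (usym (\<lambda>n. \<psi> \<tau> n - \<psi> t n))"
    using assms by (simp add: u usym_diff path_decay)
  then show ?thesis
    using coeff_le_Hdot_norm[OF s summable_dsp_diff[OF sm sm, OF assms], of n] by simp
qed

lemma path_tendsto: "t \<in> time_dom T \<Longrightarrow> ((\<lambda>\<tau>. Hdot_norm s (\<lambda>x. u \<tau> x - u t x)) \<longlongrightarrow> 0) (at t within time_dom T)"
  using path by (simp add: cont_path_def)

lemma path_coeff_continuous: "continuous_on (time_dom T) (\<lambda>t. \<psi> t n)"
  unfolding continuous_on_def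
proof
  fix t assume t: "t \<in> time_dom T"
  have "((\<lambda>\<tau>. \<psi> \<tau> n - \<psi> t n) \<longlongrightarrow> 0) (at t within time_dom T)"
  proof (rule Lim_null_comparison[OF _ path_tendsto[OF t]])
    show "\<forall>\<^sub>F \<tau> in at t within time_dom T. norm (\<psi> \<tau> n - \<psi> t n) \<le> Hdot_norm s (\<lambda>x. u \<tau> x - u t x)"
      unfolding eventually_at_filter
    proof (intro always_eventually allI impI)
      fix \<tau> assume \<tau>: "\<tau> \<in> time_dom T"
      have "1 * \<bar>\<psi> \<tau> n - \<psi> t n\<bar> \<le> 5 ^ n * \<bar>\<psi> \<tau> n - \<psi> t n\<bar>"
        by (intro mult_right_mono) auto
      then show "norm (\<psi> \<tau> n - \<psi> t n) \<le> Hdot_norm s (\<lambda>x. u \<tau> x - u t x)"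
        using path_diff[OF \<tau> t, of n] by simp
    qed
  qed
  then show "((\<lambda>t. \<psi> t n) \<longlongrightarrow> \<psi> t n) (at t within time_dom T)"
    by (simp add: LIM_zero_iff)
qed

text \<open>The path is continuous into the supremum norm with weights \<open>5 ^ n\<close>, so a
  compact time interval has bounded image.\<close>

lemma path_bounded:
  assumes t: "t \<in> time_dom T"
  shows "\<exists>C. \<forall>\<tau>\<in>{0..t}. \<forall>n. \<bar>\<psi> \<tau> n\<bar> \<le> C * (1/5) ^ n"
proof -
  define g where "g \<tau> = Bcontfun (\<lambda>n. 5 ^ n * \<psi> \<tau> n)" for \<tau>
  have g: "apply_bcontfun (g \<tau>) n = 5 ^ n * \<psi> \<tau> n" if \<tau>: "\<tau> \<in> time_dom T" for \<tau> n
    unfolding g_def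
  proof (subst Bcontfun_inverse)
    show "(\<lambda>n. 5 ^ n * \<psi> \<tau> n) \<in> bcontfun"
      using coeff_le_Hdot_norm[OF s sm[OF \<tau>]]
      by (intro bcontfun_normI[where b = "Hdot_norm s (usym (\<psi> \<tau>))"]) (auto simp: abs_mult)
  qed simp
  have "continuous_on (time_dom T) g"
    unfolding continuous_on_def
  proof
    fix t assume t: "t \<in> time_dom T"
    show "(g \<longlongrightarrow> g t) (at t within time_dom T)"
    proof (subst tendsto_dist_iff, rule Lim_null_comparison[OF _ path_tendsto[OF t]])
      show "\<forall>\<^sub>F \<tau> in at t within time_dom T. norm (dist (g \<tau>) (g t)) \<le> Hdot_norm s (\<lambda>x. u \<tau> x - u t x)"
        unfolding eventually_at_filter
      proof (intro always_eventually allI impI)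
        fix \<tau> assume \<tau>: "\<tau> \<in> time_dom T"
        have "dist (g \<tau>) (g t) \<le> Hdot_norm s (\<lambda>x. u \<tau> x - u t x)"
        proof (rule dist_bound)
          fix n
          have "dist (apply_bcontfun (g \<tau>) n) (apply_bcontfun (g t) n) = \<bar>5 ^ n * (\<psi> \<tau> n - \<psi> t n)\<bar>"
            unfolding g[OF \<tau>] g[OF t] dist_real_def right_diff_distrib ..
          also have "\<dots> = 5 ^ n * \<bar>\<psi> \<tau> n - \<psi> t n\<bar>" unfolding abs_mult by simp
          finally show "dist (apply_bcontfun (g \<tau>) n) (apply_bcontfun (g t) n) \<le> Hdot_norm s (\<lambda>x. u \<tau> x - u t x)"
            using path_diff[OF \<tau> t, of n] by simp
        qed
        then show "norm (dist (g \<tau>) (g t)) \<le> Hdot_norm s (\<lambda>x. u \<tau> x - u t x)" by simp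
      qed
    qed
  qed
  then have "compact (g ` {0..t})"
    by (intro compact_continuous_image continuous_on_subset[OF _ time_dom_Icc[OF t]]) auto
  then have "bounded (g ` {0..t})" by (rule compact_imp_bounded)
  then obtain C where "\<forall>y\<in>g ` {0..t}. norm y \<le> C"
    unfolding bounded_iff by blast
  then have C: "norm (g \<tau>) \<le> C" if "\<tau> \<in> {0..t}" for \<tau>
    using that by blast
  have "\<bar>\<psi> \<tau> n\<bar> \<le> C * (1/5) ^ n" if \<tau>: "\<tau> \<in> {0..t}" for \<tau> n
  proof -
    have "norm (apply_bcontfun (g \<tau>) n) \<le> C"
      using norm_bounded[of "g \<tau>" n] C[OF \<tau>] by linarith
    then have "5 ^ n * \<bar>\<psi> \<tau> n\<bar> \<le> C"
      using g[of \<tau> n] time_dom_Icc[OF t] \<tau> by (auto simp: abs_mult)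
    then show ?thesis by (simp add: field_simps power_divide)
  qed
  then show ?thesis by blast
qed

end

text \<open>Coefficients are bounded by the norm, so difference quotients converging in norm
  converge coefficientwise, and the equation identifies the limit.\<close>

lemma euler_ode:
  assumes s: "s > 5/2" and sol: "euler_solution s T u"
    and sm: "\<And>t. t \<in> time_dom T \<Longrightarrow> summable (\<lambda>n. dsp s n * (\<psi> t n)\<^sup>2)"
    and u: "\<And>t. t \<in> time_dom T \<Longrightarrow> u t = usym (\<psi> t)"
    and t: "t \<in> time_dom T"
  shows "((\<lambda>\<tau>. \<psi> \<tau> n) has_real_derivative Gs (\<psi> t) n) (at t within time_dom T)"
proof -
  note dec = decay_of_summable[OF s sm]
  obtain u' where u': "cont_path s T u'"
    and quot: "((\<lambda>\<tau>. Hdot_norm s (\<lambda>x. (1 / (\<tau> - t)) *\<^sub>R (u \<tau> x - u t x) - u' t x)) \<longlongrightarrow> 0) (at t within time_dom T)"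
    and eq: "\<And>x. u' t x + proj_M (convect (u t)) x = 0"
    using sol t unfolding euler_solution_def by blast
  have dG: "decay (Gs (\<psi> t))" by (rule decay_Gs[OF dec[OF t]])
  have "u' t = usym (Gs (\<psi> t))"
  proof
    fix x
    have "proj_M (convect (u t)) x = usym (\<lambda>n. - Gs (\<psi> t) n) x"
      by (simp add: u[OF t] proj_convect[OF dec[OF t]])
    also have "\<dots> = - usym (Gs (\<psi> t)) x"
      using usym_lincomb[OF dG dG, of "-1" x 0] by simp
    finally show "u' t x = usym (Gs (\<psi> t)) x" using eq[of x] by (simp add: add_eq_0_iff)
  qed
  \<comment> \<open>Decay of \<open>Gs (\<psi> t)\<close> does not by itself give summability with
    the weights of \<open>s\<close>; this is read off from the membership of the time derivative in
    the space.\<close>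
  then have "usym (Gs (\<psi> t)) \<in> Hdot s" using u' t by (auto simp: cont_path_def Hdot_M_def)
  then have smG: "summable (\<lambda>n. dsp s n * (Gs (\<psi> t) n)\<^sup>2)"
    by (simp add: Hdot_def fcoeff_usym[OF dG] Hdot_summable_iff)
  have "((\<lambda>\<tau>. (\<psi> \<tau> n - \<psi> t n) / (\<tau> - t) - Gs (\<psi> t) n) \<longlongrightarrow> 0) (at t within time_dom T)"
  proof (rule Lim_null_comparison[OF _ quot])
    show "\<forall>\<^sub>F \<tau> in at t within time_dom T. norm ((\<psi> \<tau> n - \<psi> t n) / (\<tau> - t) - Gs (\<psi> t) n)
        \<le> Hdot_norm s (\<lambda>x. (1 / (\<tau> - t)) *\<^sub>R (u \<tau> x - u t x) - u' t x)"
      unfolding eventually_at_filter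
    proof (intro always_eventually allI impI)
      fix \<tau> assume \<tau>: "\<tau> \<in> time_dom T"
      let ?c = "1 / (\<tau> - t)"
      \<comment> \<open>Spelled out as a nested combination so that \<open>usym_lincomb\<close> and
        \<open>summable_dsp_lincomb\<close> match it literally.\<close>
      let ?q = "\<lambda>n. 1 * (?c * \<psi> \<tau> n + - ?c * \<psi> t n) + - 1 * Gs (\<psi> t) n"
      have smd: "summable (\<lambda>n. dsp s n * (?c * \<psi> \<tau> n + - ?c * \<psi> t n)\<^sup>2)"
        by (rule summable_dsp_lincomb[OF sm[OF \<tau>] sm[OF t]])
      have smq: "summable (\<lambda>n. dsp s n * (?q n)\<^sup>2)"
        by (rule summable_dsp_lincomb[OF smd smG])
      have "(\<lambda>x. ?c *\<^sub>R (u \<tau> x - u t x) - u' t x) = usym ?q"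
      proof
        fix x
        have "?c *\<^sub>R (u \<tau> x - u t x) - u' t x = 1 *\<^sub>R (?c *\<^sub>R usym (\<psi> \<tau>) x + (- ?c) *\<^sub>R usym (\<psi> t) x) + (- 1) *\<^sub>R usym (Gs (\<psi> t)) x"
          by (simp add: u \<tau> t \<open>u' t = usym (Gs (\<psi> t))\<close> scaleR_diff_right)
        also have "\<dots> = usym ?q x"
          by (simp only: usym_lincomb[OF dec[OF \<tau>] dec[OF t]] usym_lincomb[OF decay_of_summable[OF s smd] dG])
        finally show "?c *\<^sub>R (u \<tau> x - u t x) - u' t x = usym ?q x" .
      qed
      moreover have "1 * \<bar>?q n\<bar> \<le> 5 ^ n * \<bar>?q n\<bar>" by (intro mult_right_mono) auto
      moreover have "?q n = (\<psi> \<tau> n - \<psi> t n) / (\<tau> - t) - Gs (\<psi> t) n"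
        by (simp add: diff_divide_distrib)
      ultimately show "norm ((\<psi> \<tau> n - \<psi> t n) / (\<tau> - t) - Gs (\<psi> t) n)
          \<le> Hdot_norm s (\<lambda>x. (1 / (\<tau> - t)) *\<^sub>R (u \<tau> x - u t x) - u' t x)"
        using coeff_le_Hdot_norm[OF s smq, of n] by simp
    qed
  qed
  then show ?thesis
    unfolding has_field_derivative_iff by (simp add: LIM_zero_iff)
qed

subsection \<open>The mild equation\<close>

lemma integrable_continuous_Icc:
  fixes f :: "real \<Rightarrow> 'a::euclidean_space"
  assumes "continuous_on {0..t} f"
  shows "set_integrable lebesgue {0..t} f" "(LINT \<tau>:{0..t}|lebesgue. f \<tau>) = integral {0..t} f"
proof -
  show "set_integrable lebesgue {0..t} f"
    using assms by (rule absolutely_integrable_continuous_real)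
  then show "(LINT \<tau>:{0..t}|lebesgue. f \<tau>) = integral {0..t} f"
    by (rule set_lebesgue_integral_eq_integral)
qed

text \<open>Sum and integral are exchanged under the majorant \<open>12 * C * (1/5) ^ n\<close>,
  where 12 bounds the modes.\<close>

lemma integral_usym:
  fixes f :: "real \<Rightarrow> nat \<Rightarrow> real"
  assumes cont: "\<And>n. continuous_on {0..t} (\<lambda>\<tau>. f \<tau> n)"
    and bd: "\<And>\<tau> n. \<tau> \<in> {0..t} \<Longrightarrow> \<bar>f \<tau> n\<bar> \<le> C * (1/5) ^ n" and t: "0 \<le> t"
  shows "(LINT \<tau>:{0..t}|lebesgue. usym (f \<tau>) x) = usym (\<lambda>n. integral {0..t} (\<lambda>\<tau>. f \<tau> n)) x"
proof -
  let ?F = "\<lambda>n \<tau>. indicat_real {0..t} \<tau> *\<^sub>R (f \<tau> n *\<^sub>R mode n x)"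
  have i1: "set_integrable lebesgue {0..t} (\<lambda>\<tau>. f \<tau> n *\<^sub>R mode n x)" for n
    by (rule integrable_continuous_Icc(1)) (intro continuous_intros cont)
  then have i: "integrable lebesgue (?F n)" for n
    by (simp add: set_integrable_def)
  have F_le: "norm (?F n \<tau>) \<le> indicat_real {0..t} \<tau> * (12 * C * (1/5) ^ n)" for n \<tau>
  proof (cases "\<tau> \<in> {0..t}")
    case True
    have "\<bar>f \<tau> n\<bar> * norm (mode n x) \<le> (C * (1/5) ^ n) * 12"
      by (intro mult_mono bd True norm_mode_le) (use bd[OF True, of n] in auto)
    then show ?thesis using True by (simp add: mult_ac)
  qed simp
  have geo: "summable (\<lambda>n. c * (1/5) ^ n :: real)" for c
    by (intro summable_mult summable_geometric) simp
  have comp: "(LINT \<tau>|lebesgue. ?F n \<tau>) = integral {0..t} (\<lambda>\<tau>. f \<tau> n) *\<^sub>R mode n x" for n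
  proof -
    have "(LINT \<tau>|lebesgue. ?F n \<tau>) = integral {0..t} (\<lambda>\<tau>. f \<tau> n *\<^sub>R mode n x)"
      using integrable_continuous_Icc(2)[of t "\<lambda>\<tau>. f \<tau> n *\<^sub>R mode n x"] cont
      by (simp add: set_lebesgue_integral_def continuous_intros)
    also have "\<dots> = integral {0..t} (\<lambda>\<tau>. f \<tau> n) *\<^sub>R mode n x"
      by (rule integral_unique, rule has_integral_scaleR_left, rule integrable_integral,
        rule integrable_continuous_interval[OF cont])
    finally show ?thesis .
  qed
  have "(LINT \<tau>:{0..t}|lebesgue. usym (f \<tau>) x) = (LINT \<tau>|lebesgue. (\<Sum>n. ?F n \<tau>))"
    unfolding set_lebesgue_integral_def usym_def
    by (rule Bochner_Integration.integral_cong) (auto simp: indicator_def)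
  also have "\<dots> = (\<Sum>n. LINT \<tau>|lebesgue. ?F n \<tau>)"
  proof (rule integral_suminf[OF i])
    show "AE \<tau> in lebesgue. summable (\<lambda>n. norm (?F n \<tau>))"
    proof (rule AE_I2)
      fix \<tau>
      show "summable (\<lambda>n. norm (?F n \<tau>))"
        by (rule summable_comparison_test'[OF geo[of "indicat_real {0..t} \<tau> * (12 * C)"]])
          (use F_le in \<open>simp add: mult.assoc\<close>)
    qed
    show "summable (\<lambda>n. LINT \<tau>|lebesgue. norm (?F n \<tau>))"
    proof (rule summable_comparison_test'[OF geo[of "t * (12 * C)"]])
      fix n
      have ic: "integrable lebesgue (\<lambda>\<tau>. indicat_real {0..t} \<tau> * (12 * C * (1/5) ^ n))"
        using integrable_continuous_Icc(1)[of t "\<lambda>\<tau>. 12 * C * (1/5) ^ n"] by (simp add: set_integrable_def)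
      have "(LINT \<tau>|lebesgue. norm (?F n \<tau>)) \<le> (LINT \<tau>|lebesgue. indicat_real {0..t} \<tau> * (12 * C * (1/5) ^ n))"
        by (rule integral_mono[OF integrable_norm[OF i] ic F_le])
      also have "\<dots> = (LINT \<tau>:{0..t}|lebesgue. 12 * C * (1/5) ^ n)"
        by (simp add: set_lebesgue_integral_def)
      also have "\<dots> = t * (12 * C) * (1/5) ^ n"
        using t by (subst integrable_continuous_Icc) auto
      finally show "norm (LINT \<tau>|lebesgue. norm (?F n \<tau>)) \<le> t * (12 * C) * (1/5) ^ n"
        by simp
    qed
  qed
  also have "\<dots> = (\<Sum>n. integral {0..t} (\<lambda>\<tau>. f \<tau> n) *\<^sub>R mode n x)"
    by (rule suminf_cong) (rule comp)
  finally show ?thesis by (simp add: usym_def)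
qed

lemma Gs_continuous:
  assumes "\<And>n. continuous_on S (\<lambda>\<tau>. \<psi> \<tau> n)"
  shows "continuous_on S (\<lambda>\<tau>. Gs (\<psi> \<tau>) n)"
  unfolding Gs_def by (cases "n = 0") (auto intro!: continuous_intros assms)

lemma heat_le_1: "\<nu> \<ge> 0 \<Longrightarrow> t \<ge> 0 \<Longrightarrow> \<bar>exp (- \<nu> * t * dsp \<alpha> n)\<bar> \<le> 1"
  by (simp add: less_imp_le)

text \<open>The heat semigroup is diagonal on symmetric fields, and \<open>proj_convect\<close>
  expresses the nonlinearity by coefficients; pulling the decaying exponential out of the time
  integral gives the form with an integrating factor.\<close>

lemma duhamel_usym:
  assumes cont: "\<And>n. continuous_on {0..t} (\<lambda>\<tau>. \<psi> \<tau> n)"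
    and bd: "\<And>\<tau> n. \<tau> \<in> {0..t} \<Longrightarrow> \<bar>\<psi> \<tau> n\<bar> \<le> C * (1/5) ^ n" and t: "0 \<le> t" and \<nu>: "0 \<le> \<nu>"
  shows "heat_op \<nu> \<alpha> t (usym (\<psi> 0)) x
      - (LINT \<tau>:{0..t}|lebesgue. heat_op \<nu> \<alpha> (t - \<tau>) (proj_M (convect (usym (\<psi> \<tau>)))) x)
    = usym (\<lambda>n. exp (- (\<nu> * dsp \<alpha> n) * t) * (\<psi> 0 n + integral {0..t} (\<lambda>\<tau>. exp (\<nu> * dsp \<alpha> n * \<tau>) * Gs (\<psi> \<tau>) n))) x"
    (is "_ = usym ?R x")
    and "decay (\<lambda>n. exp (- (\<nu> * dsp \<alpha> n) * t) * (\<psi> 0 n + integral {0..t} (\<lambda>\<tau>. exp (\<nu> * dsp \<alpha> n * \<tau>) * Gs (\<psi> \<tau>) n)))"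
proof -
  let ?e = "\<lambda>\<tau> n. exp (- \<nu> * (t - \<tau>) * dsp \<alpha> n)"
  let ?K = "64 * pi * C\<^sup>2"
  have dec: "decay (\<psi> \<tau>)" if "\<tau> \<in> {0..t}" for \<tau>
    using bd[OF that] unfolding decay_def by blast
  have decG: "decay (\<lambda>n. - Gs (\<psi> \<tau>) n)" if "\<tau> \<in> {0..t}" for \<tau>
    by (intro decay_uminus decay_Gs dec that)
  have heat: "heat_op \<nu> \<alpha> (t - \<tau>) (proj_M (convect (usym (\<psi> \<tau>)))) x = usym (\<lambda>n. ?e \<tau> n * - Gs (\<psi> \<tau>) n) x"
    if "\<tau> \<in> {0..t}" for \<tau>
    using that \<nu> by (simp only: proj_convect[OF dec[OF that]]) (subst heat_usym[OF decG[OF that]], auto)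
  have bdG: "\<bar>?e \<tau> n * - Gs (\<psi> \<tau>) n\<bar> \<le> ?K * (1/5) ^ n" if \<tau>: "\<tau> \<in> {0..t}" for \<tau> n
  proof -
    have "\<bar>?e \<tau> n\<bar> * \<bar>Gs (\<psi> \<tau>) n\<bar> \<le> 1 * (?K * (1/5) ^ n)"
      by (intro mult_mono heat_le_1 Gs_bound bd) (use \<nu> \<tau> in auto)
    then show ?thesis by (simp add: abs_mult)
  qed
  have contG: "continuous_on {0..t} (\<lambda>\<tau>. ?e \<tau> n * - Gs (\<psi> \<tau>) n)" for n
    by (intro continuous_intros Gs_continuous cont)
  have "(LINT \<tau>:{0..t}|lebesgue. heat_op \<nu> \<alpha> (t - \<tau>) (proj_M (convect (usym (\<psi> \<tau>)))) x)
      = (LINT \<tau>:{0..t}|lebesgue. usym (\<lambda>n. ?e \<tau> n * - Gs (\<psi> \<tau>) n) x)"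
    by (rule set_lebesgue_integral_cong) (auto simp: heat)
  also have "\<dots> = usym (\<lambda>n. integral {0..t} (\<lambda>\<tau>. ?e \<tau> n * - Gs (\<psi> \<tau>) n)) x"
    by (rule integral_usym[OF contG bdG t])
  finally have I: "(LINT \<tau>:{0..t}|lebesgue. heat_op \<nu> \<alpha> (t - \<tau>) (proj_M (convect (usym (\<psi> \<tau>)))) x)
      = usym (\<lambda>n. integral {0..t} (\<lambda>\<tau>. ?e \<tau> n * - Gs (\<psi> \<tau>) n)) x" .
  have decI: "decay (\<lambda>n. integral {0..t} (\<lambda>\<tau>. ?e \<tau> n * - Gs (\<psi> \<tau>) n))"
    unfolding decay_def
  proof (intro exI allI)
    fix n
    have "norm (integral {0..t} (\<lambda>\<tau>. ?e \<tau> n * - Gs (\<psi> \<tau>) n)) \<le> (?K * (1/5) ^ n) * (t - 0)"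
      by (rule integral_bound[OF t contG]) (use bdG in auto)
    then show "\<bar>integral {0..t} (\<lambda>\<tau>. ?e \<tau> n * - Gs (\<psi> \<tau>) n)\<bar> \<le> (?K * t) * (1/5) ^ n"
      by (simp add: mult_ac)
  qed
  have d0: "decay (\<lambda>n. exp (- \<nu> * t * dsp \<alpha> n) * \<psi> 0 n)"
    by (rule decay_mult_le1[OF dec heat_le_1]) (use t \<nu> in auto)
  have R: "exp (- \<nu> * t * dsp \<alpha> n) * \<psi> 0 n - integral {0..t} (\<lambda>\<tau>. ?e \<tau> n * - Gs (\<psi> \<tau>) n) = ?R n" for n
  proof -
    have "?e \<tau> n * - Gs (\<psi> \<tau>) n = - exp (- (\<nu> * dsp \<alpha> n) * t) * (exp (\<nu> * dsp \<alpha> n * \<tau>) * Gs (\<psi> \<tau>) n)" for \<tau>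
      by (simp add: algebra_simps flip: exp_add)
    then have "integral {0..t} (\<lambda>\<tau>. ?e \<tau> n * - Gs (\<psi> \<tau>) n)
        = - exp (- (\<nu> * dsp \<alpha> n) * t) * integral {0..t} (\<lambda>\<tau>. exp (\<nu> * dsp \<alpha> n * \<tau>) * Gs (\<psi> \<tau>) n)"
      by (simp only: integral_mult_right)
    then show ?thesis by (simp add: algebra_simps)
  qed
  have h0: "heat_op \<nu> \<alpha> t (usym (\<psi> 0)) x = usym (\<lambda>n. exp (- \<nu> * t * dsp \<alpha> n) * \<psi> 0 n) x"
    by (subst heat_usym[OF dec]) (use t \<nu> in auto)
  show "heat_op \<nu> \<alpha> t (usym (\<psi> 0)) x
      - (LINT \<tau>:{0..t}|lebesgue. heat_op \<nu> \<alpha> (t - \<tau>) (proj_M (convect (usym (\<psi> \<tau>)))) x) = usym ?R x"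
    unfolding h0 I usym_diff[OF d0 decI] R ..
  show "decay ?R"
    using decay_diff[OF d0 decI] unfolding R .
qed

text \<open>Every point of the half-open time domain lies below a later one, so limits within the
  domain may be taken within a compact interval, where indefinite integrals can be
  differentiated.\<close>

lemma time_dom_extend:
  assumes "t \<in> time_dom T"
  obtains t' where "t < t'" "t' \<in> time_dom T" "at t within time_dom T = at t within {0..t'}"
proof -
  have "ereal t < T" using assms by (simp add: time_dom_def)
  then obtain t' where t': "ereal t < ereal t'" "ereal t' < T"
    using ereal_dense2 by blast
  then have dom: "t' \<in> time_dom T" using assms by (auto simp: time_dom_def)
  have "at t within time_dom T = at t within {0..t'}"
    by (rule at_within_nhd[of _ "{..<t'}"])
      (use t' time_dom_Icc[OF dom] in \<open>auto simp: time_dom_def\<close>)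
  with t' dom show thesis by (intro that) auto
qed

text \<open>Injectivity of \<open>usym\<close> turns the mild equation into a scalar Duhamel formula
  for each coefficient, whose right-hand side can be differentiated in time.\<close>

lemma nse_ode:
  assumes s: "s > 5/2" and \<nu>: "\<nu> \<ge> 0" and sol: "nse_solution \<nu> \<alpha> s T u"
    and sm: "\<And>t. t \<in> time_dom T \<Longrightarrow> summable (\<lambda>n. dsp s n * (\<psi> t n)\<^sup>2)"
    and u: "\<And>t. t \<in> time_dom T \<Longrightarrow> u t = usym (\<psi> t)"
    and t: "t \<in> time_dom T"
  shows "((\<lambda>\<tau>. \<psi> \<tau> n) has_real_derivative (Gs (\<psi> t) n - \<nu> * dsp \<alpha> n * \<psi> t n)) (at t within time_dom T)"
proof -
  have path: "cont_path s T u" using sol by (simp add: nse_solution_def)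
  have cont: "continuous_on (time_dom T) (\<lambda>t. \<psi> t n)" for n
    by (rule path_coeff_continuous[OF s path sm u])
  have bdd: "\<exists>C. \<forall>\<tau>\<in>{0..t}. \<forall>n. \<bar>\<psi> \<tau> n\<bar> \<le> C * (1/5) ^ n" if "t \<in> time_dom T" for t
    by (rule path_bounded[OF s path sm u that])
  note dec = decay_of_summable[OF s sm]
  define D where "D = \<nu> * dsp \<alpha> n"
  let ?I = "\<lambda>t. \<psi> 0 n + integral {0..t} (\<lambda>\<tau>. exp (D * \<tau>) * Gs (\<psi> \<tau>) n)"
  have cont': "continuous_on {0..t} (\<lambda>\<tau>. \<psi> \<tau> m)" if "t \<in> time_dom T" for t m
    using cont time_dom_Icc[OF that] by (rule continuous_on_subset)
  have mild: "\<psi> t n = exp (- D * t) * ?I t" if t: "t \<in> time_dom T" for t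
  proof -
    obtain C where C: "\<And>\<tau> n. \<tau> \<in> {0..t} \<Longrightarrow> \<bar>\<psi> \<tau> n\<bar> \<le> C * (1/5) ^ n"
      using bdd[OF t] by blast
    have t0: "0 \<le> t" using t by (rule time_dom_nonneg)
    have 0: "0 \<in> time_dom T" using time_dom_Icc[OF t] t0 by auto
    let ?R = "\<lambda>n. exp (- (\<nu> * dsp \<alpha> n) * t) * (\<psi> 0 n + integral {0..t} (\<lambda>\<tau>. exp (\<nu> * dsp \<alpha> n * \<tau>) * Gs (\<psi> \<tau>) n))"
    have "usym (\<psi> t) = usym ?R"
    proof
      fix x
      have "u t x = heat_op \<nu> \<alpha> t (u 0) x - (LINT \<tau>:{0..t}|lebesgue. heat_op \<nu> \<alpha> (t - \<tau>) (proj_M (convect (u \<tau>))) x)"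
        using sol t by (simp add: nse_solution_def)
      also have "(LINT \<tau>:{0..t}|lebesgue. heat_op \<nu> \<alpha> (t - \<tau>) (proj_M (convect (u \<tau>))) x)
          = (LINT \<tau>:{0..t}|lebesgue. heat_op \<nu> \<alpha> (t - \<tau>) (proj_M (convect (usym (\<psi> \<tau>)))) x)"
        by (rule set_lebesgue_integral_cong) (use u time_dom_Icc[OF t] in auto)
      also have "heat_op \<nu> \<alpha> t (u 0) x - \<dots> = usym ?R x"
        unfolding u[OF 0] by (rule duhamel_usym(1)[OF cont'[OF t] C t0 \<nu>])
      finally show "usym (\<psi> t) x = usym ?R x" by (simp add: u[OF t])
    qed
    moreover have "decay ?R"
      by (rule duhamel_usym(2)[OF cont'[OF t] C t0 \<nu>])
    ultimately have "\<psi> t = ?R"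
      using usym_inject[OF dec[OF t]] by blast
    then show ?thesis unfolding D_def by (rule fun_cong)
  qed
  obtain t' where t': "t < t'" "t' \<in> time_dom T" "at t within time_dom T = at t within {0..t'}"
    using time_dom_extend[OF t] by blast
  have tt: "t \<in> {0..t'}" using t' time_dom_nonneg[OF t] by auto
  have cg: "continuous_on {0..t'} (\<lambda>\<tau>. exp (D * \<tau>) * Gs (\<psi> \<tau>) n)"
    by (intro continuous_intros Gs_continuous cont' t')
  have I: "(?I has_real_derivative (exp (D * t) * Gs (\<psi> t) n)) (at t within {0..t'})"
    using integral_has_real_derivative[OF cg tt] by (auto intro!: derivative_eq_intros)
  have "((\<lambda>t. exp (- D * t) * ?I t) has_real_derivative
      (- D * exp (- D * t) * ?I t + (exp (D * t) * Gs (\<psi> t) n) * exp (- D * t))) (at t within {0..t'})"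
    by (intro DERIV_mult I) (auto intro!: derivative_eq_intros)
  moreover have "- D * exp (- D * t) * ?I t + (exp (D * t) * Gs (\<psi> t) n) * exp (- D * t) = Gs (\<psi> t) n - D * \<psi> t n"
    unfolding mild[OF t] by (simp add: exp_minus)
  ultimately have "((\<lambda>t. exp (- D * t) * ?I t) has_real_derivative (Gs (\<psi> t) n - D * \<psi> t n)) (at t within {0..t'})"
    by simp
  then have "((\<lambda>\<tau>. \<psi> \<tau> n) has_real_derivative (Gs (\<psi> t) n - D * \<psi> t n)) (at t within {0..t'})"
  proof (rule has_field_derivative_transform_within[where d = 1])
    show "exp (- D * x) * ?I x = \<psi> x n" if "x \<in> {0..t'}" for x
      by (rule mild [symmetric]) (use that time_dom_Icc[OF t'(2)] in blast)
  qed (use tt in auto)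
  then show ?thesis by (simp add: D_def t')
qed

subsection \<open>Solutions from coefficients\<close>

context
  fixes s T1 K :: real and \<Psi> :: "real \<Rightarrow> nat \<Rightarrow> real" and E :: "nat \<Rightarrow> real"
  assumes s: "s > 5/2" and E: "summable (\<lambda>n. dsp s n * (E n)\<^sup>2)"
    and bd: "\<And>t n. t \<in> {0..T1} \<Longrightarrow> \<bar>\<Psi> t n\<bar> \<le> E n"
    and bdG: "\<And>t n. t \<in> {0..T1} \<Longrightarrow> \<bar>Gs (\<Psi> t) n\<bar> \<le> K * E n"
begin

lemma dom_Icc: "t \<in> time_dom (ereal T1) \<Longrightarrow> t \<in> {0..T1}"
  by (auto simp: time_dom_def)

lemma coeff_summable: "t \<in> {0..T1} \<Longrightarrow> summable (\<lambda>n. dsp s n * (\<Psi> t n)\<^sup>2)"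
  by (rule summable_dsp_dominated[OF E, of _ 1]) (simp add: bd)

lemma coeff_decay: "t \<in> {0..T1} \<Longrightarrow> decay (\<Psi> t)"
  by (rule decay_of_summable[OF s coeff_summable])

text \<open>By the mean value inequality the difference quotients are bounded by
  \<open>K * E n\<close>; this common majorant upgrades coefficientwise derivatives to a derivative
  in norm.\<close>

lemma euler_from_coeffs:
  assumes ode: "\<And>t n. t \<in> {0..T1} \<Longrightarrow>
      ((\<lambda>t. \<Psi> t n) has_real_derivative Gs (\<Psi> t) n) (at t within {0..T1})"
  shows "euler_solution s (ereal T1) (\<lambda>t. usym (\<Psi> t))"
  unfolding euler_solution_def
proof (intro conjI exI ballI allI)
  have c: "continuous_on {0..T1} (\<lambda>t. \<Psi> t n)" for n
    using ode by (rule DERIV_continuous_on)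
  have c': "continuous_on (time_dom (ereal T1)) (\<lambda>t. \<Psi> t n)" for n
    by (rule continuous_on_subset[OF c]) (use dom_Icc in auto)
  show "cont_path s (ereal T1) (\<lambda>t. usym (\<Psi> t))"
    by (rule cont_path_usym[OF s E, where C = 1]) (use bd dom_Icc c' in auto)
  show "cont_path s (ereal T1) (\<lambda>t. usym (Gs (\<Psi> t)))"
    by (rule cont_path_usym[OF s E bdG[OF dom_Icc] Gs_continuous[OF c']])
  fix t assume t: "t \<in> time_dom (ereal T1)"
  note t1 = dom_Icc[OF t]
  show "usym (Gs (\<Psi> t)) x + proj_M (convect (usym (\<Psi> t))) x = 0" for x
    using usym_lincomb[of "Gs (\<Psi> t)" "Gs (\<Psi> t)" "-1" x 0] decay_Gs[OF coeff_decay[OF t1]]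
    by (simp add: proj_convect[OF coeff_decay[OF t1]] add_eq_0_iff)
  let ?q = "\<lambda>\<tau> n. 1 * ((1 / (\<tau> - t)) * \<Psi> \<tau> n + - (1 / (\<tau> - t)) * \<Psi> t n) + - 1 * Gs (\<Psi> t) n"
  have q_eq: "?q \<tau> n = (\<Psi> \<tau> n - \<Psi> t n) / (\<tau> - t) - Gs (\<Psi> t) n" for \<tau> n
    by (simp add: diff_divide_distrib)
  have lim: "((\<lambda>\<tau>. Hdot_norm s (usym (?q \<tau>))) \<longlongrightarrow> 0) (at t within time_dom (ereal T1))"
  proof (rule Hdot_norm_tendsto_zero[OF s E, where C = "2 * K"])
    show "\<forall>\<^sub>F \<tau> in at t within time_dom (ereal T1). \<forall>n. \<bar>?q \<tau> n\<bar> \<le> 2 * K * E n"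
      unfolding eventually_at_filter
    proof (intro always_eventually allI impI)
      fix \<tau> n assume \<tau>: "\<tau> \<noteq> t" "\<tau> \<in> time_dom (ereal T1)"
      have "norm (\<Psi> \<tau> n - \<Psi> t n) \<le> (K * E n) * norm (\<tau> - t)"
        by (rule field_differentiable_bound[of "{0..T1}" _ "\<lambda>t. Gs (\<Psi> t) n"])
          (use ode bdG dom_Icc[OF \<tau>(2)] t1 in auto)
      then have "\<bar>(\<Psi> \<tau> n - \<Psi> t n) / (\<tau> - t)\<bar> \<le> K * E n"
        using \<tau> by (simp add: divide_le_eq)
      then show "\<bar>?q \<tau> n\<bar> \<le> 2 * K * E n"
        unfolding q_eq using bdG[OF t1, of n] abs_triangle_ineq4[of "(\<Psi> \<tau> n - \<Psi> t n) / (\<tau> - t)" "Gs (\<Psi> t) n"] by linarith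
    qed
    fix n
    have "((\<lambda>t. \<Psi> t n) has_real_derivative Gs (\<Psi> t) n) (at t within time_dom (ereal T1))"
      using ode[OF t1] by (rule has_field_derivative_subset) (use dom_Icc in auto)
    then show "((\<lambda>\<tau>. ?q \<tau> n) \<longlongrightarrow> 0) (at t within time_dom (ereal T1))"
      unfolding q_eq has_field_derivative_iff by (rule LIM_zero)
  qed
  have q: "(\<lambda>x. (1 / (\<tau> - t)) *\<^sub>R (usym (\<Psi> \<tau>) x - usym (\<Psi> t) x) - usym (Gs (\<Psi> t)) x) = usym (?q \<tau>)"
    if \<tau>: "\<tau> \<in> time_dom (ereal T1)" for \<tau>
  proof
    fix x
    note d\<tau> = coeff_decay[OF dom_Icc[OF \<tau>]]
    have "(1 / (\<tau> - t)) *\<^sub>R (usym (\<Psi> \<tau>) x - usym (\<Psi> t) x) - usym (Gs (\<Psi> t)) x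
        = 1 *\<^sub>R ((1 / (\<tau> - t)) *\<^sub>R usym (\<Psi> \<tau>) x + (- (1 / (\<tau> - t))) *\<^sub>R usym (\<Psi> t) x) + (- 1) *\<^sub>R usym (Gs (\<Psi> t)) x"
      by (simp add: scaleR_diff_right)
    also have "\<dots> = usym (?q \<tau>) x"
      by (simp only: usym_lincomb[OF d\<tau> coeff_decay[OF t1]]
        usym_lincomb[OF decay_lincomb[OF d\<tau> coeff_decay[OF t1]] decay_Gs[OF coeff_decay[OF t1]]])
    finally show "(1 / (\<tau> - t)) *\<^sub>R (usym (\<Psi> \<tau>) x - usym (\<Psi> t) x) - usym (Gs (\<Psi> t)) x = usym (?q \<tau>) x" .
  qed
  show "((\<lambda>\<tau>. Hdot_norm s (\<lambda>x. (1 / (\<tau> - t)) *\<^sub>R (usym (\<Psi> \<tau>) x - usym (\<Psi> t) x) - usym (Gs (\<Psi> t)) x)) \<longlongrightarrow> 0)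
      (at t within time_dom (ereal T1))"
    by (rule Lim_transform_eventually[OF lim]) (simp add: eventually_at_filter q always_eventually)
qed

text \<open>Variation of constants: the growing exponential times a coefficient has that exponential
  times \<open>Gs\<close> as its derivative, and integration gives the scalar Duhamel
  formula.\<close>

lemma nse_from_coeffs:
  assumes \<nu>: "\<nu> \<ge> 0" and ode: "\<And>t n. t \<in> {0..T1} \<Longrightarrow>
      ((\<lambda>t. \<Psi> t n) has_real_derivative (Gs (\<Psi> t) n - \<nu> * dsp \<alpha> n * \<Psi> t n)) (at t within {0..T1})"
  shows "nse_solution \<nu> \<alpha> s (ereal T1) (\<lambda>t. usym (\<Psi> t))"
  unfolding nse_solution_def
proof (intro conjI ballI allI)
  have c: "continuous_on {0..T1} (\<lambda>t. \<Psi> t n)" for n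
    using ode by (rule DERIV_continuous_on)
  have c': "continuous_on (time_dom (ereal T1)) (\<lambda>t. \<Psi> t n)" for n
    by (rule continuous_on_subset[OF c]) (use dom_Icc in auto)
  show "cont_path s (ereal T1) (\<lambda>t. usym (\<Psi> t))"
    by (rule cont_path_usym[OF s E, where C = 1]) (use bd dom_Icc c' in auto)
  fix t x assume t: "t \<in> time_dom (ereal T1)"
  have t0: "0 \<le> t" and sub: "{0..t} \<subseteq> {0..T1}" using dom_Icc[OF t] by auto
  have ct: "continuous_on {0..t} (\<lambda>t. \<Psi> t n)" for n
    using c sub by (rule continuous_on_subset)
  let ?C = "sqrt (\<Sum>n. dsp s n * (E n)\<^sup>2)"
  have C: "\<bar>\<Psi> \<tau> n\<bar> \<le> ?C * (1/5) ^ n" if "\<tau> \<in> {0..t}" for \<tau> n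
    using bound_of_summable[OF s E, of n] bd[of \<tau> n] sub that by auto
  have "\<Psi> t n = exp (- (\<nu> * dsp \<alpha> n) * t) * (\<Psi> 0 n + integral {0..t} (\<lambda>\<tau>. exp (\<nu> * dsp \<alpha> n * \<tau>) * Gs (\<Psi> \<tau>) n))" for n
  proof -
    let ?D = "\<nu> * dsp \<alpha> n"
    have "((\<lambda>\<tau>. exp (?D * \<tau>) * Gs (\<Psi> \<tau>) n) has_integral (exp (?D * t) * \<Psi> t n - exp (?D * 0) * \<Psi> 0 n)) {0..t}"
    proof (rule fundamental_theorem_of_calculus[OF t0])
      fix \<tau> assume \<tau>: "\<tau> \<in> {0..t}"
      have o: "((\<lambda>t. \<Psi> t n) has_real_derivative (Gs (\<Psi> \<tau>) n - ?D * \<Psi> \<tau> n)) (at \<tau> within {0..t})"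
        using ode[of \<tau> n] sub \<tau> by (blast intro: has_field_derivative_subset)
      have "((\<lambda>\<tau>. exp (?D * \<tau>) * \<Psi> \<tau> n) has_real_derivative
          (?D * exp (?D * \<tau>) * \<Psi> \<tau> n + (Gs (\<Psi> \<tau>) n - ?D * \<Psi> \<tau> n) * exp (?D * \<tau>))) (at \<tau> within {0..t})"
        by (intro DERIV_mult o) (auto intro!: derivative_eq_intros)
      then show "((\<lambda>\<tau>. exp (?D * \<tau>) * \<Psi> \<tau> n) has_vector_derivative exp (?D * \<tau>) * Gs (\<Psi> \<tau>) n) (at \<tau> within {0..t})"
        by (simp add: has_real_derivative_iff_has_vector_derivative algebra_simps)
    qed
    then have "integral {0..t} (\<lambda>\<tau>. exp (?D * \<tau>) * Gs (\<Psi> \<tau>) n) = exp (?D * t) * \<Psi> t n - \<Psi> 0 n"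
      by (simp add: integral_unique)
    then show ?thesis
      by (simp add: exp_minus)
  qed
  then have eq: "\<Psi> t = (\<lambda>n. exp (- (\<nu> * dsp \<alpha> n) * t) * (\<Psi> 0 n + integral {0..t} (\<lambda>\<tau>. exp (\<nu> * dsp \<alpha> n * \<tau>) * Gs (\<Psi> \<tau>) n)))"
    by (rule ext)
  have "heat_op \<nu> \<alpha> t (usym (\<Psi> 0)) x
      - (LINT \<tau>:{0..t}|lebesgue. heat_op \<nu> \<alpha> (t - \<tau>) (proj_M (convect (usym (\<Psi> \<tau>)))) x)
    = usym (\<lambda>n. exp (- (\<nu> * dsp \<alpha> n) * t) * (\<Psi> 0 n + integral {0..t} (\<lambda>\<tau>. exp (\<nu> * dsp \<alpha> n * \<tau>) * Gs (\<Psi> \<tau>) n))) x"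
    by (rule duhamel_usym(1)[OF ct C t0 \<nu>])
  then show "usym (\<Psi> t) x = heat_op \<nu> \<alpha> t (usym (\<Psi> 0)) x
      - (LINT \<tau>:{0..t}|lebesgue. heat_op \<nu> \<alpha> (t - \<tau>) (proj_M (convect (usym (\<Psi> \<tau>)))) x)"
    unfolding eq [symmetric] by (rule sym)
qed

end

section \<open>The gradient at the origin and the main theorem\<close>

lemma dmode_0: "dmode n 0 h = - (12 * pi * 2 ^ n * Pn n) *\<^sub>R ((sigma \<bullet> h) *\<^sub>R sigma - h)"
  by (simp add: dmode_def sum_vdir_tensor)

lemma gradient_matrix_mult:
  "(l *\<^sub>R vector [vector [0, -1, -1], vector [-1, 0, -1], vector [-1, -1, 0]] :: real^3^3) *v h
    = - l *\<^sub>R ((sigma \<bullet> h) *\<^sub>R sigma - h)"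
  by (rule vec3_eqI) (simp_all add: matrix_vector_mult_def sum_3 inner_3 algebra_simps)

lemma usym_gradient_0:
  assumes "decay \<psi>"
  shows "(usym \<psi> has_derivative
    (\<lambda>h. (lamf \<psi> *\<^sub>R vector [vector [0, -1, -1], vector [-1, 0, -1], vector [-1, -1, 0]] :: real^3^3) *v h)) (at 0)"
proof -
  have "dusym \<psi> 0 h = - lamf \<psi> *\<^sub>R ((sigma \<bullet> h) *\<^sub>R sigma - h)" for h
  proof -
    have "(\<lambda>n. (12 * pi * 2 ^ n * Pn n * \<psi> n) *\<^sub>R - ((sigma \<bullet> h) *\<^sub>R sigma - h)) sums (lamf \<psi> *\<^sub>R - ((sigma \<bullet> h) *\<^sub>R sigma - h))"
      unfolding lamf_def by (intro sums_scaleR_left summable_sums summable_lamf assms)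
    then show ?thesis
      by (simp add: dusym_def dmode_0 sums_iff mult_ac scaleR_diff_right)
  qed
  then have "dusym \<psi> 0 = (\<lambda>h. - lamf \<psi> *\<^sub>R ((sigma \<bullet> h) *\<^sub>R sigma - h))"
    by (rule ext)
  then show ?thesis
    using usym_has_derivative[OF assms, of 0] by (simp only: gradient_matrix_mult)
qed

text \<open>Brings the factor of \<open>lamf\<close> into the form of the statement by taking
  \<open>3 * 4 ^ n\<close> out of \<open>Kn n\<close>.\<close>

lemma shell_weight: "2 ^ n * Pn n = sqrt 2 * (sqrt 3 ^ n / sqrt (1 + 2/3 * (3/4) ^ n))"
proof -
  have "Kn n = 3 * (4 ^ n * (1 + 2/3 * (3/4) ^ n))"
    by (simp add: Kn_def distrib_left power_divide)
  then have "6 * 3 ^ n / Kn n = 2 * 3 ^ n / (4 ^ n * (1 + 2/3 * (3/4) ^ n))"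
    by simp
  then have "Pn n = sqrt 2 * sqrt 3 ^ n / (sqrt 4 ^ n * sqrt (1 + 2/3 * (3/4) ^ n))"
    unfolding Pn_def by (simp only: real_sqrt_divide real_sqrt_mult real_sqrt_power)
  then show ?thesis by simp
qed

lemma lamf_eq:
  assumes "decay \<psi>"
  shows "summable (\<lambda>n. \<psi> n * (sqrt 3 ^ n / sqrt (1 + 2/3 * (3/4) ^ n)))"
    and "lamf \<psi> = 12 * sqrt 2 * pi * (\<Sum>n. \<psi> n * (sqrt 3 ^ n / sqrt (1 + 2/3 * (3/4) ^ n)))"
proof -
  let ?w = "\<lambda>n. \<psi> n * (sqrt 3 ^ n / sqrt (1 + 2/3 * (3/4) ^ n))"
  have eq: "12 * pi * 2 ^ n * Pn n * \<psi> n = 12 * sqrt 2 * pi * ?w n" for n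
  proof -
    have "12 * pi * 2 ^ n * Pn n * \<psi> n = 12 * pi * \<psi> n * (2 ^ n * Pn n)" by simp
    then show ?thesis unfolding shell_weight by simp
  qed
  have "summable (\<lambda>n. 12 * sqrt 2 * pi * ?w n)"
    using summable_lamf[OF assms] unfolding eq .
  then show sm: "summable ?w"
    by (subst (asm) summable_cmult_iff) simp
  show "lamf \<psi> = 12 * sqrt 2 * pi * (\<Sum>n. ?w n)"
    unfolding lamf_def eq by (rule suminf_mult[OF sm])
qed

lemma sqrt3_powr: "sqrt 3 powr (2 * 1 * real n) = 3 ^ n"
proof -
  have "sqrt 3 powr (2 * 1 * real n) = (sqrt 3 powr 2) powr real n"
    by (simp only: powr_powr mult_1_right)
  also have "sqrt 3 powr 2 = 3" by (simp add: powr_numeral)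
  finally show ?thesis by (simp add: powr_realpow)
qed

lemma decay_H1:
  assumes "decay \<psi>"
  shows "seq_norm_summable 1 \<psi>" "(seq_norm 1 \<psi>)\<^sup>2 = (\<Sum>n. 3 ^ n * (\<psi> n)\<^sup>2)" "summable (\<lambda>n. 3 ^ n * (\<psi> n)\<^sup>2)"
proof -
  obtain C where C: "\<And>n. \<bar>\<psi> n\<bar> \<le> C * (1/5) ^ n" using assms by (auto simp: decay_def)
  show sm: "summable (\<lambda>n. 3 ^ n * (\<psi> n)\<^sup>2)"
  proof (rule summable_comparison_test')
    show "summable (\<lambda>n. C\<^sup>2 * (3/25) ^ n :: real)" by (intro summable_mult summable_geometric) simp
    fix n
    have "(\<psi> n)\<^sup>2 \<le> (C * (1/5) ^ n)\<^sup>2" using power_mono[OF C[of n], of 2] by simp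
    also have "\<dots> = C\<^sup>2 * (1/25) ^ n"
      by (simp add: power_mult_distrib power_mult [symmetric] mult.commute[of n]) (simp add: power_mult power_divide)
    finally have "3 ^ n * (\<psi> n)\<^sup>2 \<le> 3 ^ n * (C\<^sup>2 * (1/25) ^ n)" by (intro mult_left_mono) auto
    then show "norm (3 ^ n * (\<psi> n)\<^sup>2) \<le> C\<^sup>2 * (3/25) ^ n" by (simp add: power_divide mult_ac)
  qed
  then show "seq_norm_summable 1 \<psi>" by (simp only: seq_norm_summable_def sqrt3_powr)
  have "(\<Sum>n. 3 ^ n * (\<psi> n)\<^sup>2) \<ge> 0" by (intro suminf_nonneg sm) simp
  then show "(seq_norm 1 \<psi>)\<^sup>2 = (\<Sum>n. 3 ^ n * (\<psi> n)\<^sup>2)"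
    by (simp only: seq_norm_def sqrt3_powr) simp
qed

section \<open>Energy inequality and blow-up integral in the stated form\<close>

context shell_model
begin

text \<open>The truncated bound passes to the limit with rate 1/3, which is at most
  \<open>sqrt 5 / (3 * sqrt 3)\<close> because 3 \<le> 5; as \<open>Lam t\<close> is nonnegative,
  the larger rate only weakens the bound.\<close>

lemma energy_inequality:
  assumes t: "t \<in> time_dom T"
  shows "(seq_norm 1 (\<psi> t))\<^sup>2 \<le> (seq_norm 1 (\<psi> 0))\<^sup>2 * exp (sqrt 5 / (3 * sqrt 3) * Lam t)"
proof -
  have "0 \<in> time_dom T" using time_dom_Icc[OF t] time_dom_nonneg[OF t] by auto
  note d0 = decay_\<psi>[OF this] and dt = decay_\<psi>[OF t]
  have "(\<Sum>n. 3 ^ n * (\<psi> t n)\<^sup>2) \<le> (\<Sum>n. 3 ^ n * (\<psi> 0 n)\<^sup>2) * exp (Lam t / 3)"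
  proof (rule suminf_le_const[OF decay_H1(3)[OF dt]])
    fix N
    have "(\<Sum>n<N. 3 ^ n * (\<psi> 0 n)\<^sup>2) \<le> (\<Sum>n. 3 ^ n * (\<psi> 0 n)\<^sup>2)"
      by (rule sum_le_suminf[OF decay_H1(3)[OF d0]]) auto
    then have "(\<Sum>n<N. 3 ^ n * (\<psi> 0 n)\<^sup>2) * exp (Lam t / 3) \<le> (\<Sum>n. 3 ^ n * (\<psi> 0 n)\<^sup>2) * exp (Lam t / 3)"
      by (intro mult_right_mono) auto
    then show "(\<Sum>n<N. 3 ^ n * (\<psi> t n)\<^sup>2) \<le> (\<Sum>n. 3 ^ n * (\<psi> 0 n)\<^sup>2) * exp (Lam t / 3)"
      using energy_partial[OF t, of N] by linarith
  qed
  also have "\<dots> \<le> (\<Sum>n. 3 ^ n * (\<psi> 0 n)\<^sup>2) * exp (sqrt 5 / (3 * sqrt 3) * Lam t)"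
  proof -
    have "sqrt 3 \<le> sqrt (5::real)" by simp
    then have "1 / 3 \<le> sqrt 5 / (3 * sqrt (3::real))" by (simp add: field_simps)
    then have "1 / 3 * Lam t \<le> sqrt 5 / (3 * sqrt 3) * Lam t"
      by (rule mult_right_mono) (rule Lam_nonneg[OF t])
    moreover have "(\<Sum>n. 3 ^ n * (\<psi> 0 n)\<^sup>2) \<ge> 0"
      by (intro suminf_nonneg decay_H1(3)[OF d0]) simp
    ultimately show ?thesis by (intro mult_left_mono) auto
  qed
  finally show ?thesis by (simp only: decay_H1(2)[OF d0] decay_H1(2)[OF dt])
qed

text \<open>If the integral over the whole time domain is finite, it bounds all \<open>Lam t\<close>
  at once, which is the hypothesis on \<open>L\<close> in \<open>extension\<close>.\<close>

lemma nn_integral_Lam: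
  assumes t: "t \<in> time_dom T"
  shows "ennreal (Lam t) \<le> (\<integral>\<^sup>+ \<tau> \<in> time_dom T. ennreal (lamf (\<psi> \<tau>)) \<partial>lebesgue)"
proof -
  note si = integrable_continuous_Icc[OF lam_cont[OF t]]
  have nn: "0 \<le> indicat_real {0..t} \<tau> *\<^sub>R lamf (\<psi> \<tau>)" for \<tau>
    using lam_nonneg time_dom_Icc[OF t] by (auto simp: indicator_def)
  have "ennreal (Lam t) = ennreal (LINT \<tau>|lebesgue. indicat_real {0..t} \<tau> *\<^sub>R lamf (\<psi> \<tau>))"
    using si(2) by (simp add: Lam_def set_lebesgue_integral_def)
  also have "\<dots> = (\<integral>\<^sup>+ \<tau>. ennreal (indicat_real {0..t} \<tau> *\<^sub>R lamf (\<psi> \<tau>)) \<partial>lebesgue)"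
    by (rule nn_integral_eq_integral[symmetric]) (use si(1) nn in \<open>auto simp: set_integrable_def\<close>)
  also have "\<dots> \<le> (\<integral>\<^sup>+ \<tau> \<in> time_dom T. ennreal (lamf (\<psi> \<tau>)) \<partial>lebesgue)"
    by (rule nn_integral_mono) (use time_dom_Icc[OF t] in \<open>auto simp: indicator_def\<close>)
  finally show ?thesis .
qed

end

text \<open>The two equations only differ in the damping \<open>d\<close>, so \<open>sol\<close> stands for either notion of solution.\<close>

lemma shell_solution_properties:
  assumes s: "s > 5/2" and max: "maximal_solution sol T u"
    and sym: "\<And>t. t \<in> time_dom T \<Longrightarrow> odd_field (u t) \<and> permutation_symmetric (u t) \<and> mirror_symmetric (u t)"
    and psi: "\<And>t. \<psi> t = sym_coeffs (u t)"
    and lam: "\<And>t. lam t = 12 * sqrt 2 * pi * (\<Sum>n. \<psi> t n * (sqrt 3 ^ n / sqrt (1 + 2/3 * (3/4) ^ n)))"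
    and nonneg: "\<And>n. \<psi> 0 n \<ge> 0"
    and d: "\<And>n. d n \<ge> 0" and path: "cont_path s T u"
    and ode: "\<And>t n. (\<And>t. t \<in> time_dom T \<Longrightarrow> summable (\<lambda>n. dsp s n * (\<psi> t n)\<^sup>2)) \<Longrightarrow>
      (\<And>t. t \<in> time_dom T \<Longrightarrow> u t = usym (\<psi> t)) \<Longrightarrow> t \<in> time_dom T \<Longrightarrow>
      ((\<lambda>\<tau>. \<psi> \<tau> n) has_real_derivative (Gs (\<psi> t) n - d n * \<psi> t n)) (at t within time_dom T)"
    and solution: "\<And>(T1::real) \<Psi> E K. summable (\<lambda>n. dsp s n * (E n)\<^sup>2) \<Longrightarrow>
      (\<And>t n. t \<in> {0..T1} \<Longrightarrow> \<bar>\<Psi> t n\<bar> \<le> E n) \<Longrightarrow> (\<And>t n. t \<in> {0..T1} \<Longrightarrow> \<bar>Gs (\<Psi> t) n\<bar> \<le> K * E n) \<Longrightarrow>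
      (\<And>t n. t \<in> {0..T1} \<Longrightarrow>
        ((\<lambda>t. \<Psi> t n) has_real_derivative (Gs (\<Psi> t) n - d n * \<Psi> t n)) (at t within {0..T1})) \<Longrightarrow>
      sol (ereal T1) (\<lambda>t. usym (\<Psi> t))"
  shows "(\<forall>t\<in>time_dom T.
           (u t has_derivative
              (\<lambda>h. (lam t *\<^sub>R vector [vector [0, -1, -1], vector [-1, 0, -1], vector [-1, -1, 0]] :: real^3^3) *v h))
             (at 0)
           \<and> summable (\<lambda>n. \<psi> t n * (sqrt 3 ^ n / sqrt (1 + 2/3 * (3/4) ^ n)))
           \<and> lam t \<ge> 0)
       \<and> (\<forall>t\<in>time_dom T.
           seq_norm_summable 1 (\<psi> t)
           \<and> set_integrable lebesgue {0..t} lam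
           \<and> (seq_norm 1 (\<psi> t))\<^sup>2
               \<le> (seq_norm 1 (\<psi> 0))\<^sup>2 * exp (sqrt 5 / (3 * sqrt 3) * (LINT \<tau>:{0..t}|lebesgue. lam \<tau>)))
       \<and> (T < \<infinity> \<longrightarrow> (\<integral>\<^sup>+ \<tau> \<in> time_dom T. ennreal (lam \<tau>) \<partial>lebesgue) = \<infinity>)"
proof -
  have sm: "summable (\<lambda>n. dsp s n * (\<psi> t n)\<^sup>2)" if "t \<in> time_dom T" for t
    unfolding psi by (rule path_coeffs(1)[OF s path sym that])
  have u: "u t = usym (\<psi> t)" if "t \<in> time_dom T" for t
    unfolding psi by (rule path_coeffs(3)[OF s path sym that])
  have bounded: "\<exists>C. \<forall>\<tau>\<in>{0..t}. \<forall>n. \<bar>\<psi> \<tau> n\<bar> \<le> C * (1/5) ^ n" if "t \<in> time_dom T" for t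
    by (rule path_bounded[OF s path sm u that])
  interpret shell_model d T \<psi>
    by standard (use d bounded ode[OF sm u] nonneg in auto)
  have lam_eq: "lam t = lamf (\<psi> t)" if "t \<in> time_dom T" for t
    using lamf_eq(2)[OF decay_\<psi>[OF that]] by (simp add: lam)
  have T: "0 < T" using max by (simp add: maximal_solution_def)
  have "set_integrable lebesgue {0..t} lam \<and> (LINT \<tau>:{0..t}|lebesgue. lam \<tau>) = Lam t" if t: "t \<in> time_dom T" for t
  proof -
    have eq: "lam \<tau> = lamf (\<psi> \<tau>)" if "\<tau> \<in> {0..t}" for \<tau>
      using lam_eq time_dom_Icc[OF t] that by blast
    have c: "continuous_on {0..t} lam"
      using lam_cont[OF t] by (rule continuous_on_eq) (simp add: eq)
    have "integral {0..t} lam = Lam t"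
      unfolding Lam_def by (rule integral_cong) (simp add: eq)
    then show ?thesis using integrable_continuous_Icc[OF c] by simp
  qed
  note lam_int = this
  have blowup: "(\<integral>\<^sup>+ \<tau> \<in> time_dom T. ennreal (lam \<tau>) \<partial>lebesgue) = \<infinity>" if "T < \<infinity>"
  proof (rule ccontr)
    assume fin: "(\<integral>\<^sup>+ \<tau> \<in> time_dom T. ennreal (lam \<tau>) \<partial>lebesgue) \<noteq> \<infinity>"
    obtain T0 where T0: "T = ereal T0" "T0 > 0"
      using T \<open>T < \<infinity>\<close> by (cases T) auto
    have "(\<integral>\<^sup>+ \<tau> \<in> time_dom T. ennreal (lam \<tau>) \<partial>lebesgue) = (\<integral>\<^sup>+ \<tau> \<in> time_dom T. ennreal (lamf (\<psi> \<tau>)) \<partial>lebesgue)"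
      by (rule nn_integral_cong) (auto simp: indicator_def lam_eq)
    with fin obtain L where L: "L \<ge> 0" "(\<integral>\<^sup>+ \<tau> \<in> time_dom T. ennreal (lamf (\<psi> \<tau>)) \<partial>lebesgue) = ennreal L"
      by (metis ennreal_cases infinity_ennreal_def)
    have Lam: "Lam t \<le> L" if "t \<in> time_dom T" for t
      using nn_integral_Lam[OF that] L by (simp add: ennreal_le_iff)
    have 0: "0 \<in> time_dom T" using T0 by (simp add: time_dom_def)
    obtain T1 \<Psi> E K where ext: "T1 > T0" "\<And>t. t \<in> time_dom T \<Longrightarrow> \<Psi> t = \<psi> t"
      "summable (\<lambda>n. dsp s n * (E n)\<^sup>2)" "\<And>t n. t \<in> {0..T1} \<Longrightarrow> \<bar>\<Psi> t n\<bar> \<le> E n"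
      "\<And>t n. t \<in> {0..T1} \<Longrightarrow> \<bar>Gs (\<Psi> t) n\<bar> \<le> K * E n"
      "\<And>t n. t \<in> {0..T1} \<Longrightarrow>
        ((\<lambda>t. \<Psi> t n) has_real_derivative (Gs (\<Psi> t) n - d n * \<Psi> t n)) (at t within {0..T1})"
      by (rule extension[OF T0 s sm[OF 0] Lam]) (assumption | rule that)+
    \<comment> \<open>The field built from the prolonged coefficients solves the equation on a
      longer interval and agrees with \<open>u\<close> before \<open>T\<close>, against
      maximality.\<close>
    have "sol (ereal T1) (\<lambda>t. usym (\<Psi> t))"
      by (rule solution[OF ext(3-6)])
    moreover have "T < ereal T1" using ext(1) T0 by simp
    moreover have "\<forall>t\<in>time_dom T. usym (\<Psi> t) = u t" using ext(2) u by simp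
    ultimately show False using max unfolding maximal_solution_def by blast
  qed
  show ?thesis
  proof (intro conjI ballI impI)
    fix t assume t: "t \<in> time_dom T"
    note dt = decay_\<psi>[OF t]
    show "(u t has_derivative
        (\<lambda>h. (lam t *\<^sub>R vector [vector [0, -1, -1], vector [-1, 0, -1], vector [-1, -1, 0]] :: real^3^3) *v h)) (at 0)"
      unfolding u[OF t] lam_eq[OF t] by (rule usym_gradient_0[OF dt])
    show "summable (\<lambda>n. \<psi> t n * (sqrt 3 ^ n / sqrt (1 + 2/3 * (3/4) ^ n)))" by (rule lamf_eq(1)[OF dt])
    show "lam t \<ge> 0" unfolding lam_eq[OF t] by (rule lam_nonneg[OF t])
    show "seq_norm_summable 1 (\<psi> t)" by (rule decay_H1(1)[OF dt])
    show "set_integrable lebesgue {0..t} lam" using lam_int[OF t] by blast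
    show "(seq_norm 1 (\<psi> t))\<^sup>2 \<le> (seq_norm 1 (\<psi> 0))\<^sup>2 * exp (sqrt 5 / (3 * sqrt 3) * (LINT \<tau>:{0..t}|lebesgue. lam \<tau>))"
      using energy_inequality[OF t] lam_int[OF t] by simp
  qed (rule blowup)
qed

theorem theorem2p4:
  fixes \<nu> \<alpha> s :: real and T :: ereal and u :: "real \<Rightarrow> vfield"
    and \<psi> :: "real \<Rightarrow> nat \<Rightarrow> real" and lam :: "real \<Rightarrow> real"
  assumes s: "s > 5/2"
    and sol: "(\<nu> > 0 \<and> \<alpha> > 0 \<and> maximal_solution (nse_solution \<nu> \<alpha> s) T u)
              \<or> maximal_solution (euler_solution s) T u"
    and sym: "\<forall>t\<in>time_dom T. odd_field (u t) \<and> permutation_symmetric (u t) \<and> mirror_symmetric (u t)"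
    and psi: "\<And>t. \<psi> t = sym_coeffs (u t)"
    and lam: "\<And>t. lam t = 12 * sqrt 2 * pi * (\<Sum>n. \<psi> t n * (sqrt 3 ^ n / sqrt (1 + 2/3 * (3/4) ^ n)))"
    and nonneg: "\<forall>n. \<psi> 0 n \<ge> 0"
  shows "(\<forall>t\<in>time_dom T.
           (u t has_derivative
              (\<lambda>h. (lam t *\<^sub>R vector [vector [0, -1, -1], vector [-1, 0, -1], vector [-1, -1, 0]] :: real^3^3) *v h))
             (at 0)
           \<and> summable (\<lambda>n. \<psi> t n * (sqrt 3 ^ n / sqrt (1 + 2/3 * (3/4) ^ n)))
           \<and> lam t \<ge> 0)
       \<and> (\<forall>t\<in>time_dom T.
           seq_norm_summable 1 (\<psi> t)
           \<and> set_integrable lebesgue {0..t} lam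
           \<and> (seq_norm 1 (\<psi> t))\<^sup>2
               \<le> (seq_norm 1 (\<psi> 0))\<^sup>2 * exp (sqrt 5 / (3 * sqrt 3) * (LINT \<tau>:{0..t}|lebesgue. lam \<tau>)))
       \<and> (T < \<infinity> \<longrightarrow> (\<integral>\<^sup>+ \<tau> \<in> time_dom T. ennreal (lam \<tau>) \<partial>lebesgue) = \<infinity>)"
  using sol
proof (elim disjE conjE)
  assume \<nu>: "\<nu> > 0" and max: "maximal_solution (nse_solution \<nu> \<alpha> s) T u"
  have nse: "nse_solution \<nu> \<alpha> s T u" using max by (simp add: maximal_solution_def)
  show ?thesis
  proof (rule shell_solution_properties[OF s max _ psi lam, where d = "\<lambda>n. \<nu> * dsp \<alpha> n"])
    show "cont_path s T u" using nse by (simp add: nse_solution_def)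
    show "((\<lambda>\<tau>. \<psi> \<tau> n) has_real_derivative (Gs (\<psi> t) n - \<nu> * dsp \<alpha> n * \<psi> t n)) (at t within time_dom T)"
      if "\<And>t. t \<in> time_dom T \<Longrightarrow> summable (\<lambda>n. dsp s n * (\<psi> t n)\<^sup>2)"
        "\<And>t. t \<in> time_dom T \<Longrightarrow> u t = usym (\<psi> t)" "t \<in> time_dom T" for t n
      by (rule nse_ode[OF s less_imp_le[OF \<nu>] nse that])
    show "nse_solution \<nu> \<alpha> s (ereal T1) (\<lambda>t. usym (\<Psi> t))"
      if "summable (\<lambda>n. dsp s n * (E n)\<^sup>2)" "\<And>t n. t \<in> {0..T1} \<Longrightarrow> \<bar>\<Psi> t n\<bar> \<le> E n"
        "\<And>t n. t \<in> {0..T1} \<Longrightarrow> \<bar>Gs (\<Psi> t) n\<bar> \<le> K * E n"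
        "\<And>t n. t \<in> {0..T1} \<Longrightarrow>
          ((\<lambda>t. \<Psi> t n) has_real_derivative (Gs (\<Psi> t) n - \<nu> * dsp \<alpha> n * \<Psi> t n)) (at t within {0..T1})"
      for T1 \<Psi> E K
      by (rule nse_from_coeffs[OF s that(1-3) less_imp_le[OF \<nu>] that(4)])
  qed (use sym nonneg \<nu> in \<open>auto simp: less_imp_le\<close>)
next
  assume max: "maximal_solution (euler_solution s) T u"
  have euler: "euler_solution s T u" using max by (simp add: maximal_solution_def)
  show ?thesis
  proof (rule shell_solution_properties[OF s max _ psi lam, where d = "\<lambda>n. 0"])
    show "cont_path s T u" using euler by (simp add: euler_solution_def)
    show "((\<lambda>\<tau>. \<psi> \<tau> n) has_real_derivative (Gs (\<psi> t) n - 0 * \<psi> t n)) (at t within time_dom T)"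
      if "\<And>t. t \<in> time_dom T \<Longrightarrow> summable (\<lambda>n. dsp s n * (\<psi> t n)\<^sup>2)"
        "\<And>t. t \<in> time_dom T \<Longrightarrow> u t = usym (\<psi> t)" "t \<in> time_dom T" for t n
      using euler_ode[OF s euler that] by simp
    show "euler_solution s (ereal T1) (\<lambda>t. usym (\<Psi> t))"
      if "summable (\<lambda>n. dsp s n * (E n)\<^sup>2)" "\<And>t n. t \<in> {0..T1} \<Longrightarrow> \<bar>\<Psi> t n\<bar> \<le> E n"
        "\<And>t n. t \<in> {0..T1} \<Longrightarrow> \<bar>Gs (\<Psi> t) n\<bar> \<le> K * E n"
        "\<And>t n. t \<in> {0..T1} \<Longrightarrow>
          ((\<lambda>t. \<Psi> t n) has_real_derivative (Gs (\<Psi> t) n - 0 * \<Psi> t n)) (at t within {0..T1})"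
      for T1 \<Psi> E K
      by (rule euler_from_coeffs[OF s that(1-3) that(4)[unfolded mult_zero_left diff_zero]])
  qed (use sym nonneg in auto)
qed

end
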